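(* Let $n\ge1$ and let $R$ be a left $n$-gr-coherent graded ring. (1) If $l.n\text{-}\mathrm{FP}\text{-}\mathrm{gr}\text{-}\mathrm{dim}(R)<\infty$, then every Gorenstein $n$-FP-gr-injective module in $R$-gr is $n$-FP-gr-injective. (2) If $r.n\text{-}\mathrm{gr}\text{-}\mathrm{dim}(R)<\infty$, then every Gorenstein $n$-gr-flat module in gr-$R$ is $n$-gr-flat.
   Context: Let $G$ be a group and $R=\bigoplus_{\sigma\in G}R_\sigma$ a $G$-graded associative ring with identity ($R_\sigma R_\tau\subseteq R_{\sigma\tau}$). $R$-gr (resp. gr-$R$) is the category of graded left (resp. right) $R$-modules with degree-preserving $R$-linear maps. For $M,N$ in $R$-gr, $\mathrm{HOM}_R(M,N)=\bigoplus_{\sigma\in G}\mathrm{HOM}_R(M,N)_\sigma$, where $\mathrm{HOM}_R(M,N)_\sigma$ is the group of $R$-linear maps $f$ with $f(M_\tau)\subseteq N_{\tau\sigma}$ for all $\tau$; $\mathrm{EXT}^i_R$ are the right derived functors of $\mathrm{HOM}_R$. $\mathrm{gr}\text{-}\mathrm{pd}_R$ and $\mathrm{gr}\text{-}\mathrm{fd}_R$ are the gr-projective and gr-flat dimensions of graded modules. A graded left module $U$ is $m$-presented if there is an exact sequence $F_m\to F_{m-1}\to\cdots\to F_0\to U\to 0$ in $R$-gr with each $F_i$ a finitely generated free (graded free, i.e. a finite direct sum of suspensions of $R$) left $R$-module. $R$ is left $n$-gr-coherent if every $n$-presented module in $R$-gr is $(n+1)$-presented. Fix $n\ge1$. Given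 such a sequence with $m=n$, put $K_{n-1}=\mathrm{Im}(F_{n-1}\to F_{n-2})$ (with $F_{-1}=U$ when $n=1$); modules $K_{n-1}$ arising in this way from $n$-presented graded left modules $U$ are called special gr-presented. A graded left module $M$ is $n$-FP-gr-injective if $\mathrm{EXT}^n_R(U,M)=0$ for every $n$-presented graded left module $U$. A graded right module $N$ is $n$-gr-flat if $\mathrm{Tor}_n^R(N,U)=0$ for every $n$-presented graded left module $U$. A module $M$ in $R$-gr is Gorenstein $n$-FP-gr-injective if there is an exact sequence $\mathbf{A}=\cdots\to A_1\to A_0\to A^0\to A^1\to\cdots$ of $n$-FP-gr-injective modules in $R$-gr with $M=\ker(A^0\to A^1)$ such that $\mathrm{HOM}_R(K_{n-1},\mathbf{A})$ is exact for every special gr-presented $K_{n-1}$ in $R$-gr with $\mathrm{gr}\text{-}\mathrm{pd}_R(K_{n-1})<\infty$. A module $N$ in gr-$R$ is Gorenstein $n$-gr-flat if there is an exact sequence $\mathbf{F}=\cdots\to F_1\to F_0\to F^0\to F^1\to\cdots$ of $n$-gr-flat modules in gr-$R$ with $N=\ker(F^0\to F^1)$ such that $\mathbf{F}\otimes_R K_{n-1}$ is exact for every special gr-presented $K_{n-1}$ in $R$-gr with $\mathrm{gr}\text{-}\mathrm{fd}_R(K_{n-1})<\infty$. For a graded left module $M$, $n.\mathrm{FP}\text{-}\mathrm{gr}\text{-}\mathrm{id}_R(M)$ is the least integer $k\ge0$ such that $\mathrm{EXT}_R^{k+1}(K_{n-1},M)=0$ for every special gr-presented $K_{n-1}$ in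 $R$-gr; for a graded right module $M$, $n\text{-}\mathrm{gr}\text{-}\mathrm{fd}_R(M)$ is the least integer $k\ge0$ such that $\mathrm{Tor}^R_{k+1}(M,K_{n-1})=0$ for every special gr-presented $K_{n-1}$ in $R$-gr (each is $\infty$ if no such $k$ exists). Then $l.n\text{-}\mathrm{FP}\text{-}\mathrm{gr}\text{-}\mathrm{dim}(R)=\sup\{n.\mathrm{FP}\text{-}\mathrm{gr}\text{-}\mathrm{id}_R(M): M\text{ a graded left module}\}$ and $r.n\text{-}\mathrm{gr}\text{-}\mathrm{dim}(R)=\sup\{n\text{-}\mathrm{gr}\text{-}\mathrm{fd}_R(M): M\text{ a graded right module}\}$. *)

theory Defs
  imports "HOL-Algebra.AbelCoset" "HOL-Algebra.Module" "HOL-Algebra.Free_Abelian_Groups" "HOL-Library.Extended_Nat"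
begin

section \<open>Graded rings and graded modules\<close>

record ('g, 'r) gr_ring = "'r ring" +
  rgrade :: "'g \<Rightarrow> 'r set"

text \<open>
  The record serves left and right modules alike: for a right module, \<open>smult M r x\<close> stands for
  \<open>x \<cdot> r\<close>.  The inherited fields \<open>mult\<close> and \<open>one\<close> of the ring record carry no meaning.
  The locale \<open>module\<close> of the library is not used because it requires a commutative ring.
\<close>

record ('g, 'r, 'm) gr_module = "('r, 'm) module" +
  mgrade :: "'g \<Rightarrow> 'm set"

text \<open>Internal direct sum decomposition of the additive group of \<open>M\<close> into the \<open>D \<sigma>\<close>.\<close>

definition graded_by ::
    "'g set \<Rightarrow> ('m, 'x) ring_scheme \<Rightarrow> ('g \<Rightarrow> 'm set) \<Rightarrow> bool" where
  "graded_by I M D \<longleftrightarrow>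
     (\<forall>\<sigma>\<in>I. additive_subgroup (D \<sigma>) M) \<and>
     (\<forall>x\<in>carrier M. \<exists>!f. f \<in> (\<Pi>\<^sub>E \<sigma>\<in>I. D \<sigma>) \<and> finite {\<sigma>\<in>I. f \<sigma> \<noteq> \<zero>\<^bsub>M\<^esub>} \<and>
        x = finsum M f {\<sigma>\<in>I. f \<sigma> \<noteq> \<zero>\<^bsub>M\<^esub>})"

definition graded_ring :: "'g monoid \<Rightarrow> ('g, 'r) gr_ring \<Rightarrow> bool" where
  "graded_ring G R \<longleftrightarrow>
     group G \<and> ring R \<and> graded_by (carrier G) R (rgrade R) \<and>
     (\<forall>\<sigma>\<in>carrier G. \<forall>\<tau>\<in>carrier G. \<forall>a\<in>rgrade R \<sigma>. \<forall>b\<in>rgrade R \<tau>.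
        a \<otimes>\<^bsub>R\<^esub> b \<in> rgrade R (\<sigma> \<otimes>\<^bsub>G\<^esub> \<tau>))"

definition pre_module :: "('g, 'r) gr_ring \<Rightarrow> ('g, 'r, 'm) gr_module \<Rightarrow> bool" where
  "pre_module R M \<longleftrightarrow>
     abelian_group M \<and>
     (\<forall>a\<in>carrier R. \<forall>x\<in>carrier M. smult M a x \<in> carrier M) \<and>
     (\<forall>a\<in>carrier R. \<forall>b\<in>carrier R. \<forall>x\<in>carrier M.
        smult M (a \<oplus>\<^bsub>R\<^esub> b) x = smult M a x \<oplus>\<^bsub>M\<^esub> smult M b x) \<and>
     (\<forall>a\<in>carrier R. \<forall>x\<in>carrier M. \<forall>y\<in>carrier M.
        smult M a (x \<oplus>\<^bsub>M\<^esub> y) = smult M a x \<oplus>\<^bsub>M\<^esub> smult M a y) \<and>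
     (\<forall>x\<in>carrier M. smult M \<one>\<^bsub>R\<^esub> x = x)"

definition left_gr_module :: "'g monoid \<Rightarrow> ('g, 'r) gr_ring \<Rightarrow> ('g, 'r, 'm) gr_module \<Rightarrow> bool" where
  "left_gr_module G R M \<longleftrightarrow>
     pre_module R M \<and>
     (\<forall>a\<in>carrier R. \<forall>b\<in>carrier R. \<forall>x\<in>carrier M.
        smult M (a \<otimes>\<^bsub>R\<^esub> b) x = smult M a (smult M b x)) \<and>
     graded_by (carrier G) M (mgrade M) \<and>
     (\<forall>\<sigma>\<in>carrier G. \<forall>\<tau>\<in>carrier G. \<forall>a\<in>rgrade R \<sigma>. \<forall>x\<in>mgrade M \<tau>.
        smult M a x \<in> mgrade M (\<sigma> \<otimes>\<^bsub>G\<^esub> \<tau>))"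

definition right_gr_module :: "'g monoid \<Rightarrow> ('g, 'r) gr_ring \<Rightarrow> ('g, 'r, 'm) gr_module \<Rightarrow> bool" where
  "right_gr_module G R M \<longleftrightarrow>
     pre_module R M \<and>
     (\<forall>a\<in>carrier R. \<forall>b\<in>carrier R. \<forall>x\<in>carrier M.
        smult M (a \<otimes>\<^bsub>R\<^esub> b) x = smult M b (smult M a x)) \<and>
     graded_by (carrier G) M (mgrade M) \<and>
     (\<forall>\<sigma>\<in>carrier G. \<forall>\<tau>\<in>carrier G. \<forall>a\<in>rgrade R \<sigma>. \<forall>x\<in>mgrade M \<tau>.
        smult M a x \<in> mgrade M (\<tau> \<otimes>\<^bsub>G\<^esub> \<sigma>))"

definition lin_map ::
    "('g, 'r) gr_ring \<Rightarrow> ('g, 'r, 'm) gr_module \<Rightarrow> ('g, 'r, 'k) gr_module \<Rightarrow> ('m \<Rightarrow> 'k) \<Rightarrow> bool" where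
  "lin_map R M N f \<longleftrightarrow>
     f \<in> carrier M \<rightarrow> carrier N \<and>
     (\<forall>x\<in>carrier M. \<forall>y\<in>carrier M. f (x \<oplus>\<^bsub>M\<^esub> y) = f x \<oplus>\<^bsub>N\<^esub> f y) \<and>
     (\<forall>a\<in>carrier R. \<forall>x\<in>carrier M. f (smult M a x) = smult N a (f x))"

definition gr_hom ::
    "'g monoid \<Rightarrow> ('g, 'r) gr_ring \<Rightarrow> ('g, 'r, 'm) gr_module \<Rightarrow> ('g, 'r, 'k) gr_module
      \<Rightarrow> ('m \<Rightarrow> 'k) \<Rightarrow> bool" where
  "gr_hom G R M N f \<longleftrightarrow>
     lin_map R M N f \<and> (\<forall>\<sigma>\<in>carrier G. f ` mgrade M \<sigma> \<subseteq> mgrade N \<sigma>)"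

definition gr_isomorphic ::
    "'g monoid \<Rightarrow> ('g, 'r) gr_ring \<Rightarrow> ('g, 'r, 'm) gr_module \<Rightarrow> ('g, 'r, 'k) gr_module \<Rightarrow> bool" where
  "gr_isomorphic G R M N \<longleftrightarrow> (\<exists>f. gr_hom G R M N f \<and> bij_betw f (carrier M) (carrier N))"

definition gr_image ::
    "('g, 'r, 'm) gr_module \<Rightarrow> ('g, 'r, 'k) gr_module \<Rightarrow> ('m \<Rightarrow> 'k) \<Rightarrow> ('g, 'r, 'k) gr_module" where
  "gr_image M N f =
     N\<lparr>carrier := f ` carrier M, mgrade := (\<lambda>\<sigma>. mgrade N \<sigma> \<inter> f ` carrier M)\<rparr>"

text \<open>
  The direct sum over \<open>b \<in> B\<close> of the suspensions \<open>R(\<delta> b)\<close>, where \<open>R(\<delta>)\<^sub>\<sigma> = R\<^sub>\<sigma>\<^sub>\<delta>\<close>,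
  as a left module of finitely supported functions.
\<close>

definition gr_free ::
    "'g monoid \<Rightarrow> ('g, 'r) gr_ring \<Rightarrow> 'b set \<Rightarrow> ('b \<Rightarrow> 'g) \<Rightarrow> ('g, 'r, 'b \<Rightarrow> 'r) gr_module" where
  "gr_free G R B \<delta> =
     (let C = {f. (\<forall>b\<in>B. f b \<in> carrier R) \<and> (\<forall>b. b \<notin> B \<longrightarrow> f b = \<zero>\<^bsub>R\<^esub>) \<and>
                  finite {b. f b \<noteq> \<zero>\<^bsub>R\<^esub>}}
      in \<lparr>carrier = C, monoid.mult = (\<lambda>_ _. undefined), one = undefined,
          ring.zero = (\<lambda>_. \<zero>\<^bsub>R\<^esub>), ring.add = (\<lambda>f g b. f b \<oplus>\<^bsub>R\<^esub> g b),
          module.smult = (\<lambda>a f b. a \<otimes>\<^bsub>R\<^esub> f b),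
          mgrade = (\<lambda>\<sigma>. {f \<in> C. \<forall>b\<in>B. f b \<in> rgrade R (\<sigma> \<otimes>\<^bsub>G\<^esub> \<delta> b)})\<rparr>)"

definition fg_gr_free :: "'g monoid \<Rightarrow> ('g, 'r) gr_ring \<Rightarrow> ('g, 'r, 'm) gr_module \<Rightarrow> bool" where
  "fg_gr_free G R F \<longleftrightarrow>
     left_gr_module G R F \<and>
     (\<exists>(k::nat) \<delta>. \<delta> \<in> {..<k} \<rightarrow> carrier G \<and> gr_isomorphic G R F (gr_free G R {..<k} \<delta>))"


section \<open>The abelian groups HOM and tensor product\<close>

definition HOM_deg ::
    "'g monoid \<Rightarrow> ('g, 'r) gr_ring \<Rightarrow> ('g, 'r, 'm) gr_module \<Rightarrow> ('g, 'r, 'k) gr_module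
      \<Rightarrow> 'g \<Rightarrow> ('m \<Rightarrow> 'k) set" where
  "HOM_deg G R M N \<sigma> =
     {f \<in> extensional (carrier M). lin_map R M N f \<and>
        (\<forall>\<tau>\<in>carrier G. f ` mgrade M \<tau> \<subseteq> mgrade N (\<tau> \<otimes>\<^bsub>G\<^esub> \<sigma>))}"

text \<open>The direct sum of the \<open>HOM_deg G R M N \<sigma>\<close>, formed inside the group of all linear maps.\<close>

definition HOM ::
    "'g monoid \<Rightarrow> ('g, 'r) gr_ring \<Rightarrow> ('g, 'r, 'm) gr_module \<Rightarrow> ('g, 'r, 'k) gr_module
      \<Rightarrow> ('m \<Rightarrow> 'k) monoid" where
  "HOM G R M N =
     \<lparr>carrier = {f. \<exists>S h. finite S \<and> S \<subseteq> carrier G \<and> (\<forall>\<sigma>\<in>S. h \<sigma> \<in> HOM_deg G R M N \<sigma>) \<and>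
                   f = (\<lambda>x\<in>carrier M. finsum N (\<lambda>\<sigma>. h \<sigma> x) S)},
      monoid.mult = (\<lambda>f g. \<lambda>x\<in>carrier M. f x \<oplus>\<^bsub>N\<^esub> g x),
      one = (\<lambda>x\<in>carrier M. \<zero>\<^bsub>N\<^esub>)\<rparr>"

definition tensor_relators ::
    "('g, 'r) gr_ring \<Rightarrow> ('g, 'r, 'm) gr_module \<Rightarrow> ('g, 'r, 'k) gr_module
      \<Rightarrow> (('m \<times> 'k) \<Rightarrow>\<^sub>0 int) set" where
  "tensor_relators R M N =
     {frag_of (x \<oplus>\<^bsub>M\<^esub> x', y) - frag_of (x, y) - frag_of (x', y) | x x' y.
        x \<in> carrier M \<and> x' \<in> carrier M \<and> y \<in> carrier N} \<union>
     {frag_of (x, y \<oplus>\<^bsub>N\<^esub> y') - frag_of (x, y) - frag_of (x, y') | x y y'.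
        x \<in> carrier M \<and> y \<in> carrier N \<and> y' \<in> carrier N} \<union>
     {frag_of (smult M a x, y) - frag_of (x, smult N a y) | a x y.
        a \<in> carrier R \<and> x \<in> carrier M \<and> y \<in> carrier N}"

definition tensor_rel ::
    "('g, 'r) gr_ring \<Rightarrow> ('g, 'r, 'm) gr_module \<Rightarrow> ('g, 'r, 'k) gr_module
      \<Rightarrow> (('m \<times> 'k) \<Rightarrow>\<^sub>0 int) set" where
  "tensor_rel R M N =
     generate (free_Abelian_group (carrier M \<times> carrier N)) (tensor_relators R M N)"

text \<open>\<open>M\<close> is a right module and \<open>N\<close> a left module.\<close>

definition tensor ::
    "('g, 'r) gr_ring \<Rightarrow> ('g, 'r, 'm) gr_module \<Rightarrow> ('g, 'r, 'k) gr_module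
      \<Rightarrow> (('m \<times> 'k) \<Rightarrow>\<^sub>0 int) set monoid" where
  "tensor R M N = free_Abelian_group (carrier M \<times> carrier N) Mod tensor_rel R M N"

text \<open>
  The map \<open>f \<otimes> g\<close> from \<open>tensor R M N\<close> to \<open>tensor R M' N'\<close>; the union is over representatives
  of one coset, and its members coincide when \<open>f\<close> and \<open>g\<close> are linear.
\<close>

definition tensor_map ::
    "('g, 'r) gr_ring \<Rightarrow> ('g, 'r, 'm) gr_module \<Rightarrow> ('g, 'r, 'k) gr_module \<Rightarrow> ('a \<Rightarrow> 'm) \<Rightarrow> ('b \<Rightarrow> 'k)
      \<Rightarrow> (('a \<times> 'b) \<Rightarrow>\<^sub>0 int) set \<Rightarrow> (('m \<times> 'k) \<Rightarrow>\<^sub>0 int) set" where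
  "tensor_map R M' N' f g X =
     \<Union> ((\<lambda>c. r_coset (free_Abelian_group (carrier M' \<times> carrier N')) (tensor_rel R M' N')
                  (frag_extend (\<lambda>(x, y). frag_of (f x, g y)) c)) ` X)"


section \<open>Resolutions and the derived functors EXT and Tor\<close>

text \<open>
  HOL has no type of all modules, so the modules occurring in a resolution of a module with elements
  of type \<open>'m\<close> need a type that is large enough.  In the type below a free resolution always exists:
  the elements of \<open>M\<close> serve as basis elements of \<open>P 0\<close> (via \<open>Elt\<close>), and an element of
  \<open>P i\<close>, being a linear combination of basis elements, can serve as basis element of
  \<open>P (i + 1)\<close> (via \<open>Comb\<close>).
\<close>

datatype ('m, 'r) syz = Elt 'm | Comb "(('m, 'r) syz \<times> 'r) list"

type_synonym ('m, 'r) univ = "('m, 'r) syz \<Rightarrow> 'r"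

definition gr_resolution ::
    "'g monoid \<Rightarrow> ('g, 'r) gr_ring \<Rightarrow> ('g, 'r, 'm) gr_module
      \<Rightarrow> (nat \<Rightarrow> ('g, 'r, 'k) gr_module) \<Rightarrow> (nat \<Rightarrow> 'k \<Rightarrow> 'k) \<Rightarrow> ('k \<Rightarrow> 'm) \<Rightarrow> bool" where
  "gr_resolution G R M P d \<epsilon> \<longleftrightarrow>
     (\<forall>i. left_gr_module G R (P i)) \<and>
     (\<forall>i. gr_hom G R (P (Suc i)) (P i) (d i)) \<and>
     gr_hom G R (P 0) M \<epsilon> \<and>
     \<epsilon> ` carrier (P 0) = carrier M \<and>
     d 0 ` carrier (P 1) = a_kernel (P 0) M \<epsilon> \<and>
     (\<forall>i. d (Suc i) ` carrier (P (Suc (Suc i))) = a_kernel (P (Suc i)) (P i) (d i))"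

definition gr_free_resolution ::
    "'g monoid \<Rightarrow> ('g, 'r) gr_ring \<Rightarrow> ('g, 'r, 'm) gr_module
      \<Rightarrow> (nat \<Rightarrow> ('g, 'r, 'b \<Rightarrow> 'r) gr_module) \<Rightarrow> (nat \<Rightarrow> ('b \<Rightarrow> 'r) \<Rightarrow> ('b \<Rightarrow> 'r))
      \<Rightarrow> (('b \<Rightarrow> 'r) \<Rightarrow> 'm) \<Rightarrow> bool" where
  "gr_free_resolution G R M P d \<epsilon> \<longleftrightarrow>
     gr_resolution G R M P d \<epsilon> \<and>
     (\<forall>i. \<exists>B \<delta>. \<delta> \<in> B \<rightarrow> carrier G \<and> P i = gr_free G R B \<delta>)"

definition chosen_resolution ::
    "'g monoid \<Rightarrow> ('g, 'r) gr_ring \<Rightarrow> ('g, 'r, 'm) gr_module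
      \<Rightarrow> (nat \<Rightarrow> ('g, 'r, ('m, 'r) univ) gr_module) \<times> (nat \<Rightarrow> ('m, 'r) univ \<Rightarrow> ('m, 'r) univ)" where
  "chosen_resolution G R M = (SOME (P, d). \<exists>\<epsilon>. gr_free_resolution G R M P d \<epsilon>)"

definition EXT ::
    "'g monoid \<Rightarrow> ('g, 'r) gr_ring \<Rightarrow> nat \<Rightarrow> ('g, 'r, 'm) gr_module \<Rightarrow> ('g, 'r, 'k) gr_module
      \<Rightarrow> (('m, 'r) univ \<Rightarrow> 'k) set monoid" where
  "EXT G R i M N =
     (let (P, d) = chosen_resolution G R M;
          C = (\<lambda>j. HOM G R (P j) N);
          D = (\<lambda>j f. compose (carrier (P (Suc j))) f (d j));
          Z = kernel (C i) (C (Suc i)) (D i);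
          B = (case i of 0 \<Rightarrow> {\<one>\<^bsub>C 0\<^esub>} | Suc j \<Rightarrow> D j ` carrier (C j))
      in (C i)\<lparr>carrier := Z\<rparr> Mod B)"

text \<open>\<open>N\<close> is a right module and \<open>M\<close> a left module.\<close>

definition Tor ::
    "'g monoid \<Rightarrow> ('g, 'r) gr_ring \<Rightarrow> nat \<Rightarrow> ('g, 'r, 'k) gr_module \<Rightarrow> ('g, 'r, 'm) gr_module
      \<Rightarrow> (('k \<times> ('m, 'r) univ) \<Rightarrow>\<^sub>0 int) set set monoid" where
  "Tor G R i N M =
     (let (P, d) = chosen_resolution G R M;
          C = (\<lambda>j. tensor R N (P j));
          D = (\<lambda>j. tensor_map R N (P j) (\<lambda>x. x) (d j));
          Z = (case i of 0 \<Rightarrow> carrier (C 0) | Suc j \<Rightarrow> kernel (C i) (C j) (D j));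
          B = D i ` carrier (C (Suc i))
      in (C i)\<lparr>carrier := Z\<rparr> Mod B)"


section \<open>Finitely presented modules and coherence\<close>

text \<open>
  Up to isomorphism, every finitely generated graded module, and every submodule of one, has its
  elements in this type, as cosets of a submodule of some \<open>R\<^sup>k\<close>.
\<close>

type_synonym 'r fin_univ = "(nat \<Rightarrow> 'r) set"

text \<open>
  An exact sequence \<open>F\<^sub>m \<rightarrow> \<dots> \<rightarrow> F\<^sub>0 \<rightarrow> U \<rightarrow> 0\<close> with \<open>U = X 0\<close> and
  \<open>F\<^sub>i = X (i + 1)\<close>, so that \<open>F\<^sub>-\<^sub>1 = U\<close> is \<open>X 0\<close>.
\<close>

definition gr_presentation ::
    "'g monoid \<Rightarrow> ('g, 'r) gr_ring \<Rightarrow> nat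
      \<Rightarrow> (nat \<Rightarrow> ('g, 'r, 'u) gr_module) \<Rightarrow> (nat \<Rightarrow> 'u \<Rightarrow> 'u) \<Rightarrow> bool" where
  "gr_presentation G R m X d \<longleftrightarrow>
     left_gr_module G R (X 0) \<and>
     (\<forall>i\<le>m. fg_gr_free G R (X (Suc i))) \<and>
     (\<forall>i\<le>m. gr_hom G R (X (Suc i)) (X i) (d i)) \<and>
     d 0 ` carrier (X 1) = carrier (X 0) \<and>
     (\<forall>i<m. d (Suc i) ` carrier (X (Suc (Suc i))) = a_kernel (X (Suc i)) (X i) (d i))"

definition gr_presented ::
    "'g monoid \<Rightarrow> ('g, 'r) gr_ring \<Rightarrow> nat \<Rightarrow> ('g, 'r, 'r fin_univ) gr_module \<Rightarrow> bool" where
  "gr_presented G R m U \<longleftrightarrow> (\<exists>X d. gr_presentation G R m X d \<and> X 0 = U)"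

definition left_gr_coherent :: "'g monoid \<Rightarrow> ('g, 'r) gr_ring \<Rightarrow> nat \<Rightarrow> bool" where
  "left_gr_coherent G R n \<longleftrightarrow>
     (\<forall>U. gr_presented G R n U \<longrightarrow> gr_presented G R (Suc n) U)"

definition special_gr_presented ::
    "'g monoid \<Rightarrow> ('g, 'r) gr_ring \<Rightarrow> nat \<Rightarrow> ('g, 'r, 'r fin_univ) gr_module \<Rightarrow> bool" where
  "special_gr_presented G R n K \<longleftrightarrow>
     (\<exists>X d. gr_presentation G R n X d \<and> K = gr_image (X n) (X (n - 1)) (d (n - 1)))"


section \<open>Projective and flat dimension\<close>

text \<open>
  Lifting against epimorphisms between modules in \<open>('p, 'r) univ\<close> suffices, since that type
  accommodates a free module mapping onto \<open>P\<close> as well as a copy of \<open>P\<close>.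
\<close>

definition gr_projective :: "'g monoid \<Rightarrow> ('g, 'r) gr_ring \<Rightarrow> ('g, 'r, 'p) gr_module \<Rightarrow> bool" where
  "gr_projective G R P \<longleftrightarrow>
     left_gr_module G R P \<and>
     (\<forall>(M :: ('g, 'r, ('p, 'r) univ) gr_module) (N :: ('g, 'r, ('p, 'r) univ) gr_module) p f.
        left_gr_module G R M \<and> left_gr_module G R N \<and>
        gr_hom G R M N p \<and> p ` carrier M = carrier N \<and> gr_hom G R P N f \<longrightarrow>
        (\<exists>h. gr_hom G R P M h \<and> (\<forall>x\<in>carrier P. p (h x) = f x)))"

definition gr_pd :: "'g monoid \<Rightarrow> ('g, 'r) gr_ring \<Rightarrow> ('g, 'r, 'm) gr_module \<Rightarrow> enat" where
  "gr_pd G R M =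
     Inf {enat k | k. \<exists>(P :: nat \<Rightarrow> ('g, 'r, ('m, 'r) univ) gr_module) d \<epsilon>.
            gr_resolution G R M P d \<epsilon> \<and> (\<forall>i. gr_projective G R (P i)) \<and>
            (\<forall>i>k. carrier (P i) = {\<zero>\<^bsub>P i\<^esub>})}"

text \<open>
  \<open>- \<otimes> F\<close> preserves monomorphisms.  Up to isomorphism \<open>'r fin_univ\<close> contains the graded right
  ideals of \<open>R\<close> and their suspensions, which are known to suffice as tests.
\<close>

definition gr_flat :: "'g monoid \<Rightarrow> ('g, 'r) gr_ring \<Rightarrow> ('g, 'r, 'm) gr_module \<Rightarrow> bool" where
  "gr_flat G R F \<longleftrightarrow>
     left_gr_module G R F \<and>
     (\<forall>(N' :: ('g, 'r, 'r fin_univ) gr_module) (N :: ('g, 'r, 'r fin_univ) gr_module) f.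
        right_gr_module G R N' \<and> right_gr_module G R N \<and>
        gr_hom G R N' N f \<and> inj_on f (carrier N') \<longrightarrow>
        inj_on (tensor_map R N F f (\<lambda>x. x)) (carrier (tensor R N' F)))"

definition gr_fd :: "'g monoid \<Rightarrow> ('g, 'r) gr_ring \<Rightarrow> ('g, 'r, 'm) gr_module \<Rightarrow> enat" where
  "gr_fd G R M =
     Inf {enat k | k. \<exists>(P :: nat \<Rightarrow> ('g, 'r, ('m, 'r) univ) gr_module) d \<epsilon>.
            gr_resolution G R M P d \<epsilon> \<and> (\<forall>i. gr_flat G R (P i)) \<and>
            (\<forall>i>k. carrier (P i) = {\<zero>\<^bsub>P i\<^esub>})}"


section \<open>FP-gr-injective and gr-flat modules and their Gorenstein versions\<close>

definition FP_gr_injective ::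
    "'g monoid \<Rightarrow> ('g, 'r) gr_ring \<Rightarrow> nat \<Rightarrow> ('g, 'r, 'm) gr_module \<Rightarrow> bool" where
  "FP_gr_injective G R n M \<longleftrightarrow>
     left_gr_module G R M \<and> (\<forall>U. gr_presented G R n U \<longrightarrow> trivial_group (EXT G R n U M))"

definition n_gr_flat ::
    "'g monoid \<Rightarrow> ('g, 'r) gr_ring \<Rightarrow> nat \<Rightarrow> ('g, 'r, 'm) gr_module \<Rightarrow> bool" where
  "n_gr_flat G R n N \<longleftrightarrow>
     right_gr_module G R N \<and> (\<forall>U. gr_presented G R n U \<longrightarrow> trivial_group (Tor G R n N U))"

text \<open>
  In the two-sided complexes below \<open>A\<^sup>i\<close> is \<open>A i\<close> and \<open>A\<^sub>i\<close> is \<open>A (- i - 1)\<close>.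
  \<open>M\<close> is identified with \<open>ker (A\<^sup>0 \<rightarrow> A\<^sup>1)\<close> along a monomorphism \<open>\<iota>\<close>.
\<close>

definition gr_exact_complex ::
    "'g monoid \<Rightarrow> ('g, 'r) gr_ring \<Rightarrow> (int \<Rightarrow> ('g, 'r, 'm) gr_module) \<Rightarrow> (int \<Rightarrow> 'm \<Rightarrow> 'm) \<Rightarrow> bool" where
  "gr_exact_complex G R A d \<longleftrightarrow>
     (\<forall>i. gr_hom G R (A i) (A (i + 1)) (d i)) \<and>
     (\<forall>i. d i ` carrier (A i) = a_kernel (A (i + 1)) (A (i + 2)) (d (i + 1)))"

definition is_gr_kernel ::
    "'g monoid \<Rightarrow> ('g, 'r) gr_ring \<Rightarrow> ('g, 'r, 'm) gr_module
      \<Rightarrow> ('g, 'r, 'k) gr_module \<Rightarrow> ('g, 'r, 'l) gr_module \<Rightarrow> ('k \<Rightarrow> 'l) \<Rightarrow> bool" where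
  "is_gr_kernel G R M A B f \<longleftrightarrow>
     (\<exists>\<iota>. gr_hom G R M A \<iota> \<and> inj_on \<iota> (carrier M) \<and> \<iota> ` carrier M = a_kernel A B f)"

definition HOM_exact ::
    "'g monoid \<Rightarrow> ('g, 'r) gr_ring \<Rightarrow> ('g, 'r, 'k) gr_module
      \<Rightarrow> (int \<Rightarrow> ('g, 'r, 'm) gr_module) \<Rightarrow> (int \<Rightarrow> 'm \<Rightarrow> 'm) \<Rightarrow> bool" where
  "HOM_exact G R K A d \<longleftrightarrow>
     (\<forall>i. (\<lambda>f. compose (carrier K) (d i) f) ` carrier (HOM G R K (A i)) =
          kernel (HOM G R K (A (i + 1))) (HOM G R K (A (i + 2)))
            (\<lambda>f. compose (carrier K) (d (i + 1)) f))"

definition tensor_exact ::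
    "('g, 'r) gr_ring \<Rightarrow> (int \<Rightarrow> ('g, 'r, 'm) gr_module) \<Rightarrow> (int \<Rightarrow> 'm \<Rightarrow> 'm)
      \<Rightarrow> ('g, 'r, 'k) gr_module \<Rightarrow> bool" where
  "tensor_exact R F d K \<longleftrightarrow>
     (\<forall>i. tensor_map R (F (i + 1)) K (d i) (\<lambda>x. x) ` carrier (tensor R (F i) K) =
          kernel (tensor R (F (i + 1)) K) (tensor R (F (i + 2)) K)
            (tensor_map R (F (i + 2)) K (d (i + 1)) (\<lambda>x. x)))"

definition Gorenstein_FP_gr_injective ::
    "'g monoid \<Rightarrow> ('g, 'r) gr_ring \<Rightarrow> nat \<Rightarrow> ('g, 'r, 'm) gr_module \<Rightarrow> bool" where
  "Gorenstein_FP_gr_injective G R n M \<longleftrightarrow>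
     left_gr_module G R M \<and>
     (\<exists>(A :: int \<Rightarrow> ('g, 'r, 'm) gr_module) d.
        (\<forall>i. FP_gr_injective G R n (A i)) \<and>
        gr_exact_complex G R A d \<and>
        is_gr_kernel G R M (A 0) (A 1) (d 0) \<and>
        (\<forall>K. special_gr_presented G R n K \<and> gr_pd G R K < \<infinity> \<longrightarrow> HOM_exact G R K A d))"

definition Gorenstein_gr_flat ::
    "'g monoid \<Rightarrow> ('g, 'r) gr_ring \<Rightarrow> nat \<Rightarrow> ('g, 'r, 'm) gr_module \<Rightarrow> bool" where
  "Gorenstein_gr_flat G R n N \<longleftrightarrow>
     right_gr_module G R N \<and>
     (\<exists>(F :: int \<Rightarrow> ('g, 'r, 'm) gr_module) d.
        (\<forall>i. n_gr_flat G R n (F i)) \<and>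
        gr_exact_complex G R F d \<and>
        is_gr_kernel G R N (F 0) (F 1) (d 0) \<and>
        (\<forall>K. special_gr_presented G R n K \<and> gr_fd G R K < \<infinity> \<longrightarrow> tensor_exact R F d K))"

definition FP_gr_id ::
    "'g monoid \<Rightarrow> ('g, 'r) gr_ring \<Rightarrow> nat \<Rightarrow> ('g, 'r, 'm) gr_module \<Rightarrow> enat" where
  "FP_gr_id G R n M =
     Inf {enat k | k. \<forall>K. special_gr_presented G R n K \<longrightarrow> trivial_group (EXT G R (k + 1) K M)}"

definition n_gr_fd ::
    "'g monoid \<Rightarrow> ('g, 'r) gr_ring \<Rightarrow> nat \<Rightarrow> ('g, 'r, 'm) gr_module \<Rightarrow> enat" where
  "n_gr_fd G R n M =
     Inf {enat k | k. \<forall>K. special_gr_presented G R n K \<longrightarrow> trivial_group (Tor G R (k + 1) M K)}"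

text \<open>
  The suprema range over the modules with elements in the type \<open>'m\<close>, which stands for an arbitrary
  universe; the Gorenstein notions above draw their complexes from the same universe.  Any given
  complex can be transported to a sufficiently large type.
\<close>

definition l_FP_gr_dim ::
    "'g monoid \<Rightarrow> ('g, 'r) gr_ring \<Rightarrow> nat \<Rightarrow> 'm itself \<Rightarrow> enat" where
  "l_FP_gr_dim G R n _ =
     Sup {FP_gr_id G R n M | M :: ('g, 'r, 'm) gr_module. left_gr_module G R M}"

definition r_gr_dim ::
    "'g monoid \<Rightarrow> ('g, 'r) gr_ring \<Rightarrow> nat \<Rightarrow> 'm itself \<Rightarrow> enat" where
  "r_gr_dim G R n _ =
     Sup {n_gr_fd G R n M | M :: ('g, 'r, 'm) gr_module. right_gr_module G R M}"

end

theory Submission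
  imports Defs
begin

text \<open>
  Let \<open>R\<close> be left \<open>n\<close>-gr-coherent and let \<open>U\<close> be an \<open>n\<close>-presented graded left module.  Coherence prolongs the
  presentation of \<open>U\<close> indefinitely, so \<open>U\<close> has a resolution by finitely generated free modules all of whose
  syzygies \<open>V\<^sub>0 = U, V\<^sub>1, V\<^sub>2, \<dots>\<close> are again \<open>n\<close>-presented, and the syzygy \<open>V\<^sub>j\<^sub>+\<^sub>n\<^sub>-\<^sub>1\<close> is the special gr-presented
  module attached to \<open>V\<^sub>j\<close> (\<open>coherent_syzygy\<close>, \<open>coherent_resolution\<close>).  Since \<open>EXT\<^sup>i(V\<^sub>j, -)\<close> is
  \<open>EXT\<^sup>i\<^sup>+\<^sup>j(U, -)\<close> for \<open>i \<ge> 1\<close>, two facts about the single sequence of functors \<open>EXT\<^sup>i(U, -)\<close> follow.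
  An \<open>n\<close>-FP-gr-injective module annihilates it in all degrees \<open>i \<ge> n\<close>.  And if \<open>l.n-FP-gr-dim(R)\<close> is at most \<open>b\<close>, then
  every graded left module annihilates it in degree \<open>n + b + 1\<close>.

  Now let \<open>M\<close> be the module of cycles at \<open>A\<^sup>0\<close> in an exact complex \<open>A\<close> of \<open>n\<close>-FP-gr-injective modules.  The
  complex is spliced from short exact sequences \<open>0 \<rightarrow> Z\<^sub>s \<rightarrow> A\<^sub>s \<rightarrow> Z\<^sub>s\<^sub>+\<^sub>1 \<rightarrow> 0\<close> of modules of cycles.  The long exact
  sequence passes the vanishing of \<open>EXT\<^sup>i\<^sup>+\<^sup>1(U, Z\<^sub>s)\<close> on to \<open>EXT\<^sup>i(U, Z\<^sub>s\<^sub>+\<^sub>1)\<close> for \<open>i \<ge> n\<close>.  Starting from degree \<open>n + b + 1\<close>,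
  where everything vanishes, \<open>b + 1\<close> such steps yield \<open>EXT\<^sup>n(U, M) = 0\<close>.  For Gorenstein \<open>n\<close>-gr-flat modules the
  same argument runs in the other direction along the complex, with \<open>Tor\<close> in place of \<open>EXT\<close>.

  The homological algebra behind this is developed in the form needed.  The derived functors are defined by a chosen
  free resolution, so their vanishing has to be shown independent of the resolution; this rests on the comparison of
  free resolutions up to homotopy (\<open>comparison_of_resolutions\<close>), which in turn rests on the graded projectivity of
  free modules (\<open>gr_free_lift\<close>).  On the side of \<open>EXT\<close>, cocycles are split into homogeneous ones
  (\<open>EXT_trivial_iff\<close>).  On the side of \<open>Tor\<close>, exactness of tensoring with a free module is obtained
  from coordinates (\<open>tensor_free_inj\<close>, \<open>tensor_free_exact\<close>).  In place of long exact sequences, only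
  the diagram chases \<open>ext_vanishes_quotient\<close> and \<open>tor_vanishes_submodule\<close> are carried out.
\<close>

section \<open>Homogeneous components\<close>

text \<open>
  The description operator picks the decomposition that \<open>graded_by\<close> asserts to exist uniquely, so
  this is the projection onto the part of degree \<open>\<sigma>\<close> for \<open>\<sigma> \<in> I\<close> and \<open>x \<in> carrier M\<close>, and unspecified
  elsewhere.
\<close>

definition component :: "'g set \<Rightarrow> ('m, 'x) ring_scheme \<Rightarrow> ('g \<Rightarrow> 'm set) \<Rightarrow> 'g \<Rightarrow> 'm \<Rightarrow> 'm" where
  "component I M D \<sigma> x = (THE f. f \<in> (\<Pi>\<^sub>E \<sigma>\<in>I. D \<sigma>) \<and> finite {\<sigma>\<in>I. f \<sigma> \<noteq> \<zero>\<^bsub>M\<^esub>} \<and>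
        x = finsum M f {\<sigma>\<in>I. f \<sigma> \<noteq> \<zero>\<^bsub>M\<^esub>}) \<sigma>"

lemma graded_by_zero: "graded_by I M D \<Longrightarrow> \<sigma> \<in> I \<Longrightarrow> \<zero>\<^bsub>M\<^esub> \<in> D \<sigma>"
  unfolding graded_by_def by (simp add: additive_subgroup.zero_closed)

lemma graded_by_add:
  "graded_by I M D \<Longrightarrow> \<sigma> \<in> I \<Longrightarrow> x \<in> D \<sigma> \<Longrightarrow> y \<in> D \<sigma> \<Longrightarrow> x \<oplus>\<^bsub>M\<^esub> y \<in> D \<sigma>"
  unfolding graded_by_def by (simp add: additive_subgroup.a_closed)

lemma graded_by_neg:
  assumes "abelian_group M" "graded_by I M D" "\<sigma> \<in> I" "x \<in> D \<sigma>" shows "\<ominus>\<^bsub>M\<^esub> x \<in> D \<sigma>"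
proof -
  have "subgroup (D \<sigma>) (add_monoid M)"
    using assms unfolding graded_by_def additive_subgroup_def by blast
  then show ?thesis using assms(4) subgroup.m_inv_closed by (fastforce simp: a_inv_def)
qed

lemma graded_by_closed: "graded_by I M D \<Longrightarrow> \<sigma> \<in> I \<Longrightarrow> x \<in> D \<sigma> \<Longrightarrow> x \<in> carrier M"
  unfolding graded_by_def by (meson additive_subgroup.a_Hcarr)

lemma (in abelian_group) additive_map_zero:
  assumes "abelian_group N" "f \<in> carrier G \<rightarrow> carrier N"
    and "\<And>x y. x \<in> carrier G \<Longrightarrow> y \<in> carrier G \<Longrightarrow> f (x \<oplus> y) = f x \<oplus>\<^bsub>N\<^esub> f y"
  shows "f \<zero> = \<zero>\<^bsub>N\<^esub>"
proof -
  interpret N: abelian_group N by fact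
  have "f \<zero> \<oplus>\<^bsub>N\<^esub> f \<zero> = f \<zero> \<oplus>\<^bsub>N\<^esub> \<zero>\<^bsub>N\<^esub>"
    using assms(2) assms(3)[of \<zero> \<zero>] by (auto simp: Pi_iff)
  then show ?thesis using assms(2) by (simp add: Pi_iff)
qed

lemma (in abelian_group) additive_map_finsum:
  assumes N: "abelian_group N" and f: "f \<in> carrier G \<rightarrow> carrier N"
    and add: "\<And>x y. x \<in> carrier G \<Longrightarrow> y \<in> carrier G \<Longrightarrow> f (x \<oplus> y) = f x \<oplus>\<^bsub>N\<^esub> f y"
    and h: "h \<in> S \<rightarrow> carrier G"
  shows "f (finsum G h S) = finsum N (\<lambda>s. f (h s)) S"
proof (cases "finite S")
  case True
  interpret N: abelian_group N by fact
  have f0: "f \<zero> = \<zero>\<^bsub>N\<^esub>" by (rule additive_map_zero[OF N f add])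
  show ?thesis using True h
  proof (induction S)
    case empty then show ?case using f0 by simp
  next
    case (insert s S)
    then have "(\<lambda>s. f (h s)) \<in> S \<rightarrow> carrier N" using f by auto
    with insert f show ?case by (simp add: add Pi_iff finsum_closed)
  qed
next
  case False
  then show ?thesis
    using additive_map_zero[OF N f add] by (simp add: finsum_infinite abelian_monoid.finsum_infinite abelian_group.axioms(1)[OF N])
qed

text \<open>
  Uniqueness of the decomposition identifies the components of any finite sum of homogeneous elements
  of distinct degrees; the other properties of components are read off from this.
\<close>

lemma component_finsum:
  assumes M: "abelian_group M" and D: "graded_by I M D" and S: "finite S" "S \<subseteq> I"
    and y: "\<And>\<sigma>. \<sigma> \<in> S \<Longrightarrow> y \<sigma> \<in> D \<sigma>" and \<tau>: "\<tau> \<in> I"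
  shows "component I M D \<tau> (finsum M y S) = (if \<tau> \<in> S then y \<tau> else \<zero>\<^bsub>M\<^esub>)"
proof -
  interpret M: abelian_group M by fact
  let ?P = "\<lambda>f. f \<in> (\<Pi>\<^sub>E \<sigma>\<in>I. D \<sigma>) \<and> finite {\<sigma>\<in>I. f \<sigma> \<noteq> \<zero>\<^bsub>M\<^esub>} \<and>
        finsum M y S = finsum M f {\<sigma>\<in>I. f \<sigma> \<noteq> \<zero>\<^bsub>M\<^esub>}"
  define f where "f = (\<lambda>\<sigma>\<in>I. if \<sigma> \<in> S then y \<sigma> else \<zero>\<^bsub>M\<^esub>)"
  have yc: "y \<sigma> \<in> carrier M" if "\<sigma> \<in> S" for \<sigma>
    using that y S graded_by_closed[OF D] by blast
  have "f \<in> (\<Pi>\<^sub>E \<sigma>\<in>I. D \<sigma>)" unfolding f_def using y graded_by_zero[OF D] by auto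
  moreover have sub: "{\<sigma>\<in>I. f \<sigma> \<noteq> \<zero>\<^bsub>M\<^esub>} \<subseteq> S" by (auto simp: f_def)
  moreover have "finite {\<sigma>\<in>I. f \<sigma> \<noteq> \<zero>\<^bsub>M\<^esub>}" using sub S(1) finite_subset by blast
  moreover have "finsum M f {\<sigma>\<in>I. f \<sigma> \<noteq> \<zero>\<^bsub>M\<^esub>} = finsum M y S"
    by (rule M.add.finprod_mono_neutral_cong_left[OF S(1) sub]) (use S yc in \<open>auto simp: f_def\<close>)
  ultimately have Pf: "?P f" by metis
  have "finsum M y S \<in> carrier M" using yc by (intro M.finsum_closed) auto
  then have "\<exists>!f. ?P f" using D unfolding graded_by_def by blast
  then have "(THE f. ?P f) = f" using the1_equality[of ?P f] Pf by blast
  then show ?thesis unfolding component_def using \<tau> by (simp add: f_def)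
qed

lemma component_decomposition:
  assumes M: "abelian_group M" and D: "graded_by I M D" and x: "x \<in> carrier M"
  obtains S where "finite S" "S \<subseteq> I" "\<And>\<sigma>. \<sigma> \<in> I \<Longrightarrow> component I M D \<sigma> x \<in> D \<sigma>"
    "\<And>\<sigma>. \<sigma> \<in> I - S \<Longrightarrow> component I M D \<sigma> x = \<zero>\<^bsub>M\<^esub>"
    "x = finsum M (\<lambda>\<sigma>. component I M D \<sigma> x) S"
proof -
  interpret M: abelian_group M by fact
  obtain f where f: "f \<in> (\<Pi>\<^sub>E \<sigma>\<in>I. D \<sigma>)" "finite {\<sigma>\<in>I. f \<sigma> \<noteq> \<zero>\<^bsub>M\<^esub>}"
        "x = finsum M f {\<sigma>\<in>I. f \<sigma> \<noteq> \<zero>\<^bsub>M\<^esub>}"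
    using D x unfolding graded_by_def by blast
  let ?S = "{\<sigma>\<in>I. f \<sigma> \<noteq> \<zero>\<^bsub>M\<^esub>}"
  have c: "component I M D \<sigma> x = (if \<sigma> \<in> ?S then f \<sigma> else \<zero>\<^bsub>M\<^esub>)" if "\<sigma> \<in> I" for \<sigma>
    using component_finsum[OF M D f(2) _ _ that, of f] f by (auto simp: PiE_iff)
  show ?thesis
  proof (rule that[OF f(2)])
    show "?S \<subseteq> I" by auto
    show "component I M D \<sigma> x \<in> D \<sigma>" if "\<sigma> \<in> I" for \<sigma>
      using f(1) c[OF that] graded_by_zero[OF D that] that by (auto simp: PiE_iff)
    show "component I M D \<sigma> x = \<zero>\<^bsub>M\<^esub>" if "\<sigma> \<in> I - ?S" for \<sigma> using c that by simp
    have "x = finsum M f ?S" by (rule f(3))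
    also have "\<dots> = finsum M (\<lambda>\<sigma>. component I M D \<sigma> x) ?S"
      by (rule M.finsum_cong') (use f(1) graded_by_closed[OF D] c in \<open>auto simp: PiE_iff\<close>)
    finally show "x = finsum M (\<lambda>\<sigma>. component I M D \<sigma> x) ?S" .
  qed
qed

lemma component_closed:
  assumes "abelian_group M" "graded_by I M D" "x \<in> carrier M" "\<sigma> \<in> I"
  shows "component I M D \<sigma> x \<in> D \<sigma>"
  using component_decomposition[OF assms(1-3)] assms(4) by metis

lemma component_in_carrier:
  assumes "abelian_group M" "graded_by I M D" "x \<in> carrier M" "\<sigma> \<in> I"
  shows "component I M D \<sigma> x \<in> carrier M"
  using component_closed[OF assms] graded_by_closed[OF assms(2,4)] by blast

lemma finite_components:
  assumes "abelian_group M" "graded_by I M D" "x \<in> carrier M"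
  shows "finite {\<sigma>\<in>I. component I M D \<sigma> x \<noteq> \<zero>\<^bsub>M\<^esub>}"
proof (rule component_decomposition[OF assms])
  fix S assume S: "finite S" "\<And>\<sigma>. \<sigma> \<in> I - S \<Longrightarrow> component I M D \<sigma> x = \<zero>\<^bsub>M\<^esub>"
  then have "{\<sigma>\<in>I. component I M D \<sigma> x \<noteq> \<zero>\<^bsub>M\<^esub>} \<subseteq> S" by blast
  then show ?thesis using S(1) finite_subset by blast
qed

lemma finsum_components:
  assumes M: "abelian_group M" and D: "graded_by I M D" and x: "x \<in> carrier M"
    and S: "finite S" "S \<subseteq> I" "\<And>\<sigma>. \<sigma> \<in> I - S \<Longrightarrow> component I M D \<sigma> x = \<zero>\<^bsub>M\<^esub>"
  shows "finsum M (\<lambda>\<sigma>. component I M D \<sigma> x) S = x"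
proof (rule component_decomposition[OF M D x])
  interpret M: abelian_group M by fact
  fix T assume T: "finite T" "T \<subseteq> I" "\<And>\<sigma>. \<sigma> \<in> I - T \<Longrightarrow> component I M D \<sigma> x = \<zero>\<^bsub>M\<^esub>"
    "x = finsum M (\<lambda>\<sigma>. component I M D \<sigma> x) T"
  have "finsum M (\<lambda>\<sigma>. component I M D \<sigma> x) T = finsum M (\<lambda>\<sigma>. component I M D \<sigma> x) S"
    by (rule M.add.finprod_mono_neutral_cong)
      (use S T component_in_carrier[OF M D x] in auto)
  with T(4) show ?thesis by simp
qed

lemma component_homogeneous:
  assumes "abelian_group M" "graded_by I M D" "\<sigma> \<in> I" "\<tau> \<in> I" "x \<in> D \<sigma>"
  shows "component I M D \<tau> x = (if \<tau> = \<sigma> then x else \<zero>\<^bsub>M\<^esub>)"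
proof -
  interpret M: abelian_group M by fact
  have "finsum M (\<lambda>_. x) {\<sigma>} = x"
    using graded_by_closed[OF assms(2,3,5)] by simp
  then show ?thesis using component_finsum[OF assms(1,2), of "{\<sigma>}" "\<lambda>_. x" \<tau>] assms by auto
qed

lemma component_add:
  assumes M: "abelian_group M" and D: "graded_by I M D" and x: "x \<in> carrier M" and y: "y \<in> carrier M"
    and \<tau>: "\<tau> \<in> I"
  shows "component I M D \<tau> (x \<oplus>\<^bsub>M\<^esub> y) = component I M D \<tau> x \<oplus>\<^bsub>M\<^esub> component I M D \<tau> y"
proof (rule component_decomposition[OF M D x], rule component_decomposition[OF M D y])
  interpret M: abelian_group M by fact
  fix S T assume S: "finite S" "S \<subseteq> I" "\<And>\<sigma>. \<sigma> \<in> I - S \<Longrightarrow> component I M D \<sigma> x = \<zero>\<^bsub>M\<^esub>"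
    and T: "finite T" "T \<subseteq> I" "\<And>\<sigma>. \<sigma> \<in> I - T \<Longrightarrow> component I M D \<sigma> y = \<zero>\<^bsub>M\<^esub>"
  let ?U = "S \<union> T \<union> {\<tau>}"
  have U: "finite ?U" "?U \<subseteq> I" using S T \<tau> by auto
  note c = component_closed[OF M D] and cc = component_in_carrier[OF M D]
  have "x \<oplus>\<^bsub>M\<^esub> y = finsum M (\<lambda>\<sigma>. component I M D \<sigma> x) ?U \<oplus>\<^bsub>M\<^esub> finsum M (\<lambda>\<sigma>. component I M D \<sigma> y) ?U"
    using finsum_components[OF M D x U] finsum_components[OF M D y U] S T by auto
  also have "\<dots> = finsum M (\<lambda>\<sigma>. component I M D \<sigma> x \<oplus>\<^bsub>M\<^esub> component I M D \<sigma> y) ?U"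
    by (rule M.finsum_addf[symmetric]) (use U cc x y in auto)
  finally have eq: "x \<oplus>\<^bsub>M\<^esub> y = finsum M (\<lambda>\<sigma>. component I M D \<sigma> x \<oplus>\<^bsub>M\<^esub> component I M D \<sigma> y) ?U" .
  show ?thesis unfolding eq
    by (subst component_finsum[OF M D U _ \<tau>]) (use U c x y graded_by_add[OF D] in auto)
qed

text \<open>
  A grading is the same as a family of additive projections; this is how gradings are constructed.
\<close>

lemma graded_byI:
  assumes M: "abelian_group M" and sub: "\<And>\<sigma>. \<sigma> \<in> I \<Longrightarrow> additive_subgroup (D \<sigma>) M"
    and p: "\<And>\<sigma> x. \<sigma> \<in> I \<Longrightarrow> x \<in> carrier M \<Longrightarrow> p \<sigma> x \<in> D \<sigma>"
    and fin: "\<And>x. x \<in> carrier M \<Longrightarrow> finite {\<sigma>\<in>I. p \<sigma> x \<noteq> \<zero>\<^bsub>M\<^esub>}"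
    and sum: "\<And>x. x \<in> carrier M \<Longrightarrow> x = finsum M (\<lambda>\<sigma>. p \<sigma> x) {\<sigma>\<in>I. p \<sigma> x \<noteq> \<zero>\<^bsub>M\<^esub>}"
    and add: "\<And>\<sigma> x y. \<sigma> \<in> I \<Longrightarrow> x \<in> carrier M \<Longrightarrow> y \<in> carrier M \<Longrightarrow> p \<sigma> (x \<oplus>\<^bsub>M\<^esub> y) = p \<sigma> x \<oplus>\<^bsub>M\<^esub> p \<sigma> y"
    and hom: "\<And>\<sigma> \<tau> x. \<sigma> \<in> I \<Longrightarrow> \<tau> \<in> I \<Longrightarrow> x \<in> D \<sigma> \<Longrightarrow> p \<tau> x = (if \<tau> = \<sigma> then x else \<zero>\<^bsub>M\<^esub>)"
  shows "graded_by I M D"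
  unfolding graded_by_def
proof (intro conjI ballI sub)
  interpret M: abelian_group M by fact
  have Dc: "y \<in> carrier M" if "\<sigma> \<in> I" "y \<in> D \<sigma>" for \<sigma> y
    using sub that additive_subgroup.a_Hcarr by metis
  fix x assume x: "x \<in> carrier M"
  let ?P = "\<lambda>f. f \<in> (\<Pi>\<^sub>E \<sigma>\<in>I. D \<sigma>) \<and> finite {\<sigma>\<in>I. f \<sigma> \<noteq> \<zero>\<^bsub>M\<^esub>} \<and> x = finsum M f {\<sigma>\<in>I. f \<sigma> \<noteq> \<zero>\<^bsub>M\<^esub>}"
  show "\<exists>!f. ?P f"
  proof (rule ex1I[of _ "\<lambda>\<sigma>\<in>I. p \<sigma> x"])
    have eq: "{\<sigma>\<in>I. (\<lambda>\<sigma>\<in>I. p \<sigma> x) \<sigma> \<noteq> \<zero>\<^bsub>M\<^esub>} = {\<sigma>\<in>I. p \<sigma> x \<noteq> \<zero>\<^bsub>M\<^esub>}" by auto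
    have "finsum M (\<lambda>\<sigma>\<in>I. p \<sigma> x) {\<sigma>\<in>I. p \<sigma> x \<noteq> \<zero>\<^bsub>M\<^esub>} = finsum M (\<lambda>\<sigma>. p \<sigma> x) {\<sigma>\<in>I. p \<sigma> x \<noteq> \<zero>\<^bsub>M\<^esub>}"
      by (rule M.finsum_cong') (use p x Dc in auto)
    then show "?P (\<lambda>\<sigma>\<in>I. p \<sigma> x)" unfolding eq using p x fin sum by auto
  next
    fix f assume f: "?P f"
    let ?S = "{\<sigma>\<in>I. f \<sigma> \<noteq> \<zero>\<^bsub>M\<^esub>}"
    have fD: "f \<sigma> \<in> D \<sigma>" if "\<sigma> \<in> I" for \<sigma> using f that by (auto simp: PiE_iff)
    show "f = (\<lambda>\<sigma>\<in>I. p \<sigma> x)"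
    proof
      fix \<tau>
      show "f \<tau> = (\<lambda>\<sigma>\<in>I. p \<sigma> x) \<tau>"
      proof (cases "\<tau> \<in> I")
        case True
        have pc: "p \<tau> \<in> carrier M \<rightarrow> carrier M" using p[OF True] Dc[OF True] by auto
        have "p \<tau> x = finsum M (\<lambda>\<sigma>. p \<tau> (f \<sigma>)) ?S"
          using M.additive_map_finsum[OF M pc add, of f ?S] f True fD Dc by auto
        also have "\<dots> = finsum M (\<lambda>\<sigma>. if \<tau> = \<sigma> then f \<sigma> else \<zero>\<^bsub>M\<^esub>) ?S"
          by (rule M.finsum_cong') (use hom True fD Dc M.zero_closed in auto)
        also have "\<dots> = (if \<tau> \<in> ?S then f \<tau> else \<zero>\<^bsub>M\<^esub>)"
        proof (cases "\<tau> \<in> ?S")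
          case T: True
          then show ?thesis using M.finsum_singleton[OF T, of f] f fD Dc by auto
        next
          case False
          then have "finsum M (\<lambda>\<sigma>. if \<tau> = \<sigma> then f \<sigma> else \<zero>\<^bsub>M\<^esub>) ?S = finsum M (\<lambda>\<sigma>. \<zero>\<^bsub>M\<^esub>) ?S"
            by (intro M.finsum_cong') auto
          with False show ?thesis by (simp add: M.finsum_zero)
        qed
        finally show ?thesis using True by auto
      next
        case False
        then show ?thesis using f by (auto simp: PiE_iff extensional_def)
      qed
    qed
  qed
qed

text \<open>
  The components of \<open>M\<close> restrict to projections of the subgroup.  The new structure \<open>M'\<close> is described by its
  fields, so that \<open>gr_kernel\<close> below is an instance.
\<close>

lemma graded_by_subgroup:
  fixes I :: "'g set" and M :: "('m, 'x) ring_scheme" and M' :: "('m, 'y) ring_scheme"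
  assumes M: "abelian_group M" and D: "graded_by I M D" and K: "additive_subgroup K M"
    and comp: "\<And>\<sigma> x. \<sigma> \<in> I \<Longrightarrow> x \<in> K \<Longrightarrow> component I M D \<sigma> x \<in> K"
    and M': "carrier M' = K" "\<zero>\<^bsub>M'\<^esub> = \<zero>\<^bsub>M\<^esub>" "ring.add M' = ring.add M"
    and D': "\<And>\<sigma>. \<sigma> \<in> I \<Longrightarrow> D' \<sigma> = D \<sigma> \<inter> K"
  shows "abelian_group M'" "graded_by I M' D'"
proof -
  interpret M: abelian_group M by fact
  have Kc: "K \<subseteq> carrier M" using K by (simp add: additive_subgroup.a_subset)
  have K0: "\<zero>\<^bsub>M\<^esub> \<in> K" using K by (simp add: additive_subgroup.zero_closed)
  have Ka: "x \<oplus>\<^bsub>M\<^esub> y \<in> K" if "x \<in> K" "y \<in> K" for x y using K that by (simp add: additive_subgroup.a_closed)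
  have sK: "subgroup K (add_monoid M)" using K by (simp add: additive_subgroup_def)
  have Kn: "\<ominus>\<^bsub>M\<^esub> x \<in> K" if "x \<in> K" for x
    using subgroup.m_inv_closed[OF sK] that by (fastforce simp: a_inv_def)
  show ag: "abelian_group M'"
  proof (rule abelian_groupI, goal_cases)
    case (6 x)
    then have "x \<in> K" by (simp add: M')
    then show ?case using Kn Kc by (intro bexI[of _ "\<ominus>\<^bsub>M\<^esub> x"]) (auto simp: M' M.l_neg)
  next
    case (3 x y z)
    then show ?case using Kc by (auto simp: M' M.a_assoc subset_iff)
  next
    case (4 x y)
    then show ?case using Kc by (auto simp: M' M.a_comm subset_iff)
  qed (use Kc K0 Ka in \<open>auto simp: M'\<close>)
  interpret M': abelian_group M' by fact
  have fs: "finsum M' f S = finsum M f S" if "f \<in> S \<rightarrow> K" for f :: "'g \<Rightarrow> 'm" and S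
    using M'.additive_map_finsum[OF M, of "\<lambda>x. x" f S] that Kc by (auto simp: M')
  show "graded_by I M' D'"
  proof (rule graded_byI[OF ag, where p = "component I M D"])
    fix \<sigma> assume \<sigma>: "\<sigma> \<in> I"
    have "subgroup (D' \<sigma>) (add_monoid M')"
    proof (rule group.subgroupI)
      show "group (add_monoid M')" using M'.a_group .
      fix a assume a: "a \<in> D' \<sigma>"
      then have a': "a \<in> D \<sigma>" "a \<in> K" using D'[OF \<sigma>] by auto
      have na: "\<ominus>\<^bsub>M\<^esub> a \<in> D \<sigma> \<inter> K"
        using Kn a' graded_by_neg[OF M D \<sigma>] by auto
      have "a \<oplus>\<^bsub>M'\<^esub> (\<ominus>\<^bsub>M\<^esub> a) = \<zero>\<^bsub>M'\<^esub>" using a' Kc by (auto simp: M' M.r_neg)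
      then have "\<ominus>\<^bsub>M'\<^esub> a = \<ominus>\<^bsub>M\<^esub> a" using a' na by (intro M'.minus_equality) (auto simp: M' M.l_neg subsetD[OF Kc])
      then show "inv\<^bsub>add_monoid M'\<^esub> a \<in> D' \<sigma>" using na D'[OF \<sigma>] by (simp add: a_inv_def)
    qed (use \<sigma> K0 graded_by_zero[OF D \<sigma>] graded_by_add[OF D \<sigma>] Ka in \<open>auto simp: D' M'\<close>)
    then show "additive_subgroup (D' \<sigma>) M'" by (simp add: additive_subgroup_def)
  next
    fix \<sigma> x assume "\<sigma> \<in> I" "x \<in> carrier M'"
    then show "component I M D \<sigma> x \<in> D' \<sigma>"
      using component_closed[OF M D, of x \<sigma>] comp[of \<sigma> x] Kc by (auto simp: D' M')
  next
    fix x assume x: "x \<in> carrier M'"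
    then show f: "finite {\<sigma>\<in>I. component I M D \<sigma> x \<noteq> \<zero>\<^bsub>M'\<^esub>}"
      using finite_components[OF M D, of x] Kc by (auto simp: M')
    have "finsum M' (\<lambda>\<sigma>. component I M D \<sigma> x) {\<sigma>\<in>I. component I M D \<sigma> x \<noteq> \<zero>\<^bsub>M'\<^esub>}
        = finsum M (\<lambda>\<sigma>. component I M D \<sigma> x) {\<sigma>\<in>I. component I M D \<sigma> x \<noteq> \<zero>\<^bsub>M'\<^esub>}"
      by (rule fs) (use comp x in \<open>auto simp: M'\<close>)
    also have "\<dots> = x"
      by (rule finsum_components[OF M D _ f]) (use x Kc in \<open>auto simp: M'\<close>)
    finally show "x = finsum M' (\<lambda>\<sigma>. component I M D \<sigma> x) {\<sigma>\<in>I. component I M D \<sigma> x \<noteq> \<zero>\<^bsub>M'\<^esub>}" ..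
  qed (use Kc component_add[OF M D] component_homogeneous[OF M D] in \<open>auto simp: D' M' subset_iff\<close>)
qed

section \<open>Linear maps and homogeneous maps\<close>

lemma pre_module_abelian_group: "pre_module R M \<Longrightarrow> abelian_group M"
  by (simp add: pre_module_def)

lemma smult_closed: "pre_module R M \<Longrightarrow> a \<in> carrier R \<Longrightarrow> x \<in> carrier M \<Longrightarrow> smult M a x \<in> carrier M"
  by (simp add: pre_module_def)

lemma smult_add:
  "pre_module R M \<Longrightarrow> a \<in> carrier R \<Longrightarrow> x \<in> carrier M \<Longrightarrow> y \<in> carrier M \<Longrightarrow>
    smult M a (x \<oplus>\<^bsub>M\<^esub> y) = smult M a x \<oplus>\<^bsub>M\<^esub> smult M a y"
  by (simp add: pre_module_def)

lemma smult_add_left: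
  "pre_module R M \<Longrightarrow> a \<in> carrier R \<Longrightarrow> b \<in> carrier R \<Longrightarrow> x \<in> carrier M \<Longrightarrow>
    smult M (a \<oplus>\<^bsub>R\<^esub> b) x = smult M a x \<oplus>\<^bsub>M\<^esub> smult M b x"
  by (simp add: pre_module_def)

lemma smult_one: "pre_module R M \<Longrightarrow> x \<in> carrier M \<Longrightarrow> smult M \<one>\<^bsub>R\<^esub> x = x"
  by (simp add: pre_module_def)

lemma smult_zero:
  assumes "pre_module R M" "a \<in> carrier R" shows "smult M a \<zero>\<^bsub>M\<^esub> = \<zero>\<^bsub>M\<^esub>"
proof -
  interpret abelian_group M using assms(1) by (rule pre_module_abelian_group)
  show ?thesis
    by (rule additive_map_zero)
      (use assms smult_closed smult_add pre_module_abelian_group in auto)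
qed

lemma smult_neg:
  assumes "pre_module R M" "a \<in> carrier R" "x \<in> carrier M"
  shows "smult M a (\<ominus>\<^bsub>M\<^esub> x) = \<ominus>\<^bsub>M\<^esub> smult M a x"
proof -
  interpret abelian_group M using assms(1) by (rule pre_module_abelian_group)
  have "smult M a (\<ominus>\<^bsub>M\<^esub> x) \<oplus>\<^bsub>M\<^esub> smult M a x = \<zero>\<^bsub>M\<^esub>"
    using assms smult_add[OF assms(1,2), of "\<ominus>\<^bsub>M\<^esub> x" x, symmetric] smult_zero by (metis a_inv_closed l_neg)
  then show ?thesis using assms smult_closed by (metis a_inv_closed minus_equality)
qed

lemma smult_zero_left:
  assumes "ring R" "pre_module R M" "x \<in> carrier M" shows "smult M \<zero>\<^bsub>R\<^esub> x = \<zero>\<^bsub>M\<^esub>"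
proof -
  interpret R: ring R by fact
  have "abelian_group M" using assms(2) by (rule pre_module_abelian_group)
  then show ?thesis
    by (rule R.additive_map_zero) (use assms smult_closed smult_add_left in auto)
qed

lemma lin_mapI:
  assumes "\<And>x. x \<in> carrier M \<Longrightarrow> f x \<in> carrier N"
    "\<And>x y. x \<in> carrier M \<Longrightarrow> y \<in> carrier M \<Longrightarrow> f (x \<oplus>\<^bsub>M\<^esub> y) = f x \<oplus>\<^bsub>N\<^esub> f y"
    "\<And>a x. a \<in> carrier R \<Longrightarrow> x \<in> carrier M \<Longrightarrow> f (smult M a x) = smult N a (f x)"
  shows "lin_map R M N f"
  using assms by (auto simp: lin_map_def)

lemma lin_map_closed: "lin_map R M N f \<Longrightarrow> x \<in> carrier M \<Longrightarrow> f x \<in> carrier N"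
  by (auto simp: lin_map_def)

lemma lin_map_add:
  "lin_map R M N f \<Longrightarrow> x \<in> carrier M \<Longrightarrow> y \<in> carrier M \<Longrightarrow> f (x \<oplus>\<^bsub>M\<^esub> y) = f x \<oplus>\<^bsub>N\<^esub> f y"
  by (auto simp: lin_map_def)

lemma lin_map_smult:
  "lin_map R M N f \<Longrightarrow> a \<in> carrier R \<Longrightarrow> x \<in> carrier M \<Longrightarrow> f (smult M a x) = smult N a (f x)"
  by (auto simp: lin_map_def)

lemma lin_map_zero:
  assumes "abelian_group M" "abelian_group N" "lin_map R M N f" shows "f \<zero>\<^bsub>M\<^esub> = \<zero>\<^bsub>N\<^esub>"
  by (rule abelian_group.additive_map_zero[OF assms(1,2)]) (use assms(3) in \<open>auto simp: lin_map_def\<close>)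

lemma lin_map_neg:
  assumes "abelian_group M" "abelian_group N" "lin_map R M N f" "x \<in> carrier M"
  shows "f (\<ominus>\<^bsub>M\<^esub> x) = \<ominus>\<^bsub>N\<^esub> f x"
proof -
  interpret M: abelian_group M by fact
  interpret N: abelian_group N by fact
  have "f (\<ominus>\<^bsub>M\<^esub> x) \<oplus>\<^bsub>N\<^esub> f x = \<zero>\<^bsub>N\<^esub>"
    using assms lin_map_add[OF assms(3), of "\<ominus>\<^bsub>M\<^esub> x" x, symmetric] lin_map_zero
    by (metis M.a_inv_closed M.l_neg)
  moreover have "f x \<in> carrier N" "f (\<ominus>\<^bsub>M\<^esub> x) \<in> carrier N"
    using lin_map_closed[OF assms(3)] assms(4) by auto
  ultimately show ?thesis using N.minus_equality by metis
qed

lemma lin_map_finsum: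
  assumes "abelian_group M" "abelian_group N" "lin_map R M N f" "\<And>s. s \<in> S \<Longrightarrow> h s \<in> carrier M"
  shows "f (finsum M h S) = finsum N (\<lambda>s. f (h s)) S"
  by (rule abelian_group.additive_map_finsum[OF assms(1,2)])
    (use assms in \<open>auto simp: lin_map_def\<close>)

lemma lin_map_comp: "lin_map R M N f \<Longrightarrow> lin_map R N L g \<Longrightarrow> lin_map R M L (\<lambda>x. g (f x))"
  by (auto simp: lin_map_def Pi_iff)

lemma lin_map_add_maps:
  assumes N: "pre_module R N" and f: "lin_map R M N f" and g: "lin_map R M N g"
  shows "lin_map R M N (\<lambda>x. f x \<oplus>\<^bsub>N\<^esub> g x)"
proof -
  interpret N: abelian_group N using N by (rule pre_module_abelian_group)
  show ?thesis
    by (rule lin_mapI) (simp_all add: lin_map_closed[OF f] lin_map_closed[OF g] lin_map_add[OF f]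
        lin_map_add[OF g] lin_map_smult[OF f] lin_map_smult[OF g] smult_add[OF N] N.a_ac)
qed

lemma lin_map_neg_map:
  assumes N: "pre_module R N" and f: "lin_map R M N f"
  shows "lin_map R M N (\<lambda>x. \<ominus>\<^bsub>N\<^esub> f x)"
proof -
  interpret N: abelian_group N using N by (rule pre_module_abelian_group)
  show ?thesis
    by (rule lin_mapI) (simp_all add: lin_map_closed[OF f] lin_map_add[OF f] lin_map_smult[OF f]
        smult_neg[OF N] N.minus_add)
qed

lemma lin_map_zero_map: "pre_module R N \<Longrightarrow> lin_map R M N (\<lambda>x. \<zero>\<^bsub>N\<^esub>)"
proof -
  assume N: "pre_module R N"
  interpret N: abelian_group N using N by (rule pre_module_abelian_group)
  show ?thesis by (rule lin_mapI) (simp_all add: smult_zero[OF N])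
qed

text \<open>
  Most arguments about gradings only use the grading of the additive group and the linearity of scalar
  multiplication.  This notion has left and right modules as special cases.
\<close>

definition gr_premodule :: "'g monoid \<Rightarrow> ('g, 'r) gr_ring \<Rightarrow> ('g, 'r, 'm) gr_module \<Rightarrow> bool" where
  "gr_premodule G R M \<longleftrightarrow> pre_module R M \<and> graded_by (carrier G) M (mgrade M)"

lemma left_gr_module_premodule: "left_gr_module G R M \<Longrightarrow> gr_premodule G R M"
  by (simp add: left_gr_module_def gr_premodule_def)

lemma right_gr_module_premodule: "right_gr_module G R M \<Longrightarrow> gr_premodule G R M"
  by (simp add: right_gr_module_def gr_premodule_def)

lemma gr_premoduleD:
  assumes "gr_premodule G R M"
  shows "pre_module R M" "abelian_group M" "graded_by (carrier G) M (mgrade M)"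
  using assms by (auto simp: gr_premodule_def pre_module_def)

text \<open>
  The members of \<open>HOM_deg\<close> without the requirement of being extensional; such maps can be composed and
  added pointwise.  Composing with a \<open>gr_hom\<close> on either side does not change the degree, which is why
  complexes of homogeneous maps of a fixed degree can be treated like complexes of graded maps.
\<close>

definition deg_hom ::
    "'g monoid \<Rightarrow> ('g, 'r) gr_ring \<Rightarrow> 'g \<Rightarrow> ('g, 'r, 'm) gr_module \<Rightarrow> ('g, 'r, 'k) gr_module
      \<Rightarrow> ('m \<Rightarrow> 'k) \<Rightarrow> bool" where
  "deg_hom G R \<sigma> M N f \<longleftrightarrow>
     lin_map R M N f \<and> (\<forall>\<tau>\<in>carrier G. f ` mgrade M \<tau> \<subseteq> mgrade N (\<tau> \<otimes>\<^bsub>G\<^esub> \<sigma>))"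

lemma deg_hom_lin: "deg_hom G R \<sigma> M N f \<Longrightarrow> lin_map R M N f"
  by (simp add: deg_hom_def)

lemma gr_hom_lin: "gr_hom G R M N f \<Longrightarrow> lin_map R M N f"
  by (simp add: gr_hom_def)

lemma deg_hom_grade:
  "deg_hom G R \<sigma> M N f \<Longrightarrow> \<tau> \<in> carrier G \<Longrightarrow> x \<in> mgrade M \<tau> \<Longrightarrow> f x \<in> mgrade N (\<tau> \<otimes>\<^bsub>G\<^esub> \<sigma>)"
  by (auto simp: deg_hom_def)

lemma gr_hom_grade: "gr_hom G R M N f \<Longrightarrow> \<tau> \<in> carrier G \<Longrightarrow> x \<in> mgrade M \<tau> \<Longrightarrow> f x \<in> mgrade N \<tau>"
  by (auto simp: gr_hom_def)

lemma gr_hom_iff_deg_hom_one: "group G \<Longrightarrow> gr_hom G R M N f \<longleftrightarrow> deg_hom G R \<one>\<^bsub>G\<^esub> M N f"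
  by (simp add: gr_hom_def deg_hom_def group.is_monoid monoid.r_one)

lemma gr_hom_comp: "gr_hom G R M N f \<Longrightarrow> gr_hom G R N L g \<Longrightarrow> gr_hom G R M L (\<lambda>x. g (f x))"
  by (auto simp: gr_hom_def image_subset_iff intro: lin_map_comp[of R M N f])

lemma deg_hom_comp_gr_hom:
  "deg_hom G R \<sigma> M N f \<Longrightarrow> gr_hom G R N L g \<Longrightarrow> group G \<Longrightarrow> \<sigma> \<in> carrier G \<Longrightarrow>
    deg_hom G R \<sigma> M L (\<lambda>x. g (f x))"
  by (auto simp: deg_hom_def gr_hom_def image_subset_iff group.is_monoid monoid.m_closed
      intro: lin_map_comp[of R M N f])

lemma gr_hom_comp_deg_hom:
  "gr_hom G R L M g \<Longrightarrow> deg_hom G R \<sigma> M N f \<Longrightarrow> deg_hom G R \<sigma> L N (\<lambda>x. f (g x))"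
  by (auto simp: deg_hom_def gr_hom_def image_subset_iff intro: lin_map_comp[of R L M g])

lemma deg_hom_add_maps:
  assumes "group G" "\<sigma> \<in> carrier G" "gr_premodule G R N" "deg_hom G R \<sigma> M N f" "deg_hom G R \<sigma> M N g"
  shows "deg_hom G R \<sigma> M N (\<lambda>x. f x \<oplus>\<^bsub>N\<^esub> g x)"
proof -
  interpret G: group G by fact
  note N = gr_premoduleD[OF assms(3)]
  show ?thesis using assms lin_map_add_maps[OF N(1)] graded_by_add[OF N(3)]
    unfolding deg_hom_def by (auto simp: image_subset_iff)
qed

lemma deg_hom_neg_map:
  assumes "group G" "\<sigma> \<in> carrier G" "gr_premodule G R N" "deg_hom G R \<sigma> M N f"
  shows "deg_hom G R \<sigma> M N (\<lambda>x. \<ominus>\<^bsub>N\<^esub> f x)"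
proof -
  interpret G: group G by fact
  note N = gr_premoduleD[OF assms(3)]
  show ?thesis using assms lin_map_neg_map[OF N(1)] graded_by_neg[OF N(2,3)]
    unfolding deg_hom_def by (auto simp: image_subset_iff)
qed

lemma deg_hom_zero_map:
  assumes "group G" "\<sigma> \<in> carrier G" "gr_premodule G R N"
  shows "deg_hom G R \<sigma> M N (\<lambda>x. \<zero>\<^bsub>N\<^esub>)"
proof -
  interpret G: group G by fact
  note N = gr_premoduleD[OF assms(3)]
  show ?thesis using assms lin_map_zero_map[OF N(1)] graded_by_zero[OF N(3)]
    unfolding deg_hom_def by (auto simp: image_subset_iff)
qed

lemma lin_map_eq_from_homogeneous:
  assumes M: "gr_premodule G R M" and N: "abelian_group N" and f: "lin_map R M N f" and g: "lin_map R M N g"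
    and eq: "\<And>\<tau> x. \<tau> \<in> carrier G \<Longrightarrow> x \<in> mgrade M \<tau> \<Longrightarrow> f x = g x" and x: "x \<in> carrier M"
  shows "f x = g x"
proof (rule component_decomposition[OF gr_premoduleD(2,3)[OF M] x])
  note M' = gr_premoduleD(2,3)[OF M]
  fix S assume S: "S \<subseteq> carrier G" "x = finsum M (\<lambda>\<sigma>. component (carrier G) M (mgrade M) \<sigma> x) S"
  let ?c = "\<lambda>\<sigma>. component (carrier G) M (mgrade M) \<sigma> x"
  have c: "?c s \<in> carrier M" "f (?c s) = g (?c s)" if "s \<in> S" for s
    using component_in_carrier[OF M' x] component_closed[OF M' x] S(1) that eq by blast+
  interpret N: abelian_group N by fact
  have "f (finsum M ?c S) = finsum N (\<lambda>s. f (?c s)) S"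
    by (rule lin_map_finsum[OF M'(1) N f c(1)])
  also have "\<dots> = finsum N (\<lambda>s. g (?c s)) S"
    by (rule N.finsum_cong') (use c lin_map_closed[OF g] in auto)
  also have "\<dots> = g (finsum M ?c S)"
    by (rule lin_map_finsum[OF M'(1) N g c(1), symmetric])
  finally show ?thesis using S(2) by simp
qed

text \<open>
  Graded maps commute with the projections onto components, hence have graded kernels and lift
  homogeneous elements to homogeneous elements.
\<close>

lemma gr_hom_component:
  assumes M: "gr_premodule G R M" and N: "gr_premodule G R N" and f: "gr_hom G R M N f"
    and \<tau>: "\<tau> \<in> carrier G" and x: "x \<in> carrier M"
  shows "component (carrier G) N (mgrade N) \<tau> (f x) = f (component (carrier G) M (mgrade M) \<tau> x)"
proof (rule component_decomposition[OF gr_premoduleD(2,3)[OF M] x])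
  note M' = gr_premoduleD(2,3)[OF M] and N' = gr_premoduleD(2,3)[OF N]
  let ?c = "\<lambda>\<sigma>. component (carrier G) M (mgrade M) \<sigma> x"
  fix S assume S: "finite S" "S \<subseteq> carrier G" "x = finsum M ?c S"
    "\<And>\<sigma>. \<sigma> \<in> carrier G - S \<Longrightarrow> ?c \<sigma> = \<zero>\<^bsub>M\<^esub>"
  have c: "?c s \<in> carrier M" "?c s \<in> mgrade M s" if "s \<in> S" for s
    using component_in_carrier[OF M' x] component_closed[OF M' x] S(2) that by blast+
  have "f (finsum M ?c S) = finsum N (\<lambda>s. f (?c s)) S"
    by (rule lin_map_finsum[OF M'(1) N'(1) gr_hom_lin[OF f] c(1)])
  then have fx: "f x = finsum N (\<lambda>s. f (?c s)) S" using S(3) by simp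
  have "component (carrier G) N (mgrade N) \<tau> (f x) = (if \<tau> \<in> S then f (?c \<tau>) else \<zero>\<^bsub>N\<^esub>)"
    unfolding fx by (rule component_finsum[OF N' S(1,2) _ \<tau>]) (use c(2) S(2) gr_hom_grade[OF f] in auto)
  then show ?thesis using S(4) \<tau> lin_map_zero[OF M'(1) N'(1) gr_hom_lin[OF f]] by auto
qed

text \<open>
  Both the syzygies of a module and the cycles of a complex are formed as kernels, inside the type of the
  ambient module.
\<close>

definition gr_kernel ::
    "('g, 'r, 'm) gr_module \<Rightarrow> ('g, 'r, 'k) gr_module \<Rightarrow> ('m \<Rightarrow> 'k) \<Rightarrow> ('g, 'r, 'm) gr_module" where
  "gr_kernel M N f =
     M\<lparr>carrier := a_kernel M N f, mgrade := (\<lambda>\<sigma>. mgrade M \<sigma> \<inter> a_kernel M N f)\<rparr>"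

lemma a_kernel_iff: "x \<in> a_kernel M N f \<longleftrightarrow> x \<in> carrier M \<and> f x = \<zero>\<^bsub>N\<^esub>"
  by (simp add: a_kernel_def')

lemma gr_kernel_simps [simp]:
  "carrier (gr_kernel M N f) = a_kernel M N f"
  "mgrade (gr_kernel M N f) = (\<lambda>\<sigma>. mgrade M \<sigma> \<inter> a_kernel M N f)"
  "\<zero>\<^bsub>gr_kernel M N f\<^esub> = \<zero>\<^bsub>M\<^esub>" "ring.add (gr_kernel M N f) = ring.add M"
  "smult (gr_kernel M N f) = smult M"
  by (simp_all add: gr_kernel_def)

lemma gr_kernel_premodule:
  assumes M: "gr_premodule G R M" and N: "gr_premodule G R N" and f: "gr_hom G R M N f"
  shows "gr_premodule G R (gr_kernel M N f)"
proof -
  note M' = gr_premoduleD[OF M] and N' = gr_premoduleD[OF N] and fl = gr_hom_lin[OF f]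
  interpret M: abelian_group M by (rule M')
  interpret N: abelian_group N by (rule N')
  have "subgroup (a_kernel M N f) (add_monoid M)"
  proof (rule group.subgroupI[OF M.a_group])
    show "a_kernel M N f \<subseteq> carrier (add_monoid M)" by (auto simp: a_kernel_iff)
    have "\<zero>\<^bsub>M\<^esub> \<in> a_kernel M N f" using lin_map_zero[OF M'(2) N'(2) fl] by (simp add: a_kernel_iff)
    then show "a_kernel M N f \<noteq> {}" by blast
    fix x assume x: "x \<in> a_kernel M N f"
    then show "inv\<^bsub>add_monoid M\<^esub> x \<in> a_kernel M N f"
      using lin_map_neg[OF M'(2) N'(2) fl, of x] by (simp add: a_kernel_iff flip: a_inv_def)
    fix y assume "y \<in> a_kernel M N f"
    with x show "x \<otimes>\<^bsub>add_monoid M\<^esub> y \<in> a_kernel M N f"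
      by (simp add: a_kernel_iff lin_map_add[OF fl])
  qed
  then have sub: "additive_subgroup (a_kernel M N f) M" by (simp add: additive_subgroup_def)
  have comp: "component (carrier G) M (mgrade M) \<sigma> x \<in> a_kernel M N f"
    if "\<sigma> \<in> carrier G" "x \<in> a_kernel M N f" for \<sigma> x
  proof -
    have "f (component (carrier G) M (mgrade M) \<sigma> x) = component (carrier G) N (mgrade N) \<sigma> \<zero>\<^bsub>N\<^esub>"
      using gr_hom_component[OF M N f that(1), of x] that by (simp add: a_kernel_iff)
    also have "\<dots> = \<zero>\<^bsub>N\<^esub>"
      using component_homogeneous[OF N'(2,3) that(1) that(1) graded_by_zero[OF N'(3) that(1)]] by simp
    finally show ?thesis using that component_in_carrier[OF M'(2,3)] by (auto simp: a_kernel_iff)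
  qed
  have "abelian_group (gr_kernel M N f)" "graded_by (carrier G) (gr_kernel M N f) (mgrade (gr_kernel M N f))"
    by (rule graded_by_subgroup[OF M'(2,3) sub comp]; simp)+
  moreover have "smult M a x \<in> a_kernel M N f" if "a \<in> carrier R" "x \<in> a_kernel M N f" for a x
    using that lin_map_smult[OF fl] smult_closed[OF M'(1)] smult_zero[OF N'(1)] by (simp add: a_kernel_iff)
  ultimately show ?thesis using M'(1)
    unfolding gr_premodule_def pre_module_def by (auto simp: a_kernel_iff)
qed

lemma gr_kernel_left:
  assumes "graded_ring G R" "left_gr_module G R M" "left_gr_module G R N" "gr_hom G R M N f"
  shows "left_gr_module G R (gr_kernel M N f)"
proof -
  note k = gr_kernel_premodule[OF left_gr_module_premodule[OF assms(2)] left_gr_module_premodule[OF assms(3)] assms(4)]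
  have "smult M a x \<in> a_kernel M N f" if "a \<in> rgrade R \<sigma>" "\<sigma> \<in> carrier G" "x \<in> a_kernel M N f" for a \<sigma> x
    using smult_closed[OF gr_premoduleD(1)[OF k], of a x] that assms(1) graded_by_closed[of "carrier G" R "rgrade R" \<sigma> a]
    by (auto simp: graded_ring_def)
  then show ?thesis using k assms(2) unfolding left_gr_module_def gr_premodule_def
    by (auto simp: a_kernel_iff)
qed

lemma gr_kernel_right:
  assumes "graded_ring G R" "right_gr_module G R M" "right_gr_module G R N" "gr_hom G R M N f"
  shows "right_gr_module G R (gr_kernel M N f)"
proof -
  note k = gr_kernel_premodule[OF right_gr_module_premodule[OF assms(2)] right_gr_module_premodule[OF assms(3)] assms(4)]
  have "smult M a x \<in> a_kernel M N f" if "a \<in> rgrade R \<sigma>" "\<sigma> \<in> carrier G" "x \<in> a_kernel M N f" for a \<sigma> x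
    using smult_closed[OF gr_premoduleD(1)[OF k], of a x] that assms(1) graded_by_closed[of "carrier G" R "rgrade R" \<sigma> a]
    by (auto simp: graded_ring_def)
  then show ?thesis using k assms(2) unfolding right_gr_module_def gr_premodule_def
    by (auto simp: a_kernel_iff)
qed

section \<open>Graded free modules\<close>

text \<open>
  Let \<open>u\<close> be the component of \<open>\<one>\<close> in the neutral degree.  Comparing degrees in \<open>a = a \<otimes> \<one>\<close> shows
  \<open>a \<otimes> u = a\<close> for homogeneous \<open>a\<close>; adding this up over the components of \<open>\<one>\<close> gives \<open>u = \<one> \<otimes> u = \<one>\<close>.
\<close>

lemma graded_ring_unit:
  assumes "graded_ring G R"
  shows "\<one>\<^bsub>R\<^esub> \<in> rgrade R \<one>\<^bsub>G\<^esub>"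
proof -
  interpret G: group G using assms by (simp add: graded_ring_def)
  interpret R: ring R using assms by (simp add: graded_ring_def)
  have D: "graded_by (carrier G) R (rgrade R)" using assms by (simp add: graded_ring_def)
  have A: "abelian_group R" by (rule R.is_abelian_group)
  let ?c = "component (carrier G) R (rgrade R)"
  let ?e = "?c \<one>\<^bsub>G\<^esub> \<one>\<^bsub>R\<^esub>"
  have ec: "?e \<in> carrier R" by (rule component_in_carrier[OF A D]) auto
  have hom: "a \<otimes>\<^bsub>R\<^esub> ?e = a" if \<tau>: "\<tau> \<in> carrier G" and a: "a \<in> rgrade R \<tau>" for a \<tau>
  proof (rule component_decomposition[OF A D R.one_closed])
    fix S assume S: "finite S" "S \<subseteq> carrier G" "\<And>\<sigma>. \<sigma> \<in> carrier G - S \<Longrightarrow> ?c \<sigma> \<one>\<^bsub>R\<^esub> = \<zero>\<^bsub>R\<^esub>"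
      "\<one>\<^bsub>R\<^esub> = finsum R (\<lambda>\<sigma>. ?c \<sigma> \<one>\<^bsub>R\<^esub>) S"
    have ac: "a \<in> carrier R" using graded_by_closed[OF D \<tau> a] .
    have cc: "?c \<sigma> \<one>\<^bsub>R\<^esub> \<in> carrier R" if "\<sigma> \<in> S" for \<sigma> using component_in_carrier[OF A D] S(2) that by auto
    let ?m = "\<lambda>\<sigma>. \<tau> \<otimes>\<^bsub>G\<^esub> \<sigma>"
    let ?g = "\<lambda>\<rho>. a \<otimes>\<^bsub>R\<^esub> ?c (inv\<^bsub>G\<^esub> \<tau> \<otimes>\<^bsub>G\<^esub> \<rho>) \<one>\<^bsub>R\<^esub>"
    have canc: "inv\<^bsub>G\<^esub> \<tau> \<otimes>\<^bsub>G\<^esub> (\<tau> \<otimes>\<^bsub>G\<^esub> \<sigma>) = \<sigma>" if "\<sigma> \<in> carrier G" for \<sigma>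
      using that \<tau> by (simp add: G.m_assoc[symmetric])
    have inj: "inj_on ?m S" by (rule inj_on_inverseI[of _ "\<lambda>\<rho>. inv\<^bsub>G\<^esub> \<tau> \<otimes>\<^bsub>G\<^esub> \<rho>"]) (use canc S(2) in auto)
    have "a = a \<otimes>\<^bsub>R\<^esub> finsum R (\<lambda>\<sigma>. ?c \<sigma> \<one>\<^bsub>R\<^esub>) S" using ac S(4) by simp
    also have "\<dots> = finsum R (\<lambda>\<sigma>. a \<otimes>\<^bsub>R\<^esub> ?c \<sigma> \<one>\<^bsub>R\<^esub>) S"
      by (rule R.finsum_rdistr) (use S ac cc in auto)
    also have "\<dots> = finsum R (\<lambda>\<sigma>. ?g (?m \<sigma>)) S"
      by (rule R.finsum_cong') (use canc S ac cc in auto)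
    also have "\<dots> = finsum R ?g (?m ` S)"
      by (rule R.finsum_reindex[symmetric]) (use inj canc S ac cc in auto)
    finally have a_sum: "a = finsum R ?g (?m ` S)" .
    have g_in: "?g \<rho> \<in> rgrade R \<rho>" if "\<rho> \<in> ?m ` S" for \<rho>
    proof -
      obtain \<sigma> where \<sigma>: "\<sigma> \<in> S" "\<rho> = ?m \<sigma>" using \<open>\<rho> \<in> ?m ` S\<close> by blast
      then have "\<sigma> \<in> carrier G" using S(2) by blast
      then have "a \<otimes>\<^bsub>R\<^esub> ?c \<sigma> \<one>\<^bsub>R\<^esub> \<in> rgrade R (?m \<sigma>)"
        using assms a \<tau> component_closed[OF A D R.one_closed] by (simp add: graded_ring_def)
      then show ?thesis using canc \<sigma> \<open>\<sigma> \<in> carrier G\<close> by simp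
    qed
    have "?c \<tau> a = (if \<tau> \<in> ?m ` S then ?g \<tau> else \<zero>\<^bsub>R\<^esub>)"
      by (subst a_sum, rule component_finsum[OF A D]) (use g_in S \<tau> in auto)
    moreover have "?g \<tau> = a \<otimes>\<^bsub>R\<^esub> ?e" using \<tau> by simp
    moreover have "?g \<tau> = \<zero>\<^bsub>R\<^esub>" if "\<tau> \<notin> ?m ` S"
    proof -
      have "\<one>\<^bsub>G\<^esub> \<notin> S" using that \<tau> by (metis G.r_one imageI)
      then show ?thesis using S(3) \<tau> ac by simp
    qed
    ultimately show ?thesis using component_homogeneous[OF A D \<tau> \<tau> a] by (cases "\<tau> \<in> ?m ` S") auto
  qed
  have "?e = \<one>\<^bsub>R\<^esub> \<otimes>\<^bsub>R\<^esub> ?e" using ec by simp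
  also have "\<dots> = \<one>\<^bsub>R\<^esub>"
  proof (rule component_decomposition[OF A D R.one_closed])
    fix S assume S: "finite S" "S \<subseteq> carrier G" "\<one>\<^bsub>R\<^esub> = finsum R (\<lambda>\<sigma>. ?c \<sigma> \<one>\<^bsub>R\<^esub>) S"
    have cc: "?c \<sigma> \<one>\<^bsub>R\<^esub> \<in> carrier R" "?c \<sigma> \<one>\<^bsub>R\<^esub> \<otimes>\<^bsub>R\<^esub> ?e = ?c \<sigma> \<one>\<^bsub>R\<^esub>" if "\<sigma> \<in> S" for \<sigma>
      using component_in_carrier[OF A D] hom component_closed[OF A D R.one_closed] S(2) that by auto
    have "finsum R (\<lambda>\<sigma>. ?c \<sigma> \<one>\<^bsub>R\<^esub>) S \<otimes>\<^bsub>R\<^esub> ?e = finsum R (\<lambda>\<sigma>. ?c \<sigma> \<one>\<^bsub>R\<^esub> \<otimes>\<^bsub>R\<^esub> ?e) S"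
      by (rule R.finsum_ldistr) (use S ec cc in auto)
    also have "\<dots> = finsum R (\<lambda>\<sigma>. ?c \<sigma> \<one>\<^bsub>R\<^esub>) S"
      by (rule R.finsum_cong') (use cc in auto)
    finally show ?thesis using S(3) by simp
  qed
  finally show ?thesis using component_closed[OF A D R.one_closed G.one_closed] by simp
qed

lemma gr_free_simps:
  "f \<in> carrier (gr_free G R B \<delta>) \<longleftrightarrow>
     (\<forall>b\<in>B. f b \<in> carrier R) \<and> (\<forall>b. b \<notin> B \<longrightarrow> f b = \<zero>\<^bsub>R\<^esub>) \<and> finite {b. f b \<noteq> \<zero>\<^bsub>R\<^esub>}"
  "f \<in> mgrade (gr_free G R B \<delta>) \<sigma> \<longleftrightarrow>
     f \<in> carrier (gr_free G R B \<delta>) \<and> (\<forall>b\<in>B. f b \<in> rgrade R (\<sigma> \<otimes>\<^bsub>G\<^esub> \<delta> b))"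
  "\<zero>\<^bsub>gr_free G R B \<delta>\<^esub> = (\<lambda>_. \<zero>\<^bsub>R\<^esub>)"
  "f \<oplus>\<^bsub>gr_free G R B \<delta>\<^esub> g = (\<lambda>b. f b \<oplus>\<^bsub>R\<^esub> g b)"
  "smult (gr_free G R B \<delta>) a f = (\<lambda>b. a \<otimes>\<^bsub>R\<^esub> f b)"
  by (simp_all add: gr_free_def Let_def)

lemma gr_free_value:
  "ring R \<Longrightarrow> f \<in> carrier (gr_free G R B \<delta>) \<Longrightarrow> f b \<in> carrier R"
  by (cases "b \<in> B") (auto simp: gr_free_simps ring.ring_simprules)

lemma gr_free_carrierI:
  assumes "\<And>b. b \<in> B \<Longrightarrow> f b \<in> carrier R" "\<And>b. b \<notin> S \<Longrightarrow> f b = \<zero>\<^bsub>R\<^esub>" "finite S" "S \<subseteq> B"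
  shows "f \<in> carrier (gr_free G R B \<delta>)"
proof -
  have "{b. f b \<noteq> \<zero>\<^bsub>R\<^esub>} \<subseteq> S" using assms(2) by blast
  then show ?thesis using assms finite_subset unfolding gr_free_simps by blast
qed

lemma gr_free_pre_module:
  assumes "ring R"
  shows "pre_module R (gr_free G R B \<delta>)"
proof -
  interpret R: ring R by fact
  let ?F = "gr_free G R B \<delta>"
  have v: "f b \<in> carrier R" if "f \<in> carrier ?F" for f b by (rule gr_free_value[OF assms that])
  have add: "f \<oplus>\<^bsub>?F\<^esub> g \<in> carrier ?F" if "f \<in> carrier ?F" "g \<in> carrier ?F" for f g
    by (rule gr_free_carrierI[of _ _ _ "{b. f b \<noteq> \<zero>\<^bsub>R\<^esub>} \<union> {b. g b \<noteq> \<zero>\<^bsub>R\<^esub>}"])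
      (use that in \<open>auto simp: gr_free_simps\<close>)
  have smult: "smult ?F a f \<in> carrier ?F" if "f \<in> carrier ?F" "a \<in> carrier R" for f a
    by (rule gr_free_carrierI[of _ _ _ "{b. f b \<noteq> \<zero>\<^bsub>R\<^esub>}"]) (use that in \<open>auto simp: gr_free_simps\<close>)
  have F0: "\<zero>\<^bsub>?F\<^esub> \<in> carrier ?F" by (simp add: gr_free_simps)
  have "abelian_group ?F"
  proof (rule abelian_groupI, goal_cases)
    case (6 f)
    have "(\<lambda>b. \<ominus>\<^bsub>R\<^esub> f b) \<in> carrier ?F"
      by (rule gr_free_carrierI[of _ _ _ "{b. f b \<noteq> \<zero>\<^bsub>R\<^esub>}"]) (use 6 in \<open>auto simp: gr_free_simps\<close>)
    then show ?case using v[OF 6] by (intro bexI[of _ "\<lambda>b. \<ominus>\<^bsub>R\<^esub> f b"]) (auto simp: gr_free_simps R.l_neg)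
  qed (insert add F0, auto simp: gr_free_simps(3,4) v R.a_ac)
  then show ?thesis unfolding pre_module_def using v smult
    by (simp add: gr_free_simps(4,5) R.l_distr R.r_distr)
qed

lemma gr_free_finsum_value:
  assumes "ring R" "\<And>s. s \<in> S \<Longrightarrow> h s \<in> carrier (gr_free G R B \<delta>)"
  shows "finsum (gr_free G R B \<delta>) h S b = finsum R (\<lambda>s. h s b) S"
  by (rule abelian_group.additive_map_finsum[where f = "\<lambda>f. f b"])
    (use assms gr_free_value[OF assms(1)] pre_module_abelian_group[OF gr_free_pre_module[OF assms(1)]]
      in \<open>auto simp: gr_free_simps(4) ring.is_abelian_group\<close>)

text \<open>
  The projection onto degree \<open>\<sigma>\<close> takes, at the place \<open>b\<close>, the component of degree \<open>\<sigma> \<otimes> \<delta> b\<close> in \<open>R\<close>.  An element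
  has finitely many nonzero places with finitely many nonzero components each, so it has finitely many
  nonzero projections; their sum is computed place by place.
\<close>

lemma gr_free_left_gr_module:
  assumes gr: "graded_ring G R" and \<delta>: "\<delta> \<in> B \<rightarrow> carrier G"
  shows "left_gr_module G R (gr_free G R B \<delta>)"
proof -
  interpret G: group G using gr by (simp add: graded_ring_def)
  have Rr: "ring R" using gr by (simp add: graded_ring_def)
  interpret R: ring R by (rule Rr)
  have D: "graded_by (carrier G) R (rgrade R)" using gr by (simp add: graded_ring_def)
  note A = R.is_abelian_group
  let ?F = "gr_free G R B \<delta>" and ?c = "component (carrier G) R (rgrade R)"
  note pm = gr_free_pre_module[OF Rr, of G B \<delta>]
  have v: "f b \<in> carrier R" if "f \<in> carrier ?F" for f b by (rule gr_free_value[OF Rr that])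
  interpret F: abelian_group ?F by (rule pre_module_abelian_group[OF pm])
  have d: "\<delta> b \<in> carrier G" if "b \<in> B" for b using that \<delta> by auto
  define p where "p = (\<lambda>\<sigma> f b. if b \<in> B then ?c (\<sigma> \<otimes>\<^bsub>G\<^esub> \<delta> b) (f b) else \<zero>\<^bsub>R\<^esub>)"
  have c0: "?c \<tau> \<zero>\<^bsub>R\<^esub> = \<zero>\<^bsub>R\<^esub>" if "\<tau> \<in> carrier G" for \<tau>
    using component_homogeneous[OF A D that that graded_by_zero[OF D that]] by simp
  have pF: "p \<sigma> f \<in> carrier ?F" if "f \<in> carrier ?F" "\<sigma> \<in> carrier G" for \<sigma> f
  proof (rule gr_free_carrierI)
    show "finite {b. f b \<noteq> \<zero>\<^bsub>R\<^esub>}" "{b. f b \<noteq> \<zero>\<^bsub>R\<^esub>} \<subseteq> B" using that by (auto simp: gr_free_simps)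
    show "p \<sigma> f b \<in> carrier R" if "b \<in> B" for b
      using that component_in_carrier[OF A D v[OF \<open>f \<in> carrier ?F\<close>]] d \<open>\<sigma> \<in> carrier G\<close> by (simp add: p_def)
    show "p \<sigma> f b = \<zero>\<^bsub>R\<^esub>" if "b \<notin> {b. f b \<noteq> \<zero>\<^bsub>R\<^esub>}" for b
      using that c0 d \<open>\<sigma> \<in> carrier G\<close> by (auto simp: p_def)
  qed
  have "graded_by (carrier G) ?F (mgrade ?F)"
  proof (rule graded_byI[where p = p])
    show "abelian_group ?F" using pm by (rule pre_module_abelian_group)
  next
    fix \<sigma> assume \<sigma>: "\<sigma> \<in> carrier G"
    have "subgroup (mgrade ?F \<sigma>) (add_monoid ?F)"
    proof (rule group.subgroupI[OF F.a_group])
      show "mgrade ?F \<sigma> \<subseteq> carrier (add_monoid ?F)" by (auto simp: gr_free_simps(2))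
      have "\<zero>\<^bsub>?F\<^esub> \<in> mgrade ?F \<sigma>" using graded_by_zero[OF D] \<sigma> d F.zero_closed
        by (auto simp: gr_free_simps(2) gr_free_simps(3))
      then show "mgrade ?F \<sigma> \<noteq> {}" by blast
      fix f assume f: "f \<in> mgrade ?F \<sigma>"
      then have fc: "f \<in> carrier ?F" by (simp add: gr_free_simps(2))
      have nb: "(\<ominus>\<^bsub>?F\<^esub> f) b = \<ominus>\<^bsub>R\<^esub> f b" for b
      proof -
        have "(\<ominus>\<^bsub>?F\<^esub> f \<oplus>\<^bsub>?F\<^esub> f) b = \<zero>\<^bsub>R\<^esub>" using fc by (simp add: F.l_neg gr_free_simps(3))
        then show ?thesis using v[OF fc, of b] v[OF F.a_inv_closed[OF fc], of b]
          by (intro R.minus_equality[symmetric]) (auto simp: gr_free_simps(4))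
      qed
      show "inv\<^bsub>add_monoid ?F\<^esub> f \<in> mgrade ?F \<sigma>"
        using f fc F.a_inv_closed[OF fc] graded_by_neg[OF A D] \<sigma> d nb
        by (auto simp: gr_free_simps(2) simp flip: a_inv_def)
      fix g assume g: "g \<in> mgrade ?F \<sigma>"
      show "f \<otimes>\<^bsub>add_monoid ?F\<^esub> g \<in> mgrade ?F \<sigma>"
        using f g graded_by_add[OF D] \<sigma> d F.a_closed[of f g]
        by (auto simp: gr_free_simps(2) gr_free_simps(4))
    qed
    then show "additive_subgroup (mgrade ?F \<sigma>) ?F" by (simp add: additive_subgroup_def)
  next
    fix \<sigma> f assume "\<sigma> \<in> carrier G" "f \<in> carrier ?F"
    then show "p \<sigma> f \<in> mgrade ?F \<sigma>"
      unfolding gr_free_simps(2) using pF component_closed[OF A D v[OF \<open>f \<in> carrier ?F\<close>]] d by (simp add: p_def)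
  next
    fix f assume f: "f \<in> carrier ?F"
    let ?S = "{b. f b \<noteq> \<zero>\<^bsub>R\<^esub>}"
    let ?T = "\<Union>b\<in>?S. (\<lambda>\<rho>. \<rho> \<otimes>\<^bsub>G\<^esub> inv\<^bsub>G\<^esub> \<delta> b) ` {\<rho>\<in>carrier G. ?c \<rho> (f b) \<noteq> \<zero>\<^bsub>R\<^esub>}"
    have fin: "finite ?S" "?S \<subseteq> B" using f by (auto simp: gr_free_simps)
    have sub: "{\<sigma>\<in>carrier G. p \<sigma> f \<noteq> \<zero>\<^bsub>?F\<^esub>} \<subseteq> ?T"
    proof
      fix \<sigma> assume "\<sigma> \<in> {\<sigma>\<in>carrier G. p \<sigma> f \<noteq> \<zero>\<^bsub>?F\<^esub>}"
      then obtain b where \<sigma>: "\<sigma> \<in> carrier G" and "p \<sigma> f b \<noteq> \<zero>\<^bsub>R\<^esub>" by (auto simp: gr_free_simps(3) fun_eq_iff)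
      then have b: "b \<in> B" "?c (\<sigma> \<otimes>\<^bsub>G\<^esub> \<delta> b) (f b) \<noteq> \<zero>\<^bsub>R\<^esub>" by (auto simp: p_def split: if_splits)
      then have "b \<in> ?S" using c0 d \<sigma> by auto
      moreover have "\<sigma> = (\<sigma> \<otimes>\<^bsub>G\<^esub> \<delta> b) \<otimes>\<^bsub>G\<^esub> inv\<^bsub>G\<^esub> \<delta> b" using \<sigma> d[OF b(1)] by (simp add: G.m_assoc)
      ultimately show "\<sigma> \<in> ?T" using b \<sigma> d by blast
    qed
    moreover have "finite ?T" using fin finite_components[OF A D v[OF f]] by blast
    ultimately show pfin: "finite {\<sigma>\<in>carrier G. p \<sigma> f \<noteq> \<zero>\<^bsub>?F\<^esub>}" using finite_subset by blast
    let ?P = "{\<sigma>\<in>carrier G. p \<sigma> f \<noteq> \<zero>\<^bsub>?F\<^esub>}"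
    show "f = finsum ?F (\<lambda>\<sigma>. p \<sigma> f) ?P"
    proof
      fix b
      have eq: "finsum ?F (\<lambda>\<sigma>. p \<sigma> f) ?P b = finsum R (\<lambda>\<sigma>. p \<sigma> f b) ?P"
        by (rule gr_free_finsum_value[OF Rr]) (use pF f in auto)
      show "f b = finsum ?F (\<lambda>\<sigma>. p \<sigma> f) ?P b"
      proof (cases "b \<in> B")
        case True
        let ?m = "\<lambda>\<sigma>. \<sigma> \<otimes>\<^bsub>G\<^esub> \<delta> b"
        have cl: "?c \<rho> (f b) \<in> carrier R" if "\<rho> \<in> carrier G" for \<rho>
          using component_in_carrier[OF A D v[OF f] that] .
        have canc: "(\<rho> \<otimes>\<^bsub>G\<^esub> inv\<^bsub>G\<^esub> \<delta> b) \<otimes>\<^bsub>G\<^esub> \<delta> b = \<rho>" if "\<rho> \<in> carrier G" for \<rho>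
          using that d[OF True] by (simp add: G.m_assoc)
        have canc': "(\<rho> \<otimes>\<^bsub>G\<^esub> \<delta> b) \<otimes>\<^bsub>G\<^esub> inv\<^bsub>G\<^esub> \<delta> b = \<rho>" if "\<rho> \<in> carrier G" for \<rho>
          using that d[OF True] by (simp add: G.m_assoc)
        have "finsum R (\<lambda>\<sigma>. p \<sigma> f b) ?P = finsum R (\<lambda>\<sigma>. ?c (?m \<sigma>) (f b)) ?P"
          by (rule R.finsum_cong') (use True cl d in \<open>auto simp: p_def\<close>)
        also have "\<dots> = finsum R (\<lambda>\<rho>. ?c \<rho> (f b)) (?m ` ?P)"
        proof (rule R.finsum_reindex[symmetric])
          show "inj_on ?m ?P" by (rule inj_on_inverseI[of _ "\<lambda>\<rho>. \<rho> \<otimes>\<^bsub>G\<^esub> inv\<^bsub>G\<^esub> \<delta> b"]) (use canc' in auto)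
        qed (use cl d[OF True] in auto)
        also have "\<dots> = f b"
        proof (rule finsum_components[OF A D v[OF f]])
          show "finite (?m ` ?P)" using pfin by blast
          show "?m ` ?P \<subseteq> carrier G" using d[OF True] by auto
          fix \<rho> assume \<rho>: "\<rho> \<in> carrier G - ?m ` ?P"
          have "\<rho> \<otimes>\<^bsub>G\<^esub> inv\<^bsub>G\<^esub> \<delta> b \<notin> ?P"
          proof
            assume "\<rho> \<otimes>\<^bsub>G\<^esub> inv\<^bsub>G\<^esub> \<delta> b \<in> ?P"
            then have "?m (\<rho> \<otimes>\<^bsub>G\<^esub> inv\<^bsub>G\<^esub> \<delta> b) \<in> ?m ` ?P" by (rule imageI)
            then show False using canc \<rho> by simp
          qed
          then have "p (\<rho> \<otimes>\<^bsub>G\<^esub> inv\<^bsub>G\<^esub> \<delta> b) f b = \<zero>\<^bsub>R\<^esub>" using \<rho> d[OF True] by (auto simp: gr_free_simps(3))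
          then show "?c \<rho> (f b) = \<zero>\<^bsub>R\<^esub>" using canc \<rho> True by (simp add: p_def)
        qed
        finally show ?thesis using eq by simp
      next
        case False
        then have "finsum R (\<lambda>\<sigma>. p \<sigma> f b) ?P = \<zero>\<^bsub>R\<^esub>" by (simp add: p_def R.finsum_zero)
        then show ?thesis using eq False f by (simp add: gr_free_simps(1))
      qed
    qed
  next
    fix \<sigma> f g assume "\<sigma> \<in> carrier G" "f \<in> carrier ?F" "g \<in> carrier ?F"
    then show "p \<sigma> (f \<oplus>\<^bsub>?F\<^esub> g) = p \<sigma> f \<oplus>\<^bsub>?F\<^esub> p \<sigma> g"
      using component_add[OF A D v[of f] v[of g]] d by (simp add: p_def gr_free_simps(4) fun_eq_iff)
  next
    fix \<sigma> \<tau> f assume s: "\<sigma> \<in> carrier G" "\<tau> \<in> carrier G" and f: "f \<in> mgrade ?F \<sigma>"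
    show "p \<tau> f = (if \<tau> = \<sigma> then f else \<zero>\<^bsub>?F\<^esub>)"
    proof
      fix b
      show "p \<tau> f b = (if \<tau> = \<sigma> then f else \<zero>\<^bsub>?F\<^esub>) b"
        using s f d component_homogeneous[OF A D, of "\<sigma> \<otimes>\<^bsub>G\<^esub> \<delta> b" "\<tau> \<otimes>\<^bsub>G\<^esub> \<delta> b" "f b"]
        by (cases "b \<in> B") (auto simp: p_def gr_free_simps)
    qed
  qed
  moreover have "smult ?F a f \<in> mgrade ?F (\<sigma> \<otimes>\<^bsub>G\<^esub> \<tau>)"
    if "\<sigma> \<in> carrier G" "\<tau> \<in> carrier G" "a \<in> rgrade R \<sigma>" "f \<in> mgrade ?F \<tau>" for \<sigma> \<tau> a f
  proof -
    have "smult ?F a f \<in> carrier ?F"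
      using smult_closed[OF pm] graded_by_closed[OF D that(1,3)] that(4) by (simp add: gr_free_simps(2))
    moreover have "a \<otimes>\<^bsub>R\<^esub> f b \<in> rgrade R (\<sigma> \<otimes>\<^bsub>G\<^esub> \<tau> \<otimes>\<^bsub>G\<^esub> \<delta> b)" if "b \<in> B" for b
      using gr \<open>\<sigma> \<in> carrier G\<close> \<open>\<tau> \<in> carrier G\<close> \<open>a \<in> rgrade R \<sigma>\<close> \<open>f \<in> mgrade ?F \<tau>\<close> d[OF that] that
      by (auto simp: graded_ring_def gr_free_simps(2) G.m_assoc)
    ultimately show ?thesis by (simp add: gr_free_simps(2) gr_free_simps(5))
  qed
  ultimately show ?thesis unfolding left_gr_module_def using pm
    by (simp add: gr_free_simps(5) R.m_assoc v)
qed

definition gr_basis :: "('g, 'r) gr_ring \<Rightarrow> 'b \<Rightarrow> 'b \<Rightarrow> 'r" where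
  "gr_basis R b = (\<lambda>c. if c = b then \<one>\<^bsub>R\<^esub> else \<zero>\<^bsub>R\<^esub>)"

lemma pre_module_add_closed:
  assumes "pre_module R M" "x \<in> carrier M" "y \<in> carrier M" shows "x \<oplus>\<^bsub>M\<^esub> y \<in> carrier M"
proof -
  interpret abelian_group M by (rule pre_module_abelian_group[OF assms(1)])
  show ?thesis using assms by simp
qed

text \<open>
  The value \<open>\<one>\<close> has neutral degree, and \<open>R(\<delta> b)\<close> shows it in degree \<open>\<sigma>\<close> with \<open>\<sigma> \<otimes> \<delta> b\<close> neutral.
\<close>

lemma gr_basis_homogeneous:
  assumes gr: "graded_ring G R" and b: "b \<in> B" and \<delta>: "\<delta> \<in> B \<rightarrow> carrier G"
  shows "gr_basis R b \<in> mgrade (gr_free G R B \<delta>) (inv\<^bsub>G\<^esub> \<delta> b)"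
proof -
  interpret G: group G using gr by (simp add: graded_ring_def)
  interpret R: ring R using gr by (simp add: graded_ring_def)
  have D: "graded_by (carrier G) R (rgrade R)" using gr by (simp add: graded_ring_def)
  have "gr_basis R b \<in> carrier (gr_free G R B \<delta>)"
    by (rule gr_free_carrierI[of _ _ _ "{b}"]) (use b in \<open>auto simp: gr_basis_def\<close>)
  moreover have "gr_basis R b c \<in> rgrade R (inv\<^bsub>G\<^esub> \<delta> b \<otimes>\<^bsub>G\<^esub> \<delta> c)" if "c \<in> B" for c
    using graded_ring_unit[OF gr] graded_by_zero[OF D, of "inv\<^bsub>G\<^esub> \<delta> b \<otimes>\<^bsub>G\<^esub> \<delta> c"] \<delta> b that
    by (auto simp: gr_basis_def Pi_iff)
  ultimately show ?thesis by (simp add: gr_free_simps(2))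
qed

lemma gr_basis_closed: "ring R \<Longrightarrow> b \<in> B \<Longrightarrow> gr_basis R b \<in> carrier (gr_free G R B \<delta>)"
  by (rule gr_free_carrierI[of _ _ _ "{b}"]) (auto simp: gr_basis_def ring.ring_simprules)

lemma gr_free_expansion:
  assumes R: "ring R" and f: "f \<in> carrier (gr_free G R B \<delta>)"
  shows "finsum (gr_free G R B \<delta>) (\<lambda>b. smult (gr_free G R B \<delta>) (f b) (gr_basis R b)) {b. f b \<noteq> \<zero>\<^bsub>R\<^esub>} = f"
proof
  interpret R: ring R by fact
  let ?F = "gr_free G R B \<delta>" and ?S = "{b. f b \<noteq> \<zero>\<^bsub>R\<^esub>}"
  have fin: "finite ?S" "?S \<subseteq> B" using f by (auto simp: gr_free_simps)
  have v: "f b \<in> carrier R" for b by (rule gr_free_value[OF R f])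
  fix c
  have "finsum ?F (\<lambda>b. smult ?F (f b) (gr_basis R b)) ?S c = finsum R (\<lambda>b. smult ?F (f b) (gr_basis R b) c) ?S"
    by (rule gr_free_finsum_value[OF R], rule smult_closed[OF gr_free_pre_module[OF R] v gr_basis_closed[OF R]])
      (use fin in blast)
  also have "\<dots> = finsum R (\<lambda>b. if c = b then f b else \<zero>\<^bsub>R\<^esub>) ?S"
    by (rule R.finsum_cong') (use v in \<open>auto simp: gr_free_simps(5) gr_basis_def\<close>)
  also have "\<dots> = f c"
  proof (cases "c \<in> ?S")
    case True
    then show ?thesis using R.finsum_singleton[OF True fin(1), of f] v by auto
  next
    case False
    then have "finsum R (\<lambda>b. if c = b then f b else \<zero>\<^bsub>R\<^esub>) ?S = finsum R (\<lambda>b. \<zero>\<^bsub>R\<^esub>) ?S"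
      by (intro R.finsum_cong') auto
    with False show ?thesis by (simp add: R.finsum_zero)
  qed
  finally show "finsum ?F (\<lambda>b. smult ?F (f b) (gr_basis R b)) ?S c = f c" .
qed

lemma graded_by_finsum:
  assumes "abelian_group M" "graded_by I M D" "\<sigma> \<in> I" "\<And>s. s \<in> S \<Longrightarrow> h s \<in> D \<sigma>"
  shows "finsum M h S \<in> D \<sigma>"
proof -
  interpret M: abelian_group M by fact
  show ?thesis using assms(4)
  proof (induction S rule: infinite_finite_induct)
    case (insert s S)
    moreover have "h \<in> S \<rightarrow> carrier M" "h s \<in> carrier M"
      using insert.prems graded_by_closed[OF assms(2,3)] by auto
    ultimately show ?case using graded_by_add[OF assms(2,3)] by simp
  qed (use graded_by_zero[OF assms(2,3)] in \<open>auto simp: M.finsum_infinite\<close>)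
qed

text \<open>
  Of an arbitrary preimage, the component of the right degree is again a preimage.
\<close>

lemma homogeneous_preimage:
  assumes M: "gr_premodule G R M" and N: "gr_premodule G R N" and p: "gr_hom G R M N p"
    and \<sigma>: "\<sigma> \<in> carrier G" and z: "z \<in> p ` carrier M" "z \<in> mgrade N \<sigma>"
  shows "\<exists>y\<in>mgrade M \<sigma>. p y = z"
proof -
  obtain x where x: "x \<in> carrier M" "p x = z" using z by blast
  note M' = gr_premoduleD(2,3)[OF M] and N' = gr_premoduleD(2,3)[OF N]
  have "p (component (carrier G) M (mgrade M) \<sigma> x) = z"
    using gr_hom_component[OF M N p \<sigma> x(1)] component_homogeneous[OF N' \<sigma> \<sigma> z(2)] x by simp
  then show ?thesis using component_closed[OF M' x(1) \<sigma>] by blast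
qed

text \<open>
  The basis element at \<open>b\<close> has degree \<open>inv (\<delta> b)\<close>, so this is the condition on \<open>y b\<close> that lets
  the linear extension have degree \<open>\<sigma>\<close>.
\<close>

lemma gr_free_extend:
  assumes gr: "graded_ring G R" and \<delta>: "\<delta> \<in> B \<rightarrow> carrier G" and M: "left_gr_module G R M"
    and \<sigma>: "\<sigma> \<in> carrier G" and y: "\<And>b. b \<in> B \<Longrightarrow> y b \<in> mgrade M (inv\<^bsub>G\<^esub> \<delta> b \<otimes>\<^bsub>G\<^esub> \<sigma>)"
  shows "deg_hom G R \<sigma> (gr_free G R B \<delta>) M (\<lambda>f. finsum M (\<lambda>b. smult M (f b) (y b)) {b. f b \<noteq> \<zero>\<^bsub>R\<^esub>})"
    (is "deg_hom G R \<sigma> ?F M ?h")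
proof -
  interpret G: group G using gr by (simp add: graded_ring_def)
  have Rr: "ring R" using gr by (simp add: graded_ring_def)
  interpret R: ring R by (rule Rr)
  note M' = gr_premoduleD[OF left_gr_module_premodule[OF M]]
  interpret M: abelian_group M by (rule M')
  have d: "\<delta> b \<in> carrier G" if "b \<in> B" for b using that \<delta> by auto
  have yc: "y b \<in> carrier M" if "b \<in> B" for b using graded_by_closed[OF M'(3) _ y[OF that]] d[OF that] \<sigma> by simp
  have v: "f b \<in> carrier R" if "f \<in> carrier ?F" for f b by (rule gr_free_value[OF Rr that])
  have fy: "smult M (f b) (y b) \<in> carrier M" if "f \<in> carrier ?F" "b \<in> B" for f b
    using smult_closed[OF M'(1)] v yc that by blast
  have supp: "?h f = finsum M (\<lambda>b. smult M (f b) (y b)) S"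
    if "f \<in> carrier ?F" "finite S" "{b. f b \<noteq> \<zero>\<^bsub>R\<^esub>} \<subseteq> S" "S \<subseteq> B" for f S
  proof (rule M.add.finprod_mono_neutral_cong_left[OF that(2,3)])
    show "(\<lambda>b. smult M (f b) (y b)) \<in> S \<rightarrow> carrier M" using that fy by blast
  next
    show "smult M (f b) (y b) = \<zero>\<^bsub>M\<^esub>" if "b \<in> S - {b. f b \<noteq> \<zero>\<^bsub>R\<^esub>}" for b
      using smult_zero_left[OF Rr M'(1)] yc that \<open>S \<subseteq> B\<close> by auto
  qed simp
  have fin: "finite {b. f b \<noteq> \<zero>\<^bsub>R\<^esub>}" "{b. f b \<noteq> \<zero>\<^bsub>R\<^esub>} \<subseteq> B" if "f \<in> carrier ?F" for f
    using that by (simp_all add: gr_free_simps(1)) blast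
  have "lin_map R ?F M ?h"
  proof (rule lin_mapI)
    fix f assume f: "f \<in> carrier ?F"
    show "?h f \<in> carrier M"
      by (rule M.finsum_closed, rule Pi_I, rule fy[OF f]) (use fin(2)[OF f] in blast)
  next
    fix f g assume f: "f \<in> carrier ?F" and g: "g \<in> carrier ?F"
    let ?S = "{b. f b \<noteq> \<zero>\<^bsub>R\<^esub>} \<union> {b. g b \<noteq> \<zero>\<^bsub>R\<^esub>}"
    have S: "finite ?S" "?S \<subseteq> B" using fin f g by auto
    have fg: "f \<oplus>\<^bsub>?F\<^esub> g \<in> carrier ?F"
      by (rule pre_module_add_closed[OF gr_free_pre_module[OF Rr] f g])
    have sub: "{b. (f \<oplus>\<^bsub>?F\<^esub> g) b \<noteq> \<zero>\<^bsub>R\<^esub>} \<subseteq> ?S" by (auto simp: gr_free_simps(4))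
    have "?h (f \<oplus>\<^bsub>?F\<^esub> g) = finsum M (\<lambda>b. smult M ((f \<oplus>\<^bsub>?F\<^esub> g) b) (y b)) ?S"
      by (rule supp[OF fg S(1) sub S(2)])
    also have "\<dots> = finsum M (\<lambda>b. smult M (f b) (y b) \<oplus>\<^bsub>M\<^esub> smult M (g b) (y b)) ?S"
    proof (rule M.finsum_cong')
      show "(\<lambda>b. smult M (f b) (y b) \<oplus>\<^bsub>M\<^esub> smult M (g b) (y b)) \<in> ?S \<rightarrow> carrier M"
        using fy[OF f] fy[OF g] S(2) by auto
      show "smult M ((f \<oplus>\<^bsub>?F\<^esub> g) b) (y b) = smult M (f b) (y b) \<oplus>\<^bsub>M\<^esub> smult M (g b) (y b)" if "b \<in> ?S" for b
        using smult_add_left[OF M'(1) v[OF f] v[OF g] yc, of b] that S(2) by (auto simp: gr_free_simps(4))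
    qed simp
    also have "\<dots> = finsum M (\<lambda>b. smult M (f b) (y b)) ?S \<oplus>\<^bsub>M\<^esub> finsum M (\<lambda>b. smult M (g b) (y b)) ?S"
      by (rule M.finsum_addf) (use fy[OF f] fy[OF g] S(2) in auto)
    also have "\<dots> = ?h f \<oplus>\<^bsub>M\<^esub> ?h g"
      using supp[OF f S(1) _ S(2)] supp[OF g S(1) _ S(2)] by auto
    finally show "?h (f \<oplus>\<^bsub>?F\<^esub> g) = ?h f \<oplus>\<^bsub>M\<^esub> ?h g" .
  next
    fix a f assume a: "a \<in> carrier R" and f: "f \<in> carrier ?F"
    let ?S = "{b. f b \<noteq> \<zero>\<^bsub>R\<^esub>}"
    have af: "smult ?F a f \<in> carrier ?F" using smult_closed[OF gr_free_pre_module[OF Rr] a f] .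
    have sub: "{b. smult ?F a f b \<noteq> \<zero>\<^bsub>R\<^esub>} \<subseteq> ?S" using a by (auto simp: gr_free_simps(5))
    have "?h (smult ?F a f) = finsum M (\<lambda>b. smult M (smult ?F a f b) (y b)) ?S"
      by (rule supp[OF af fin(1)[OF f] sub fin(2)[OF f]])
    also have "\<dots> = finsum M (\<lambda>b. smult M a (smult M (f b) (y b))) ?S"
    proof (rule M.finsum_cong')
      show "(\<lambda>b. smult M a (smult M (f b) (y b))) \<in> ?S \<rightarrow> carrier M"
        using fy[OF f] fin(2)[OF f] smult_closed[OF M'(1) a] by auto
      show "smult M (smult ?F a f b) (y b) = smult M a (smult M (f b) (y b))" if "b \<in> ?S" for b
        using M a v[OF f, of b] yc[of b] fin(2)[OF f] that by (auto simp: left_gr_module_def gr_free_simps(5))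
    qed simp
    also have "\<dots> = smult M a (?h f)"
      by (rule M.additive_map_finsum[OF M'(2), symmetric])
        (use fy[OF f] fin(2)[OF f] smult_closed[OF M'(1) a] smult_add[OF M'(1) a] in auto)
    finally show "?h (smult ?F a f) = smult M a (?h f)" .
  qed
  moreover have "?h f \<in> mgrade M (\<tau> \<otimes>\<^bsub>G\<^esub> \<sigma>)" if \<tau>: "\<tau> \<in> carrier G" and f: "f \<in> mgrade ?F \<tau>" for \<tau> f
  proof (rule graded_by_finsum[OF M'(2,3)])
    fix b assume "b \<in> {b. f b \<noteq> \<zero>\<^bsub>R\<^esub>}"
    then have b: "b \<in> B" using f by (auto simp: gr_free_simps)
    have db: "\<delta> b \<in> carrier G" by (rule d[OF b])
    have "f b \<in> rgrade R (\<tau> \<otimes>\<^bsub>G\<^esub> \<delta> b)" using f b by (simp add: gr_free_simps(2))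
    then have "smult M (f b) (y b) \<in> mgrade M ((\<tau> \<otimes>\<^bsub>G\<^esub> \<delta> b) \<otimes>\<^bsub>G\<^esub> (inv\<^bsub>G\<^esub> \<delta> b \<otimes>\<^bsub>G\<^esub> \<sigma>))"
      using M y[OF b] \<tau> db \<sigma> unfolding left_gr_module_def by blast
    moreover have "(\<tau> \<otimes>\<^bsub>G\<^esub> \<delta> b) \<otimes>\<^bsub>G\<^esub> (inv\<^bsub>G\<^esub> \<delta> b \<otimes>\<^bsub>G\<^esub> \<sigma>) = \<tau> \<otimes>\<^bsub>G\<^esub> \<sigma>"
      using \<tau> db \<sigma> G.m_assoc[of "\<delta> b" "inv\<^bsub>G\<^esub> \<delta> b" \<sigma>] by (simp add: G.m_assoc)
    ultimately show "smult M (f b) (y b) \<in> mgrade M (\<tau> \<otimes>\<^bsub>G\<^esub> \<sigma>)" by simp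
  qed (use \<tau> \<sigma> in simp)
  ultimately show ?thesis unfolding deg_hom_def by blast
qed

text \<open>
  Free modules are projective: it suffices to lift the images of the basis elements, and these are
  homogeneous.  Instead of surjectivity of \<open>p\<close>, only the image of \<open>f\<close> has to be covered, which allows lifting into the
  kernel of the next map of an exact complex and through the inclusion of a submodule.
\<close>

lemma gr_free_lift:
  assumes gr: "graded_ring G R" and \<delta>: "\<delta> \<in> B \<rightarrow> carrier G" and M: "left_gr_module G R M"
    and N: "left_gr_module G R N" and p: "gr_hom G R M N p" and \<sigma>: "\<sigma> \<in> carrier G"
    and f: "deg_hom G R \<sigma> (gr_free G R B \<delta>) N f"
    and im: "\<And>x. x \<in> carrier (gr_free G R B \<delta>) \<Longrightarrow> f x \<in> p ` carrier M"
  obtains h where "deg_hom G R \<sigma> (gr_free G R B \<delta>) M h"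
    "\<And>x. x \<in> carrier (gr_free G R B \<delta>) \<Longrightarrow> p (h x) = f x"
proof -
  interpret G: group G using gr by (simp add: graded_ring_def)
  have Rr: "ring R" using gr by (simp add: graded_ring_def)
  let ?F = "gr_free G R B \<delta>"
  note M' = gr_premoduleD[OF left_gr_module_premodule[OF M]]
  note N' = gr_premoduleD[OF left_gr_module_premodule[OF N]]
  note F' = gr_premoduleD[OF left_gr_module_premodule[OF gr_free_left_gr_module[OF gr \<delta>]]]
  have d: "\<delta> b \<in> carrier G" if "b \<in> B" for b using that \<delta> by auto
  have "\<forall>b\<in>B. \<exists>y\<in>mgrade M (inv\<^bsub>G\<^esub> \<delta> b \<otimes>\<^bsub>G\<^esub> \<sigma>). p y = f (gr_basis R b)"
  proof
    fix b assume b: "b \<in> B"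
    have "f (gr_basis R b) \<in> mgrade N (inv\<^bsub>G\<^esub> \<delta> b \<otimes>\<^bsub>G\<^esub> \<sigma>)"
      using deg_hom_grade[OF f _ gr_basis_homogeneous[OF gr b \<delta>]] d[OF b] by simp
    then show "\<exists>y\<in>mgrade M (inv\<^bsub>G\<^esub> \<delta> b \<otimes>\<^bsub>G\<^esub> \<sigma>). p y = f (gr_basis R b)"
      using homogeneous_preimage[OF left_gr_module_premodule[OF M] left_gr_module_premodule[OF N] p]
        im[OF gr_basis_closed[OF Rr b]] d[OF b] \<sigma> by simp
  qed
  then obtain y where y: "\<And>b. b \<in> B \<Longrightarrow> y b \<in> mgrade M (inv\<^bsub>G\<^esub> \<delta> b \<otimes>\<^bsub>G\<^esub> \<sigma>)"
    "\<And>b. b \<in> B \<Longrightarrow> p (y b) = f (gr_basis R b)" by metis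
  let ?h = "\<lambda>x. finsum M (\<lambda>b. smult M (x b) (y b)) {b. x b \<noteq> \<zero>\<^bsub>R\<^esub>}"
  have yc: "y b \<in> carrier M" if "b \<in> B" for b using graded_by_closed[OF M'(3) _ y(1)[OF that]] d[OF that] \<sigma> by simp
  show ?thesis
  proof (rule that[OF gr_free_extend[OF gr \<delta> M \<sigma> y(1)]])
    fix x assume x: "x \<in> carrier ?F"
    let ?S = "{b. x b \<noteq> \<zero>\<^bsub>R\<^esub>}"
    have S: "?S \<subseteq> B" using x by (auto simp: gr_free_simps)
    have v: "x b \<in> carrier R" for b by (rule gr_free_value[OF Rr x])
    interpret N: abelian_group N by (rule N')
    have e: "gr_basis R b \<in> carrier ?F" if "b \<in> ?S" for b by (rule gr_basis_closed[OF Rr subsetD[OF S that]])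
    have "p (?h x) = finsum N (\<lambda>b. p (smult M (x b) (y b))) ?S"
      by (rule lin_map_finsum[OF M'(2) N'(2) gr_hom_lin[OF p]]) (use smult_closed[OF M'(1) v yc] S in auto)
    also have "\<dots> = finsum N (\<lambda>b. f (smult ?F (x b) (gr_basis R b))) ?S"
    proof (rule N.finsum_cong')
      show "(\<lambda>b. f (smult ?F (x b) (gr_basis R b))) \<in> ?S \<rightarrow> carrier N"
        by (rule Pi_I, rule lin_map_closed[OF deg_hom_lin[OF f] smult_closed[OF F'(1) v e]])
      show "p (smult M (x b) (y b)) = f (smult ?F (x b) (gr_basis R b))" if "b \<in> ?S" for b
        by (simp only: lin_map_smult[OF gr_hom_lin[OF p] v yc[OF subsetD[OF S that]]]
            lin_map_smult[OF deg_hom_lin[OF f] v e[OF that]] y(2)[OF subsetD[OF S that]])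
    qed simp
    also have "\<dots> = f (finsum ?F (\<lambda>b. smult ?F (x b) (gr_basis R b)) ?S)"
      by (rule lin_map_finsum[OF F'(2) N'(2) deg_hom_lin[OF f], symmetric]) (rule smult_closed[OF F'(1) v e])
    also have "\<dots> = f x" by (simp only: gr_free_expansion[OF Rr x])
    finally show "p (?h x) = f x" .
  qed
qed

section \<open>Comparison of free resolutions\<close>

lemma gr_resolutionD:
  assumes "gr_resolution G R M P d \<epsilon>"
  shows "left_gr_module G R (P i)" "gr_hom G R (P (Suc i)) (P i) (d i)" "gr_hom G R (P 0) M \<epsilon>"
    "\<epsilon> ` carrier (P 0) = carrier M" "d 0 ` carrier (P (Suc 0)) = a_kernel (P 0) M \<epsilon>"
    "d (Suc i) ` carrier (P (Suc (Suc i))) = a_kernel (P (Suc i)) (P i) (d i)"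
  using assms by (auto simp: gr_resolution_def)

lemma gr_resolution_dd:
  assumes "gr_resolution G R M P d \<epsilon>" "x \<in> carrier (P (Suc (Suc i)))"
  shows "d i (d (Suc i) x) = \<zero>\<^bsub>P i\<^esub>"
  using gr_resolutionD(6)[OF assms(1), of i] assms(2) by (force simp: a_kernel_iff)

lemma gr_resolution_augment:
  assumes "gr_resolution G R M P d \<epsilon>" "x \<in> carrier (P (Suc 0))"
  shows "\<epsilon> (d 0 x) = \<zero>\<^bsub>M\<^esub>"
  using gr_resolutionD(5)[OF assms(1)] assms(2) by (force simp: a_kernel_iff)

text \<open>
  The existential form of freeness is the one in which \<open>gr_free_resolution\<close> provides it.
\<close>

lemma free_module_lift:
  assumes gr: "graded_ring G R" and P: "\<exists>B \<delta>. \<delta> \<in> B \<rightarrow> carrier G \<and> P = gr_free G R B \<delta>"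
    and M: "left_gr_module G R M" and N: "left_gr_module G R N" and p: "gr_hom G R M N p"
    and \<sigma>: "\<sigma> \<in> carrier G" and f: "deg_hom G R \<sigma> P N f"
    and im: "\<And>x. x \<in> carrier P \<Longrightarrow> f x \<in> p ` carrier M"
  obtains h where "deg_hom G R \<sigma> P M h" "\<And>x. x \<in> carrier P \<Longrightarrow> p (h x) = f x"
proof -
  obtain B \<delta> where P': "\<delta> \<in> B \<rightarrow> carrier G" "P = gr_free G R B \<delta>" using P by blast
  show ?thesis
    by (rule gr_free_lift[OF gr P'(1) M N p \<sigma>, of f]) (use f im that P'(2) in auto)
qed

lemma free_module_lift_gr_hom:
  assumes gr: "graded_ring G R" and P: "\<exists>B \<delta>. \<delta> \<in> B \<rightarrow> carrier G \<and> P = gr_free G R B \<delta>"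
    and M: "left_gr_module G R M" and N: "left_gr_module G R N" and p: "gr_hom G R M N p"
    and f: "gr_hom G R P N f" and im: "\<And>x. x \<in> carrier P \<Longrightarrow> f x \<in> p ` carrier M"
  obtains h where "gr_hom G R P M h" "\<And>x. x \<in> carrier P \<Longrightarrow> p (h x) = f x"
proof -
  interpret G: group G using gr by (simp add: graded_ring_def)
  note eq = gr_hom_iff_deg_hom_one[OF G.is_group]
  show ?thesis
    by (rule free_module_lift[OF gr P M N p G.one_closed, of f]) (use f im that in \<open>auto simp: eq\<close>)
qed

text \<open>
  The maps are lifted one degree at a time.  For the recursion to continue, \<open>f i \<circ> d i\<close> has to map into
  the image of \<open>d' i\<close>; this invariant holds at \<open>0\<close> by compatibility with the augmentations and is
  passed on because \<open>d i \<circ> d (i + 1) = 0\<close>.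
\<close>

lemma chain_map_exists:
  assumes gr: "graded_ring G R" and P: "gr_free_resolution G R M P d \<epsilon>"
    and Q: "gr_resolution G R M Q d' \<epsilon>'" and M: "left_gr_module G R M"
  obtains f where "\<And>i. gr_hom G R (P i) (Q i) (f i)" "\<And>x. x \<in> carrier (P 0) \<Longrightarrow> \<epsilon>' (f 0 x) = \<epsilon> x"
    "\<And>i x. x \<in> carrier (P (Suc i)) \<Longrightarrow> d' i (f (Suc i) x) = f i (d i x)"
proof -
  have P': "gr_resolution G R M P d \<epsilon>" and free: "\<exists>B \<delta>. \<delta> \<in> B \<rightarrow> carrier G \<and> P i = gr_free G R B \<delta>" for i
    using P by (auto simp: gr_free_resolution_def)
  note p = gr_resolutionD[OF P'] and q = gr_resolutionD[OF Q]
  let ?S = "\<lambda>i f. gr_hom G R (P i) (Q i) f \<and> (i = 0 \<longrightarrow> (\<forall>x\<in>carrier (P 0). \<epsilon>' (f x) = \<epsilon> x)) \<and>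
      (\<forall>x\<in>carrier (P (Suc i)). f (d i x) \<in> d' i ` carrier (Q (Suc i)))"
  have ex: "\<exists>f. \<forall>i. ?S i (f i) \<and> (\<forall>x\<in>carrier (P (Suc i)). d' i (f (Suc i) x) = f i (d i x))"
  proof (rule dependent_nat_choice)
    have "\<epsilon> x \<in> \<epsilon>' ` carrier (Q 0)" if "x \<in> carrier (P 0)" for x
      using lin_map_closed[OF gr_hom_lin[OF p(3)] that] q(4) by simp
    then obtain f where f: "gr_hom G R (P 0) (Q 0) f" "\<And>x. x \<in> carrier (P 0) \<Longrightarrow> \<epsilon>' (f x) = \<epsilon> x"
      using free_module_lift_gr_hom[OF gr free q(1) M q(3) p(3)] by metis
    have "f (d 0 x) \<in> d' 0 ` carrier (Q (Suc 0))" if x: "x \<in> carrier (P (Suc 0))" for x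
    proof -
      have dx: "d 0 x \<in> carrier (P 0)" by (rule lin_map_closed[OF gr_hom_lin[OF p(2)] x])
      have "\<epsilon>' (f (d 0 x)) = \<zero>\<^bsub>M\<^esub>" using f(2)[OF dx] gr_resolution_augment[OF P' x] by simp
      then show ?thesis unfolding q(5) a_kernel_iff using lin_map_closed[OF gr_hom_lin[OF f(1)] dx] by simp
    qed
    then show "\<exists>f. ?S 0 f" using f by blast
  next
    fix f i assume f: "?S i f"
    have "gr_hom G R (P (Suc i)) (Q i) (\<lambda>x. f (d i x))" using gr_hom_comp[OF p(2)] f by blast
    then obtain f' where f': "gr_hom G R (P (Suc i)) (Q (Suc i)) f'"
      "\<And>x. x \<in> carrier (P (Suc i)) \<Longrightarrow> d' i (f' x) = f (d i x)"
      using free_module_lift_gr_hom[OF gr free q(1) q(1) q(2)] f by metis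
    have "f' (d (Suc i) x) \<in> d' (Suc i) ` carrier (Q (Suc (Suc i)))" if x: "x \<in> carrier (P (Suc (Suc i)))" for x
    proof -
      have dx: "d (Suc i) x \<in> carrier (P (Suc i))" by (rule lin_map_closed[OF gr_hom_lin[OF p(2)] x])
      have "f \<zero>\<^bsub>P i\<^esub> = \<zero>\<^bsub>Q i\<^esub>"
        using f lin_map_zero gr_hom_lin gr_premoduleD(2)[OF left_gr_module_premodule[OF p(1)]]
          gr_premoduleD(2)[OF left_gr_module_premodule[OF q(1)]] by metis
      then have "d' i (f' (d (Suc i) x)) = \<zero>\<^bsub>Q i\<^esub>" using f'(2)[OF dx] gr_resolution_dd[OF P' x] by simp
      then show ?thesis unfolding q(6) a_kernel_iff using lin_map_closed[OF gr_hom_lin[OF f'(1)] dx] by simp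
    qed
    then show "\<exists>f'. ?S (Suc i) f' \<and> (\<forall>x\<in>carrier (P (Suc i)). d' i (f' x) = f (d i x))" using f' by blast
  qed
  obtain f where f: "\<forall>i. ?S i (f i) \<and> (\<forall>x\<in>carrier (P (Suc i)). d' i (f (Suc i) x) = f i (d i x))"
    using ex by (rule exE)
  show ?thesis
  proof (rule that[of f])
    show "gr_hom G R (P i) (Q i) (f i)" for i using spec[OF f, of i] by (elim conjE)
    show "\<epsilon>' (f 0 x) = \<epsilon> x" if "x \<in> carrier (P 0)" for x using spec[OF f, of 0] that by blast
    show "d' i (f (Suc i) x) = f i (d i x)" if "x \<in> carrier (P (Suc i))" for i x
      using spec[OF f, of i] that by blast
  qed
qed

text \<open>
  A chain endomorphism of a free resolution that induces zero on the augmented module is null-homotopic.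
  The map \<open>s (i + 1)\<close> lifts \<open>\<phi> (i + 1) - s i \<circ> d i\<close>; the invariant
  \<open>d i \<circ> s i \<circ> d i = \<phi> i \<circ> d i\<close> ensures that this difference maps into the kernel of \<open>d i\<close>.
\<close>

lemma homotopy_exists:
  assumes gr: "graded_ring G R" and P: "gr_free_resolution G R M P d \<epsilon>" and M: "left_gr_module G R M"
    and \<phi>: "\<And>i. gr_hom G R (P i) (P i) (\<phi> i)" and \<phi>0: "\<And>x. x \<in> carrier (P 0) \<Longrightarrow> \<epsilon> (\<phi> 0 x) = \<zero>\<^bsub>M\<^esub>"
    and \<phi>d: "\<And>i x. x \<in> carrier (P (Suc i)) \<Longrightarrow> d i (\<phi> (Suc i) x) = \<phi> i (d i x)"
  obtains s where "\<And>i. gr_hom G R (P i) (P (Suc i)) (s i)"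
    "\<And>i x. x \<in> carrier (P (Suc i)) \<Longrightarrow> \<phi> (Suc i) x = d (Suc i) (s (Suc i) x) \<oplus>\<^bsub>P (Suc i)\<^esub> s i (d i x)"
proof -
  interpret G: group G using gr by (simp add: graded_ring_def)
  have P': "gr_resolution G R M P d \<epsilon>" and free: "\<exists>B \<delta>. \<delta> \<in> B \<rightarrow> carrier G \<and> P i = gr_free G R B \<delta>" for i
    using P by (auto simp: gr_free_resolution_def)
  note p = gr_resolutionD[OF P']
  have pm: "gr_premodule G R (P i)" for i by (rule left_gr_module_premodule[OF p(1)])
  have ag: "abelian_group (P i)" for i by (rule gr_premoduleD[OF pm])
  have d: "d i x \<in> carrier (P i)" if "x \<in> carrier (P (Suc i))" for i x by (rule lin_map_closed[OF gr_hom_lin[OF p(2)] that])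
  have c\<phi>: "\<phi> i x \<in> carrier (P i)" if "x \<in> carrier (P i)" for i x by (rule lin_map_closed[OF gr_hom_lin[OF \<phi>] that])
  let ?S = "\<lambda>i s. gr_hom G R (P i) (P (Suc i)) s \<and> (\<forall>x\<in>carrier (P (Suc i)). d i (s (d i x)) = \<phi> i (d i x))"
  have ex: "\<exists>s. \<forall>i. ?S i (s i) \<and>
     (\<forall>x\<in>carrier (P (Suc i)). \<phi> (Suc i) x = d (Suc i) (s (Suc i) x) \<oplus>\<^bsub>P (Suc i)\<^esub> s i (d i x))"
  proof (rule dependent_nat_choice)
    have "\<phi> 0 x \<in> d 0 ` carrier (P (Suc 0))" if "x \<in> carrier (P 0)" for x
      unfolding p(5) a_kernel_iff using \<phi>0[OF that] c\<phi>[OF that] by simp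
    then obtain s where "gr_hom G R (P 0) (P (Suc 0)) s" "\<And>x. x \<in> carrier (P 0) \<Longrightarrow> d 0 (s x) = \<phi> 0 x"
      using free_module_lift_gr_hom[OF gr free p(1) p(1) p(2) \<phi>] by metis
    then show "\<exists>s. ?S 0 s" using d by blast
  next
    fix s i assume s: "?S i s"
    interpret Pi: abelian_group "P i" by (rule ag)
    interpret PS: abelian_group "P (Suc i)" by (rule ag)
    have cs: "s x \<in> carrier (P (Suc i))" if "x \<in> carrier (P i)" for x
      using lin_map_closed[OF gr_hom_lin[OF conjunct1[OF s]] that] .
    let ?\<psi> = "\<lambda>x. \<phi> (Suc i) x \<oplus>\<^bsub>P (Suc i)\<^esub> \<ominus>\<^bsub>P (Suc i)\<^esub> s (d i x)"
    have "gr_hom G R (P (Suc i)) (P (Suc i)) (\<lambda>x. s (d i x))" using gr_hom_comp[OF p(2)] s by blast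
    then have \<psi>: "gr_hom G R (P (Suc i)) (P (Suc i)) ?\<psi>"
      unfolding gr_hom_iff_deg_hom_one[OF G.is_group]
      by (intro deg_hom_add_maps[OF G.is_group G.one_closed pm] deg_hom_neg_map[OF G.is_group G.one_closed pm]
          \<phi>[unfolded gr_hom_iff_deg_hom_one[OF G.is_group]])
    have "?\<psi> x \<in> d (Suc i) ` carrier (P (Suc (Suc i)))" if x: "x \<in> carrier (P (Suc i))" for x
    proof -
      have m: "\<phi> (Suc i) x \<in> carrier (P (Suc i))" "s (d i x) \<in> carrier (P (Suc i))" using c\<phi>[OF x] cs[OF d[OF x]] by auto
      have "d i (?\<psi> x) = d i (\<phi> (Suc i) x) \<oplus>\<^bsub>P i\<^esub> \<ominus>\<^bsub>P i\<^esub> d i (s (d i x))"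
        using m lin_map_add[OF gr_hom_lin[OF p(2)]] lin_map_neg[OF ag ag gr_hom_lin[OF p(2)]] by simp
      also have "\<dots> = \<zero>\<^bsub>P i\<^esub>" using \<phi>d[OF x] s x c\<phi>[OF d[OF x]] by (simp add: Pi.r_neg)
      finally show ?thesis unfolding p(6) a_kernel_iff using m by simp
    qed
    then obtain s' where s': "gr_hom G R (P (Suc i)) (P (Suc (Suc i))) s'"
      "\<And>x. x \<in> carrier (P (Suc i)) \<Longrightarrow> d (Suc i) (s' x) = ?\<psi> x"
      using free_module_lift_gr_hom[OF gr free p(1) p(1) p(2) \<psi>] by metis
    have h: "\<phi> (Suc i) x = d (Suc i) (s' x) \<oplus>\<^bsub>P (Suc i)\<^esub> s (d i x)" if x: "x \<in> carrier (P (Suc i))" for x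
      using s'(2)[OF x] c\<phi>[OF x] cs[OF d[OF x]] by (simp add: PS.a_assoc PS.l_neg)
    have "d (Suc i) (s' (d (Suc i) x)) = \<phi> (Suc i) (d (Suc i) x)" if x: "x \<in> carrier (P (Suc (Suc i)))" for x
    proof -
      have "s \<zero>\<^bsub>P i\<^esub> = \<zero>\<^bsub>P (Suc i)\<^esub>" using s lin_map_zero[OF ag ag] gr_hom_lin by metis
      then show ?thesis using s'(2)[OF d[OF x]] gr_resolution_dd[OF P' x] c\<phi>[OF d[OF x]] by simp
    qed
    then show "\<exists>s'. ?S (Suc i) s' \<and>
      (\<forall>x\<in>carrier (P (Suc i)). \<phi> (Suc i) x = d (Suc i) (s' x) \<oplus>\<^bsub>P (Suc i)\<^esub> s (d i x))" using s'(1) h by blast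
  qed
  obtain s where s: "\<forall>i. ?S i (s i) \<and>
     (\<forall>x\<in>carrier (P (Suc i)). \<phi> (Suc i) x = d (Suc i) (s (Suc i) x) \<oplus>\<^bsub>P (Suc i)\<^esub> s i (d i x))"
    using ex by (rule exE)
  show ?thesis
  proof (rule that[of s])
    show "gr_hom G R (P i) (P (Suc i)) (s i)" for i using spec[OF s, of i] by (elim conjE)
    show "\<phi> (Suc i) x = d (Suc i) (s (Suc i) x) \<oplus>\<^bsub>P (Suc i)\<^esub> s i (d i x)" if "x \<in> carrier (P (Suc i))" for i x
      using spec[OF s, of i] that by blast
  qed
qed

text \<open>
  The homotopy is applied to \<open>\<phi> = id - g \<circ> f\<close>.  The result is stated without subtraction, since in this form
  it can be transported through additive functors directly.
\<close>

lemma comparison_of_resolutions: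
  assumes gr: "graded_ring G R" and M: "left_gr_module G R M"
    and P: "gr_free_resolution G R M P d \<epsilon>" and Q: "gr_free_resolution G R M Q d' \<epsilon>'"
  obtains f g s where "\<And>i. gr_hom G R (P i) (Q i) (f i)" "\<And>i. gr_hom G R (Q i) (P i) (g i)"
    "\<And>i. gr_hom G R (P i) (P (Suc i)) (s i)"
    "\<And>i x. x \<in> carrier (P (Suc i)) \<Longrightarrow> d' i (f (Suc i) x) = f i (d i x)"
    "\<And>i x. x \<in> carrier (Q (Suc i)) \<Longrightarrow> d i (g (Suc i) x) = g i (d' i x)"
    "\<And>i x. x \<in> carrier (P (Suc i)) \<Longrightarrow>
       x = (d (Suc i) (s (Suc i) x) \<oplus>\<^bsub>P (Suc i)\<^esub> s i (d i x)) \<oplus>\<^bsub>P (Suc i)\<^esub> g (Suc i) (f (Suc i) x)"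
proof -
  interpret G: group G using gr by (simp add: graded_ring_def)
  have P': "gr_resolution G R M P d \<epsilon>" and Q': "gr_resolution G R M Q d' \<epsilon>'"
    using P Q by (auto simp: gr_free_resolution_def)
  note p = gr_resolutionD[OF P']
  have pm: "gr_premodule G R (P i)" for i by (rule left_gr_module_premodule[OF p(1)])
  have ag: "abelian_group (P i)" for i by (rule gr_premoduleD[OF pm])
  obtain f where f: "\<And>i. gr_hom G R (P i) (Q i) (f i)" "\<And>x. x \<in> carrier (P 0) \<Longrightarrow> \<epsilon>' (f 0 x) = \<epsilon> x"
    "\<And>i x. x \<in> carrier (P (Suc i)) \<Longrightarrow> d' i (f (Suc i) x) = f i (d i x)"
    by (rule chain_map_exists[OF gr P Q' M]) (rule that)
  obtain g where g: "\<And>i. gr_hom G R (Q i) (P i) (g i)" "\<And>x. x \<in> carrier (Q 0) \<Longrightarrow> \<epsilon> (g 0 x) = \<epsilon>' x"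
    "\<And>i x. x \<in> carrier (Q (Suc i)) \<Longrightarrow> d i (g (Suc i) x) = g i (d' i x)"
    by (rule chain_map_exists[OF gr Q P' M]) (rule that)
  have cf: "f i x \<in> carrier (Q i)" if "x \<in> carrier (P i)" for i x by (rule lin_map_closed[OF gr_hom_lin[OF f(1)] that])
  have cg: "g i x \<in> carrier (P i)" if "x \<in> carrier (Q i)" for i x by (rule lin_map_closed[OF gr_hom_lin[OF g(1)] that])
  have cgf: "g i (f i x) \<in> carrier (P i)" if "x \<in> carrier (P i)" for i x by (rule cg[OF cf[OF that]])
  define \<phi> where "\<phi> = (\<lambda>i x. x \<oplus>\<^bsub>P i\<^esub> \<ominus>\<^bsub>P i\<^esub> g i (f i x))"
  have gh: "gr_hom G R (P i) (P i) (\<phi> i)" for i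
  proof -
    have "deg_hom G R \<one>\<^bsub>G\<^esub> (P i) (P i) (\<lambda>x. x)" by (simp add: gr_hom_iff_deg_hom_one[OF G.is_group, symmetric] gr_hom_def lin_map_def)
    moreover have "deg_hom G R \<one>\<^bsub>G\<^esub> (P i) (P i) (\<lambda>x. g i (f i x))"
      using gr_hom_comp[OF f(1) g(1)] by (simp add: gr_hom_iff_deg_hom_one[OF G.is_group])
    ultimately show ?thesis unfolding \<phi>_def gr_hom_iff_deg_hom_one[OF G.is_group]
      by (intro deg_hom_add_maps[OF G.is_group G.one_closed pm] deg_hom_neg_map[OF G.is_group G.one_closed pm])
  qed
  have e0: "\<epsilon> (\<phi> 0 x) = \<zero>\<^bsub>M\<^esub>" if x: "x \<in> carrier (P 0)" for x
  proof -
    interpret P0: abelian_group "P 0" by (rule ag)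
    interpret M: abelian_group M by (rule gr_premoduleD[OF left_gr_module_premodule[OF M]])
    have "\<epsilon> (\<phi> 0 x) = \<epsilon> x \<oplus>\<^bsub>M\<^esub> \<ominus>\<^bsub>M\<^esub> \<epsilon> (g 0 (f 0 x))"
      unfolding \<phi>_def using lin_map_add[OF gr_hom_lin[OF p(3)]] lin_map_neg[OF ag M.abelian_group_axioms gr_hom_lin[OF p(3)]] x cgf[OF x] by simp
    also have "\<dots> = \<zero>\<^bsub>M\<^esub>" using f(2)[OF x] g(2)[OF cf[OF x]] lin_map_closed[OF gr_hom_lin[OF p(3)] x] by (simp add: M.r_neg)
    finally show ?thesis .
  qed
  have dphi: "d i (\<phi> (Suc i) x) = \<phi> i (d i x)" if x: "x \<in> carrier (P (Suc i))" for i x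
  proof -
    interpret Pi: abelian_group "P (Suc i)" by (rule ag)
    have "d i (\<phi> (Suc i) x) = d i x \<oplus>\<^bsub>P i\<^esub> \<ominus>\<^bsub>P i\<^esub> d i (g (Suc i) (f (Suc i) x))"
      unfolding \<phi>_def using lin_map_add[OF gr_hom_lin[OF p(2)]] lin_map_neg[OF ag ag gr_hom_lin[OF p(2)]] x cgf[OF x] by simp
    then show ?thesis using f(3)[OF x] g(3)[OF cf[OF x]] by (simp add: \<phi>_def)
  qed
  obtain s where s: "\<And>i. gr_hom G R (P i) (P (Suc i)) (s i)"
    "\<And>i x. x \<in> carrier (P (Suc i)) \<Longrightarrow> \<phi> (Suc i) x = d (Suc i) (s (Suc i) x) \<oplus>\<^bsub>P (Suc i)\<^esub> s i (d i x)"
    by (rule homotopy_exists[OF gr P M, of \<phi>]) (rule gh, erule e0, erule dphi, rule that)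
  show ?thesis
  proof (rule that[OF f(1) g(1) s(1) f(3) g(3)])
    fix i x assume x: "x \<in> carrier (P (Suc i))"
    interpret Pi: abelian_group "P (Suc i)" by (rule ag)
    have "\<phi> (Suc i) x \<oplus>\<^bsub>P (Suc i)\<^esub> g (Suc i) (f (Suc i) x) = x"
      using x cgf[OF x] by (simp add: \<phi>_def Pi.a_assoc Pi.l_neg)
    then show "x = (d (Suc i) (s (Suc i) x) \<oplus>\<^bsub>P (Suc i)\<^esub> s i (d i x)) \<oplus>\<^bsub>P (Suc i)\<^esub> g (Suc i) (f (Suc i) x)"
      using s(2)[OF x] by simp
  qed
qed

section \<open>The derived functors of HOM\<close>

text \<open>
  Vanishing of the cohomology of the complex of homogeneous maps into \<open>N\<close>, for every degree \<open>\<sigma>\<close>, at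
  \<open>P (Suc i)\<close>.  Only positive cohomological degrees occur below, hence the shifted index, which
  avoids a case distinction at the beginning of the complex.
\<close>

definition ext_vanishes ::
    "'g monoid \<Rightarrow> ('g, 'r) gr_ring \<Rightarrow> (nat \<Rightarrow> ('g, 'r, 'm) gr_module) \<Rightarrow> (nat \<Rightarrow> 'm \<Rightarrow> 'm)
      \<Rightarrow> nat \<Rightarrow> ('g, 'r, 'k) gr_module \<Rightarrow> bool" where
  "ext_vanishes G R P d i N \<longleftrightarrow>
     (\<forall>\<sigma>\<in>carrier G. \<forall>f. deg_hom G R \<sigma> (P (Suc i)) N f \<and>
        (\<forall>x\<in>carrier (P (Suc (Suc i))). f (d (Suc i) x) = \<zero>\<^bsub>N\<^esub>) \<longrightarrow>
        (\<exists>g. deg_hom G R \<sigma> (P i) N g \<and> (\<forall>x\<in>carrier (P (Suc i)). f x = g (d i x))))"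

lemma ext_vanishesD:
  assumes "ext_vanishes G R P d i N" "\<sigma> \<in> carrier G" "deg_hom G R \<sigma> (P (Suc i)) N f"
    "\<And>x. x \<in> carrier (P (Suc (Suc i))) \<Longrightarrow> f (d (Suc i) x) = \<zero>\<^bsub>N\<^esub>"
  obtains g where "deg_hom G R \<sigma> (P i) N g" "\<And>x. x \<in> carrier (P (Suc i)) \<Longrightarrow> f x = g (d i x)"
  using assms unfolding ext_vanishes_def by blast

text \<open>
  If \<open>c\<close> is a cocycle on \<open>P\<close>, then \<open>c \<circ> g\<close> is one on \<open>Q\<close>, say \<open>c \<circ> g = b \<circ> d'\<close>.  The homotopy turns this into
  \<open>c = (c \<circ> s + b \<circ> f) \<circ> d\<close>.
\<close>

lemma ext_vanishes_independent:
  assumes gr: "graded_ring G R" and M: "left_gr_module G R M"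
    and P: "gr_free_resolution G R M P d \<epsilon>" and Q: "gr_free_resolution G R M Q d' \<epsilon>'"
    and N: "gr_premodule G R N" and van: "ext_vanishes G R Q d' i N"
  shows "ext_vanishes G R P d i N"
proof (rule comparison_of_resolutions[OF gr M P Q])
  interpret G: group G using gr by (simp add: graded_ring_def)
  have P': "gr_resolution G R M P d \<epsilon>" and Q': "gr_resolution G R M Q d' \<epsilon>'"
    using P Q by (auto simp: gr_free_resolution_def)
  note p = gr_resolutionD[OF P']
  fix f g s assume f: "\<And>i. gr_hom G R (P i) (Q i) (f i)" and g: "\<And>i. gr_hom G R (Q i) (P i) (g i)"
    and s: "\<And>i. gr_hom G R (P i) (P (Suc i)) (s i)"
    and fd: "\<And>i x. x \<in> carrier (P (Suc i)) \<Longrightarrow> d' i (f (Suc i) x) = f i (d i x)"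
    and gd: "\<And>i x. x \<in> carrier (Q (Suc i)) \<Longrightarrow> d i (g (Suc i) x) = g i (d' i x)"
    and h: "\<And>i x. x \<in> carrier (P (Suc i)) \<Longrightarrow>
       x = (d (Suc i) (s (Suc i) x) \<oplus>\<^bsub>P (Suc i)\<^esub> s i (d i x)) \<oplus>\<^bsub>P (Suc i)\<^esub> g (Suc i) (f (Suc i) x)"
  have cf: "f i x \<in> carrier (Q i)" if "x \<in> carrier (P i)" for i x by (rule lin_map_closed[OF gr_hom_lin[OF f] that])
  have cg: "g i x \<in> carrier (P i)" if "x \<in> carrier (Q i)" for i x by (rule lin_map_closed[OF gr_hom_lin[OF g] that])
  have cs: "s i x \<in> carrier (P (Suc i))" if "x \<in> carrier (P i)" for i x by (rule lin_map_closed[OF gr_hom_lin[OF s] that])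
  have cd: "d i x \<in> carrier (P i)" if "x \<in> carrier (P (Suc i))" for i x by (rule lin_map_closed[OF gr_hom_lin[OF p(2)] that])
  interpret N: abelian_group N by (rule gr_premoduleD[OF N])
  show ?thesis unfolding ext_vanishes_def
  proof (intro ballI allI impI, elim conjE)
    fix \<sigma> c assume \<sigma>: "\<sigma> \<in> carrier G" and c: "deg_hom G R \<sigma> (P (Suc i)) N c"
      and cz: "\<forall>x\<in>carrier (P (Suc (Suc i))). c (d (Suc i) x) = \<zero>\<^bsub>N\<^esub>"
    have cc: "c x \<in> carrier N" if "x \<in> carrier (P (Suc i))" for x by (rule lin_map_closed[OF deg_hom_lin[OF c] that])
    have "c (g (Suc i) (d' (Suc i) y)) = \<zero>\<^bsub>N\<^esub>" if "y \<in> carrier (Q (Suc (Suc i)))" for y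
      using cz cg[OF that] gd[OF that] by metis
    then obtain b where b: "deg_hom G R \<sigma> (Q i) N b"
      "\<And>y. y \<in> carrier (Q (Suc i)) \<Longrightarrow> c (g (Suc i) y) = b (d' i y)"
      by (rule ext_vanishesD[OF van \<sigma> gr_hom_comp_deg_hom[OF g c]]) (assumption, rule that)
    have "deg_hom G R \<sigma> (P i) N (\<lambda>x. c (s i x) \<oplus>\<^bsub>N\<^esub> b (f i x))"
      by (rule deg_hom_add_maps[OF G.is_group \<sigma> N gr_hom_comp_deg_hom[OF s c] gr_hom_comp_deg_hom[OF f b(1)]])
    moreover have "c x = c (s i (d i x)) \<oplus>\<^bsub>N\<^esub> b (f i (d i x))" if x: "x \<in> carrier (P (Suc i))" for x
    proof -
      interpret Pi: abelian_group "P (Suc i)" by (rule gr_premoduleD[OF left_gr_module_premodule[OF p(1)]])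
      let ?u = "d (Suc i) (s (Suc i) x)" and ?v = "s i (d i x)" and ?w = "g (Suc i) (f (Suc i) x)"
      have m: "?u \<in> carrier (P (Suc i))" "?v \<in> carrier (P (Suc i))" "?w \<in> carrier (P (Suc i))"
        using x by (intro cd cs cg cf; assumption)+
      have "c x = c (?u \<oplus>\<^bsub>P (Suc i)\<^esub> ?v \<oplus>\<^bsub>P (Suc i)\<^esub> ?w)" using h[OF x] by simp
      also have "\<dots> = (c ?u \<oplus>\<^bsub>N\<^esub> c ?v) \<oplus>\<^bsub>N\<^esub> c ?w"
        using m lin_map_add[OF deg_hom_lin[OF c]] by simp
      also have "c ?u = \<zero>\<^bsub>N\<^esub>" using cz cs[OF x] by blast
      also have "c ?w = b (f i (d i x))" using b(2)[OF cf[OF x]] fd[OF x] by simp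
      finally show ?thesis using cc[OF m(2)] by simp
    qed
    ultimately show "\<exists>g. deg_hom G R \<sigma> (P i) N g \<and> (\<forall>x\<in>carrier (P (Suc i)). c x = g (d i x))" by blast
  qed
qed

text \<open>
  Dimension shifting for \<open>0 \<rightarrow> L \<rightarrow> A \<rightarrow> M \<rightarrow> 0\<close>, the part of the long exact sequence that concludes
  the vanishing for \<open>M\<close> from the vanishing for \<open>A\<close> and, one degree higher, for \<open>L\<close>.  It is proved by a diagram
  chase, in which both liftings (to \<open>A\<close> and to \<open>L\<close>) exist because \<open>P\<close> is free.
\<close>

lemma ext_vanishes_quotient:
  assumes gr: "graded_ring G R" and free: "\<And>i. \<exists>B \<delta>. \<delta> \<in> B \<rightarrow> carrier G \<and> P i = gr_free G R B \<delta>"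
    and d: "\<And>i. gr_hom G R (P (Suc i)) (P i) (d i)"
    and dd: "\<And>i x. x \<in> carrier (P (Suc (Suc i))) \<Longrightarrow> d i (d (Suc i) x) = \<zero>\<^bsub>P i\<^esub>"
    and L: "left_gr_module G R L" and A: "left_gr_module G R A" and M: "left_gr_module G R M"
    and \<iota>: "gr_hom G R L A \<iota>" "inj_on \<iota> (carrier L)" and \<pi>: "gr_hom G R A M \<pi>" "\<pi> ` carrier A = carrier M"
    and ex: "\<iota> ` carrier L = a_kernel A M \<pi>"
    and vL: "ext_vanishes G R P d (Suc i) L" and vA: "ext_vanishes G R P d i A"
  shows "ext_vanishes G R P d i M"
  unfolding ext_vanishes_def
proof (intro ballI allI impI, elim conjE)
  interpret G: group G using gr by (simp add: graded_ring_def)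
  have agP: "abelian_group (P i)" for i
    using free[of i] gr_free_pre_module gr pre_module_abelian_group unfolding graded_ring_def by metis
  have preA: "gr_premodule G R A" by (rule left_gr_module_premodule[OF A])
  have agA: "abelian_group A" and agL: "abelian_group L" and agM: "abelian_group M"
    using gr_premoduleD(2)[OF left_gr_module_premodule] A L M by blast+
  interpret A: abelian_group A by (rule agA)
  interpret M: abelian_group M by (rule agM)
  have cd: "d i x \<in> carrier (P i)" if "x \<in> carrier (P (Suc i))" for i x by (rule lin_map_closed[OF gr_hom_lin[OF d] that])
  have c\<iota>: "\<iota> x \<in> carrier A" if "x \<in> carrier L" for x by (rule lin_map_closed[OF gr_hom_lin[OF \<iota>(1)] that])
  have \<pi>\<iota>: "\<pi> (\<iota> x) = \<zero>\<^bsub>M\<^esub>" if "x \<in> carrier L" for x using ex that by (auto simp: a_kernel_iff)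
  fix \<sigma> c assume \<sigma>: "\<sigma> \<in> carrier G" and c: "deg_hom G R \<sigma> (P (Suc i)) M c"
    and cz: "\<forall>x\<in>carrier (P (Suc (Suc i))). c (d (Suc i) x) = \<zero>\<^bsub>M\<^esub>"
  have "c x \<in> \<pi> ` carrier A" if "x \<in> carrier (P (Suc i))" for x
    unfolding \<pi>(2) by (rule lin_map_closed[OF deg_hom_lin[OF c] that])
  then obtain c' where c': "deg_hom G R \<sigma> (P (Suc i)) A c'" "\<And>x. x \<in> carrier (P (Suc i)) \<Longrightarrow> \<pi> (c' x) = c x"
    by (rule free_module_lift[OF gr free A M \<pi>(1) \<sigma> c]) (assumption, rule that)
  have cc': "c' x \<in> carrier A" if "x \<in> carrier (P (Suc i))" for x by (rule lin_map_closed[OF deg_hom_lin[OF c'(1)] that])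
  \<comment> \<open>The cocycle \<open>e\<close> represents the image of \<open>c\<close> under the connecting homomorphism.\<close>
  have "c' (d (Suc i) x) \<in> \<iota> ` carrier L" if "x \<in> carrier (P (Suc (Suc i)))" for x
    unfolding ex a_kernel_iff using cc'[OF cd[OF that]] c'(2)[OF cd[OF that]] cz that by simp
  then obtain e where e: "deg_hom G R \<sigma> (P (Suc (Suc i))) L e"
    "\<And>x. x \<in> carrier (P (Suc (Suc i))) \<Longrightarrow> \<iota> (e x) = c' (d (Suc i) x)"
    by (rule free_module_lift[OF gr free L A \<iota>(1) \<sigma> gr_hom_comp_deg_hom[OF d c'(1)]]) (assumption, rule that)
  have ce: "e x \<in> carrier L" if "x \<in> carrier (P (Suc (Suc i)))" for x by (rule lin_map_closed[OF deg_hom_lin[OF e(1)] that])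
  have "e (d (Suc (Suc i)) x) = \<zero>\<^bsub>L\<^esub>" if x: "x \<in> carrier (P (Suc (Suc (Suc i))))" for x
  proof -
    have "\<iota> (e (d (Suc (Suc i)) x)) = c' \<zero>\<^bsub>P (Suc i)\<^esub>" using e(2)[OF cd[OF x]] dd[OF x] by simp
    also have "\<dots> = \<zero>\<^bsub>A\<^esub>" by (rule lin_map_zero[OF agP agA deg_hom_lin[OF c'(1)]])
    also have "\<dots> = \<iota> \<zero>\<^bsub>L\<^esub>" by (rule lin_map_zero[OF agL agA gr_hom_lin[OF \<iota>(1)], symmetric])
    finally show ?thesis using inj_onD[OF \<iota>(2) _ ce[OF cd[OF x]]] abelian_groupE(2)[OF agL] by blast
  qed
  then obtain h where h: "deg_hom G R \<sigma> (P (Suc i)) L h"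
    "\<And>x. x \<in> carrier (P (Suc (Suc i))) \<Longrightarrow> e x = h (d (Suc i) x)"
    by (rule ext_vanishesD[OF vL \<sigma> e(1)]) (assumption, rule that)
  have ch: "h x \<in> carrier L" if "x \<in> carrier (P (Suc i))" for x by (rule lin_map_closed[OF deg_hom_lin[OF h(1)] that])
  let ?k = "\<lambda>x. c' x \<oplus>\<^bsub>A\<^esub> \<ominus>\<^bsub>A\<^esub> \<iota> (h x)"
  have k: "deg_hom G R \<sigma> (P (Suc i)) A ?k"
    by (rule deg_hom_add_maps[OF G.is_group \<sigma> preA c'(1)
        deg_hom_neg_map[OF G.is_group \<sigma> preA deg_hom_comp_gr_hom[OF h(1) \<iota>(1) G.is_group \<sigma>]]])
  have "?k (d (Suc i) x) = \<zero>\<^bsub>A\<^esub>" if x: "x \<in> carrier (P (Suc (Suc i)))" for x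
    using e(2)[OF x] h(2)[OF x] c\<iota>[OF ce[OF x]] by (simp add: A.r_neg)
  then obtain g where g: "deg_hom G R \<sigma> (P i) A g" "\<And>x. x \<in> carrier (P (Suc i)) \<Longrightarrow> ?k x = g (d i x)"
    by (rule ext_vanishesD[OF vA \<sigma> k]) (assumption, rule that)
  have "c x = \<pi> (g (d i x))" if x: "x \<in> carrier (P (Suc i))" for x
  proof -
    have m: "c' x \<in> carrier A" "\<iota> (h x) \<in> carrier A" using cc'[OF x] c\<iota>[OF ch[OF x]] by auto
    have "\<pi> (g (d i x)) = \<pi> (?k x)" using g(2)[OF x] by simp
    also have "\<dots> = \<pi> (c' x) \<oplus>\<^bsub>M\<^esub> \<ominus>\<^bsub>M\<^esub> \<pi> (\<iota> (h x))"
      using m lin_map_add[OF gr_hom_lin[OF \<pi>(1)]] lin_map_neg[OF agA agM gr_hom_lin[OF \<pi>(1)]] by simp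
    also have "\<dots> = c x"
      using \<pi>\<iota>[OF ch[OF x]] c'(2)[OF x] lin_map_closed[OF deg_hom_lin[OF c] x] by simp
    finally show ?thesis ..
  qed
  then show "\<exists>g. deg_hom G R \<sigma> (P i) M g \<and> (\<forall>x\<in>carrier (P (Suc i)). c x = g (d i x))"
    using deg_hom_comp_gr_hom[OF g(1) \<pi>(1) G.is_group \<sigma>] by blast
qed

text \<open>
  On elements of degree \<open>\<tau>\<close>, maps of different degrees \<open>\<rho>\<close> take values in different degrees \<open>\<tau> \<otimes> \<rho>\<close>.  Hence
  the summands of an element of \<open>HOM\<close> can be recovered from their sum.
\<close>

lemma component_of_shifted_sum:
  assumes G: "group G" and N: "gr_premodule G R N" and T: "finite T" "T \<subseteq> carrier G" and \<tau>: "\<tau> \<in> carrier G"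
    and y: "\<And>\<rho>. \<rho> \<in> T \<Longrightarrow> y \<rho> \<in> mgrade N (\<tau> \<otimes>\<^bsub>G\<^esub> \<rho>)" and \<sigma>: "\<sigma> \<in> T"
  shows "component (carrier G) N (mgrade N) (\<tau> \<otimes>\<^bsub>G\<^esub> \<sigma>) (finsum N y T) = y \<sigma>"
proof -
  interpret G: group G by fact
  note N' = gr_premoduleD(2,3)[OF N]
  interpret N: abelian_group N by (rule N')
  let ?m = "\<lambda>\<rho>. \<tau> \<otimes>\<^bsub>G\<^esub> \<rho>" and ?z = "\<lambda>\<kappa>. y (inv\<^bsub>G\<^esub> \<tau> \<otimes>\<^bsub>G\<^esub> \<kappa>)"
  have canc: "inv\<^bsub>G\<^esub> \<tau> \<otimes>\<^bsub>G\<^esub> (\<tau> \<otimes>\<^bsub>G\<^esub> \<rho>) = \<rho>" if "\<rho> \<in> T" for \<rho>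
    using that \<tau> T(2) by (simp add: G.m_assoc[symmetric] subset_iff)
  have yc: "y \<rho> \<in> carrier N" if "\<rho> \<in> T" for \<rho>
    using graded_by_closed[OF N'(2) _ y[OF that]] \<tau> T(2) that by auto
  have "finsum N y T = finsum N (\<lambda>\<rho>. ?z (?m \<rho>)) T"
    by (rule N.finsum_cong') (use canc yc in auto)
  also have "\<dots> = finsum N ?z (?m ` T)"
  proof (rule N.finsum_reindex[symmetric])
    show "inj_on ?m T" by (rule inj_on_inverseI[of _ "\<lambda>\<kappa>. inv\<^bsub>G\<^esub> \<tau> \<otimes>\<^bsub>G\<^esub> \<kappa>"]) (use canc in auto)
  qed (use canc yc in auto)
  finally have "finsum N y T = finsum N ?z (?m ` T)" .
  moreover have "component (carrier G) N (mgrade N) (?m \<sigma>) (finsum N ?z (?m ` T)) = ?z (?m \<sigma>)"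
  proof -
    have "?z \<kappa> \<in> mgrade N \<kappa>" if "\<kappa> \<in> ?m ` T" for \<kappa> using that canc y by auto
    then show ?thesis using component_finsum[OF N', of "?m ` T" ?z "?m \<sigma>"] T \<tau> \<sigma> by auto
  qed
  ultimately show ?thesis using canc[OF \<sigma>] by simp
qed

lemma deg_hom_restrict:
  assumes "gr_premodule G R M" "deg_hom G R \<sigma> M N h"
  shows "restrict h (carrier M) \<in> HOM_deg G R M N \<sigma>"
proof -
  note M' = gr_premoduleD[OF assms(1)]
  interpret M: abelian_group M by (rule M')
  have "lin_map R M N (restrict h (carrier M))"
    using deg_hom_lin[OF assms(2)] smult_closed[OF M'(1)] by (auto simp: lin_map_def)
  then show ?thesis using deg_hom_grade[OF assms(2)] graded_by_closed[OF M'(3)]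
    by (auto simp: HOM_deg_def)
qed

lemma HOM_I:
  assumes M: "gr_premodule G R M" and N: "abelian_group N" and S: "finite S" "S \<subseteq> carrier G"
    and h: "\<And>\<sigma>. \<sigma> \<in> S \<Longrightarrow> deg_hom G R \<sigma> M N (h \<sigma>)" and f: "f \<in> extensional (carrier M)"
    and eq: "\<And>x. x \<in> carrier M \<Longrightarrow> f x = finsum N (\<lambda>\<sigma>. h \<sigma> x) S"
  shows "f \<in> carrier (HOM G R M N)"
proof -
  interpret N: abelian_group N by fact
  have eq': "f = (\<lambda>x\<in>carrier M. finsum N (\<lambda>\<sigma>. (restrict (h \<sigma>) (carrier M)) x) S)"
  proof (rule extensionalityI[OF f restrict_extensional])
    fix x assume x: "x \<in> carrier M"
    have "(\<lambda>\<sigma>. h \<sigma> x) \<in> S \<rightarrow> carrier N" using lin_map_closed[OF deg_hom_lin[OF h] x] by auto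
    then show "f x = (\<lambda>x\<in>carrier M. finsum N (\<lambda>\<sigma>. (restrict (h \<sigma>) (carrier M)) x) S) x"
      using eq[OF x] x by simp
  qed
  show ?thesis unfolding HOM_def partial_object.simps mem_Collect_eq
    by (intro exI[of _ S] exI[of _ "\<lambda>\<sigma>. restrict (h \<sigma>) (carrier M)"] conjI ballI S eq' deg_hom_restrict[OF M h])
qed

text \<open>
  The family of summands is extended by zero to all degrees, so that several elements of \<open>HOM\<close> can be
  expanded over a common finite set of degrees.
\<close>

lemma HOM_E:
  assumes G: "group G" and N: "gr_premodule G R N" and f: "f \<in> carrier (HOM G R M N)"
  obtains S h where "finite S" "S \<subseteq> carrier G" "\<And>\<sigma>. \<sigma> \<in> carrier G \<Longrightarrow> deg_hom G R \<sigma> M N (h \<sigma>)"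
    "\<And>T x. finite T \<Longrightarrow> S \<subseteq> T \<Longrightarrow> x \<in> carrier M \<Longrightarrow> f x = finsum N (\<lambda>\<sigma>. h \<sigma> x) T" "f \<in> extensional (carrier M)"
proof -
  interpret N: abelian_group N by (rule gr_premoduleD[OF N])
  obtain S h where S: "finite S" "S \<subseteq> carrier G" and h: "\<And>\<sigma>. \<sigma> \<in> S \<Longrightarrow> h \<sigma> \<in> HOM_deg G R M N \<sigma>"
    and f: "f = (\<lambda>x\<in>carrier M. finsum N (\<lambda>\<sigma>. h \<sigma> x) S)" using f unfolding HOM_def by auto
  define k where "k = (\<lambda>\<sigma>. if \<sigma> \<in> S then h \<sigma> else (\<lambda>x. \<zero>\<^bsub>N\<^esub>))"
  have k: "deg_hom G R \<sigma> M N (k \<sigma>)" if "\<sigma> \<in> carrier G" for \<sigma>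
  proof (cases "\<sigma> \<in> S")
    case True
    then show ?thesis using h[of \<sigma>] by (simp add: k_def HOM_deg_def deg_hom_def)
  next
    case False
    then show ?thesis using deg_hom_zero_map[OF G that N] by (simp add: k_def)
  qed
  show ?thesis
  proof (rule that[OF S k])
    show "f \<in> extensional (carrier M)" using f by simp
    fix T x assume T: "finite T" "S \<subseteq> T" and x: "x \<in> carrier M"
    have "finsum N (\<lambda>\<sigma>. h \<sigma> x) S = finsum N (\<lambda>\<sigma>. k \<sigma> x) T"
    proof (rule N.add.finprod_mono_neutral_cong_left[OF T])
      have "k \<sigma> x \<in> carrier N" if "\<sigma> \<in> S" for \<sigma>
        using lin_map_closed[OF deg_hom_lin[OF k] x] that S(2) by blast
      then show "(\<lambda>\<sigma>. k \<sigma> x) \<in> T \<rightarrow> carrier N" by (auto simp: k_def)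
    qed (auto simp: k_def)
    then show "f x = finsum N (\<lambda>\<sigma>. k \<sigma> x) T" using f x by simp
  qed
qed

lemma HOM_lin_map:
  assumes G: "group G" and M: "gr_premodule G R M" and N: "gr_premodule G R N" and f: "f \<in> carrier (HOM G R M N)"
  shows "x \<in> carrier M \<Longrightarrow> f x \<in> carrier N" and "f \<zero>\<^bsub>M\<^esub> = \<zero>\<^bsub>N\<^esub>"
proof -
  note M' = gr_premoduleD[OF M] and N' = gr_premoduleD[OF N]
  interpret M: abelian_group M by (rule M')
  interpret N: abelian_group N by (rule N')
  obtain S h where S: "finite S" "S \<subseteq> carrier G" and h: "\<And>\<sigma>. \<sigma> \<in> carrier G \<Longrightarrow> deg_hom G R \<sigma> M N (h \<sigma>)"
    and f: "\<And>T x. finite T \<Longrightarrow> S \<subseteq> T \<Longrightarrow> x \<in> carrier M \<Longrightarrow> f x = finsum N (\<lambda>\<sigma>. h \<sigma> x) T"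
    by (rule HOM_E[OF G N f]) (rule that)
  have f: "f x = finsum N (\<lambda>\<sigma>. h \<sigma> x) S" if "x \<in> carrier M" for x using f[OF S(1) _ that] by simp
  have hc: "h \<sigma> x \<in> carrier N" if "\<sigma> \<in> S" "x \<in> carrier M" for \<sigma> x
    using lin_map_closed[OF deg_hom_lin[OF h] that(2)] S(2) that(1) by blast
  show "f x \<in> carrier N" if "x \<in> carrier M" using hc that f by auto
  have "h \<sigma> \<zero>\<^bsub>M\<^esub> = \<zero>\<^bsub>N\<^esub>" if "\<sigma> \<in> S" for \<sigma>
    using lin_map_zero[OF M'(2) N'(2) deg_hom_lin[OF h]] S(2) that by blast
  then have "finsum N (\<lambda>\<sigma>. h \<sigma> \<zero>\<^bsub>M\<^esub>) S = finsum N (\<lambda>\<sigma>. \<zero>\<^bsub>N\<^esub>) S" by (intro N.finsum_cong') auto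
  then show "f \<zero>\<^bsub>M\<^esub> = \<zero>\<^bsub>N\<^esub>" using f by simp
qed

lemma HOM_simps:
  "f \<otimes>\<^bsub>HOM G R M N\<^esub> g = (\<lambda>x\<in>carrier M. f x \<oplus>\<^bsub>N\<^esub> g x)" "\<one>\<^bsub>HOM G R M N\<^esub> = (\<lambda>x\<in>carrier M. \<zero>\<^bsub>N\<^esub>)"
  by (simp_all add: HOM_def)

lemma HOM_extensional: "f \<in> carrier (HOM G R M N) \<Longrightarrow> f \<in> extensional (carrier M)"
  by (auto simp: HOM_def)

lemma comm_group_HOM:
  assumes G: "group G" and M: "gr_premodule G R M" and N: "gr_premodule G R N"
  shows "comm_group (HOM G R M N)"
proof (rule comm_groupI)
  note N' = gr_premoduleD[OF N]
  interpret N: abelian_group N by (rule N')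
  note cl = HOM_lin_map(1)[OF G M N]
  show one: "\<one>\<^bsub>HOM G R M N\<^esub> \<in> carrier (HOM G R M N)"
    by (rule HOM_I[OF M N'(2), of "{}"]) (auto simp: HOM_simps)
  fix f assume f: "f \<in> carrier (HOM G R M N)"
  obtain S h where S: "finite S" "S \<subseteq> carrier G" and h: "\<And>\<sigma>. \<sigma> \<in> carrier G \<Longrightarrow> deg_hom G R \<sigma> M N (h \<sigma>)"
    and fh: "\<And>T x. finite T \<Longrightarrow> S \<subseteq> T \<Longrightarrow> x \<in> carrier M \<Longrightarrow> f x = finsum N (\<lambda>\<sigma>. h \<sigma> x) T"
    by (rule HOM_E[OF G N f]) (rule that)
  have hc: "h \<sigma> x \<in> carrier N" if "\<sigma> \<in> carrier G" "x \<in> carrier M" for \<sigma> x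
    by (rule lin_map_closed[OF deg_hom_lin[OF h[OF that(1)]] that(2)])
  show "\<one>\<^bsub>HOM G R M N\<^esub> \<otimes>\<^bsub>HOM G R M N\<^esub> f = f"
    by (rule extensionalityI[OF _ HOM_extensional[OF f]]) (use cl[OF f] in \<open>auto simp: HOM_simps\<close>)
  have "(\<lambda>x\<in>carrier M. \<ominus>\<^bsub>N\<^esub> f x) \<in> carrier (HOM G R M N)"
  proof (rule HOM_I[OF M N'(2) S, of "\<lambda>\<sigma> x. \<ominus>\<^bsub>N\<^esub> h \<sigma> x"])
    show "deg_hom G R \<sigma> M N (\<lambda>x. \<ominus>\<^bsub>N\<^esub> h \<sigma> x)" if "\<sigma> \<in> S" for \<sigma>
      using deg_hom_neg_map[OF G _ N h] that S(2) by blast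
    fix x assume x: "x \<in> carrier M"
    have "\<ominus>\<^bsub>N\<^esub> finsum N (\<lambda>\<sigma>. h \<sigma> x) S = finsum N (\<lambda>\<sigma>. \<ominus>\<^bsub>N\<^esub> h \<sigma> x) S"
      by (rule N.additive_map_finsum[OF N'(2)]) (use hc S(2) x in \<open>auto simp: N.minus_add\<close>)
    then show "(\<lambda>x\<in>carrier M. \<ominus>\<^bsub>N\<^esub> f x) x = finsum N (\<lambda>\<sigma>. \<ominus>\<^bsub>N\<^esub> h \<sigma> x) S" using x fh[OF S(1) _ x] by simp
  qed simp
  moreover have "(\<lambda>x\<in>carrier M. \<ominus>\<^bsub>N\<^esub> f x) \<otimes>\<^bsub>HOM G R M N\<^esub> f = \<one>\<^bsub>HOM G R M N\<^esub>"
    using cl[OF f] by (auto simp: HOM_simps N.l_neg)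
  ultimately show "\<exists>g\<in>carrier (HOM G R M N). g \<otimes>\<^bsub>HOM G R M N\<^esub> f = \<one>\<^bsub>HOM G R M N\<^esub>" by blast
  fix g assume g: "g \<in> carrier (HOM G R M N)"
  obtain S' h' where S': "finite S'" "S' \<subseteq> carrier G" and h': "\<And>\<sigma>. \<sigma> \<in> carrier G \<Longrightarrow> deg_hom G R \<sigma> M N (h' \<sigma>)"
    and gh: "\<And>T x. finite T \<Longrightarrow> S' \<subseteq> T \<Longrightarrow> x \<in> carrier M \<Longrightarrow> g x = finsum N (\<lambda>\<sigma>. h' \<sigma> x) T"
    by (rule HOM_E[OF G N g]) (rule that)
  have hc': "h' \<sigma> x \<in> carrier N" if "\<sigma> \<in> carrier G" "x \<in> carrier M" for \<sigma> x
    by (rule lin_map_closed[OF deg_hom_lin[OF h'[OF that(1)]] that(2)])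
  show "f \<otimes>\<^bsub>HOM G R M N\<^esub> g \<in> carrier (HOM G R M N)"
  proof (rule HOM_I[OF M N'(2), of "S \<union> S'" "\<lambda>\<sigma> x. h \<sigma> x \<oplus>\<^bsub>N\<^esub> h' \<sigma> x"])
    show "finite (S \<union> S')" "S \<union> S' \<subseteq> carrier G" using S S' by auto
    show "deg_hom G R \<sigma> M N (\<lambda>x. h \<sigma> x \<oplus>\<^bsub>N\<^esub> h' \<sigma> x)" if "\<sigma> \<in> S \<union> S'" for \<sigma>
      using deg_hom_add_maps[OF G _ N h h'] that S(2) S'(2) by blast
    fix x assume x: "x \<in> carrier M"
    have "finsum N (\<lambda>\<sigma>. h \<sigma> x \<oplus>\<^bsub>N\<^esub> h' \<sigma> x) (S \<union> S') = finsum N (\<lambda>\<sigma>. h \<sigma> x) (S \<union> S') \<oplus>\<^bsub>N\<^esub> finsum N (\<lambda>\<sigma>. h' \<sigma> x) (S \<union> S')"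
      by (rule N.finsum_addf) (use hc hc' S(2) S'(2) x in auto)
    then show "(f \<otimes>\<^bsub>HOM G R M N\<^esub> g) x = finsum N (\<lambda>\<sigma>. h \<sigma> x \<oplus>\<^bsub>N\<^esub> h' \<sigma> x) (S \<union> S')"
      using x fh[of "S \<union> S'" x] gh[of "S \<union> S'" x] S(1) S'(1) by (simp add: HOM_simps)
  qed (simp add: HOM_simps)
  show "f \<otimes>\<^bsub>HOM G R M N\<^esub> g = g \<otimes>\<^bsub>HOM G R M N\<^esub> f"
    using cl[OF f] cl[OF g] by (auto simp: HOM_simps N.a_comm)
  fix k assume k: "k \<in> carrier (HOM G R M N)"
  show "f \<otimes>\<^bsub>HOM G R M N\<^esub> g \<otimes>\<^bsub>HOM G R M N\<^esub> k = f \<otimes>\<^bsub>HOM G R M N\<^esub> (g \<otimes>\<^bsub>HOM G R M N\<^esub> k)"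
    using cl[OF f] cl[OF g] cl[OF k] by (auto simp: HOM_simps N.a_assoc)
qed

lemma HOM_compose_hom:
  assumes G: "group G" and M: "gr_premodule G R M" and M': "gr_premodule G R M'" and N: "gr_premodule G R N"
    and d: "gr_hom G R M' M d"
  shows "(\<lambda>f. compose (carrier M') f d) \<in> hom (HOM G R M N) (HOM G R M' N)"
proof (rule homI)
  have dc: "d x \<in> carrier M" if "x \<in> carrier M'" for x by (rule lin_map_closed[OF gr_hom_lin[OF d] that])
  fix f assume f: "f \<in> carrier (HOM G R M N)"
  obtain S h where S: "finite S" "S \<subseteq> carrier G" and h: "\<And>\<sigma>. \<sigma> \<in> carrier G \<Longrightarrow> deg_hom G R \<sigma> M N (h \<sigma>)"
    and fh: "\<And>T x. finite T \<Longrightarrow> S \<subseteq> T \<Longrightarrow> x \<in> carrier M \<Longrightarrow> f x = finsum N (\<lambda>\<sigma>. h \<sigma> x) T"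
    by (rule HOM_E[OF G N f]) (rule that)
  show "compose (carrier M') f d \<in> carrier (HOM G R M' N)"
  proof (rule HOM_I[OF M' gr_premoduleD(2)[OF N] S, of "\<lambda>\<sigma> x. h \<sigma> (d x)"])
    show "deg_hom G R \<sigma> M' N (\<lambda>x. h \<sigma> (d x))" if "\<sigma> \<in> S" for \<sigma>
      using gr_hom_comp_deg_hom[OF d h] that S(2) by blast
  qed (use fh[OF S(1)] dc in \<open>auto simp: compose_def\<close>)
  fix g assume "g \<in> carrier (HOM G R M N)"
  show "compose (carrier M') (f \<otimes>\<^bsub>HOM G R M N\<^esub> g) d
      = compose (carrier M') f d \<otimes>\<^bsub>HOM G R M' N\<^esub> compose (carrier M') g d"
    using dc by (auto simp: compose_def HOM_simps)
qed

text \<open>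
  EXT and Tor are quotients of this form, of the cycles \<open>Z\<close> by the boundaries \<open>B\<close>.
\<close>

lemma trivial_quotient_iff:
  assumes C: "comm_group C" and Z: "subgroup Z C" and B: "subgroup B C" and BZ: "B \<subseteq> Z"
  shows "trivial_group (C\<lparr>carrier := Z\<rparr> Mod B) \<longleftrightarrow> Z \<subseteq> B"
proof -
  interpret C: comm_group C by fact
  let ?Z = "C\<lparr>carrier := Z\<rparr>"
  interpret Zg: group ?Z by (rule subgroup.subgroup_is_group[OF Z C.is_group])
  interpret Z: comm_group ?Z
    by (rule Zg.group_comm_groupI) (use subgroup.subset[OF Z] in \<open>auto intro: C.m_comm\<close>)
  have sB: "subgroup B ?Z" by (rule C.subgroup_incl[OF B Z BZ])
  then have nB: "B \<lhd> ?Z" by (rule Z.subgroup_imp_normal)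
  have grp: "group (?Z Mod B)" by (rule normal.factorgroup_is_group[OF nB])
  have Bne: "B \<in> rcosets\<^bsub>?Z\<^esub> B" by (rule subgroup.subgroup_in_rcosets[OF sB Zg.is_group])
  show ?thesis
  proof
    assume "trivial_group (?Z Mod B)"
    then have c: "rcosets\<^bsub>?Z\<^esub> B = {B}" by (simp add: trivial_group_def FactGroup_def)
    show "Z \<subseteq> B"
    proof
      fix z assume z: "z \<in> Z"
      then have "z \<in> carrier ?Z" by simp
      have "B #>\<^bsub>?Z\<^esub> z \<in> rcosets\<^bsub>?Z\<^esub> B" using z by (auto simp: RCOSETS_def)
      then have "B #>\<^bsub>?Z\<^esub> z = B" using c by blast
      then show "z \<in> B" using Zg.rcos_self[OF \<open>z \<in> carrier ?Z\<close> sB] by simp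
    qed
  next
    assume "Z \<subseteq> B"
    then have ZB: "Z = B" using BZ by blast
    have "X = B" if "X \<in> rcosets\<^bsub>?Z\<^esub> B" for X
    proof -
      obtain z where z: "z \<in> Z" "X = B #>\<^bsub>?Z\<^esub> z" using \<open>X \<in> _\<close> by (auto simp: RCOSETS_def)
      then show ?thesis using Zg.coset_join2[of z B] sB ZB by simp
    qed
    then have "rcosets\<^bsub>?Z\<^esub> B = {B}" using Bne by blast
    then show "trivial_group (?Z Mod B)" using grp by (simp add: trivial_group_def FactGroup_def)
  qed
qed

text \<open>
  The group EXT splits into its homogeneous parts.  If every cocycle is a coboundary, \<open>f = g \<circ> d\<close> with \<open>f\<close> of
  degree \<open>\<sigma>\<close>, then the summand of \<open>g\<close> of degree \<open>\<sigma>\<close> already has boundary \<open>f\<close>.  Conversely, the summands of a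
  cocycle are cocycles, and homogeneous preimages of them add up to a preimage.
\<close>

lemma EXT_trivial_iff:
  assumes gr: "graded_ring G R" and N: "gr_premodule G R N" and ch: "chosen_resolution G R M = (P, d)"
    and P: "gr_resolution G R M P d \<epsilon>"
  shows "trivial_group (EXT G R (Suc i) M N) \<longleftrightarrow> ext_vanishes G R P d i N"
proof -
  interpret G: group G using gr by (simp add: graded_ring_def)
  note G = G.is_group
  note p = gr_resolutionD[OF P]
  have pm: "gr_premodule G R (P i)" for i by (rule left_gr_module_premodule[OF p(1)])
  note N' = gr_premoduleD[OF N]
  interpret N: abelian_group N by (rule N')
  have cd: "d i x \<in> carrier (P i)" if "x \<in> carrier (P (Suc i))" for i x by (rule lin_map_closed[OF gr_hom_lin[OF p(2)] that])
  let ?C = "\<lambda>j. HOM G R (P j) N"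
  let ?D = "\<lambda>j f. compose (carrier (P (Suc j))) f (d j)"
  let ?Z = "kernel (?C (Suc i)) (?C (Suc (Suc i))) (?D (Suc i))" and ?B = "?D i ` carrier (?C i)"
  have cg: "comm_group (?C j)" for j by (rule comm_group_HOM[OF G pm N])
  have gh: "group_hom (?C j) (?C (Suc j)) (?D j)" for j
    unfolding group_hom_def group_hom_axioms_def
    using cg HOM_compose_hom[OF G pm pm N p(2)] comm_group.axioms(2) by blast
  have Z: "subgroup ?Z (?C (Suc i))" by (rule group_hom.subgroup_kernel[OF gh])
  have B: "subgroup ?B (?C (Suc i))" by (rule group_hom.img_is_subgroup[OF gh])
  have Z_iff: "f \<in> ?Z \<longleftrightarrow> f \<in> carrier (?C (Suc i)) \<and> (\<forall>x\<in>carrier (P (Suc (Suc i))). f (d (Suc i) x) = \<zero>\<^bsub>N\<^esub>)" for f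
    by (auto simp: kernel_def HOM_simps compose_def restrict_def fun_eq_iff)
  have BZ: "?B \<subseteq> ?Z"
  proof
    fix f assume "f \<in> ?B"
    then obtain g where g: "g \<in> carrier (?C i)" "f = ?D i g" by blast
    have "f (d (Suc i) x) = \<zero>\<^bsub>N\<^esub>" if "x \<in> carrier (P (Suc (Suc i)))" for x
      using g(2) cd[OF that] gr_resolution_dd[OF P that] HOM_lin_map(2)[OF G pm N g(1)] by (simp add: compose_def)
    then show "f \<in> ?Z" unfolding Z_iff using \<open>f \<in> ?B\<close> subgroup.subset[OF B] by blast
  qed
  have "EXT G R (Suc i) M N = (?C (Suc i))\<lparr>carrier := ?Z\<rparr> Mod ?B"
    unfolding EXT_def ch by simp
  then have "trivial_group (EXT G R (Suc i) M N) \<longleftrightarrow> ?Z \<subseteq> ?B"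
    using trivial_quotient_iff[OF cg Z B BZ] by simp
  also have "\<dots> \<longleftrightarrow> ext_vanishes G R P d i N"
  proof
    assume ZB: "?Z \<subseteq> ?B"
    show "ext_vanishes G R P d i N" unfolding ext_vanishes_def
    proof (intro ballI allI impI, elim conjE)
      fix \<sigma> f assume \<sigma>: "\<sigma> \<in> carrier G" and f: "deg_hom G R \<sigma> (P (Suc i)) N f"
        and fz: "\<forall>x\<in>carrier (P (Suc (Suc i))). f (d (Suc i) x) = \<zero>\<^bsub>N\<^esub>"
      have fc: "f x \<in> carrier N" if "x \<in> carrier (P (Suc i))" for x by (rule lin_map_closed[OF deg_hom_lin[OF f] that])
      let ?F = "restrict f (carrier (P (Suc i)))"
      have "?F \<in> carrier (?C (Suc i))"
        by (rule HOM_I[OF pm N'(2), where S = "{\<sigma>}" and h = "\<lambda>_. f"]) (use \<sigma> f fc in auto)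
      then have "?F \<in> ?Z" unfolding Z_iff using fz cd by auto
      then obtain g where g: "g \<in> carrier (?C i)" "?F = ?D i g" using ZB by blast
      have fg: "f x = g (d i x)" if "x \<in> carrier (P (Suc i))" for x
        using fun_cong[OF g(2), of x] that by (simp add: compose_def)
      obtain S h where S: "finite S" "S \<subseteq> carrier G" and h: "\<And>\<sigma>. \<sigma> \<in> carrier G \<Longrightarrow> deg_hom G R \<sigma> (P i) N (h \<sigma>)"
        and gh: "\<And>T x. finite T \<Longrightarrow> S \<subseteq> T \<Longrightarrow> x \<in> carrier (P i) \<Longrightarrow> g x = finsum N (\<lambda>\<sigma>. h \<sigma> x) T"
        by (rule HOM_E[OF G N g(1)]) (rule that)
      let ?T = "insert \<sigma> S"
      have T: "finite ?T" "?T \<subseteq> carrier G" using S \<sigma> by auto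
      have hom: "f x = h \<sigma> (d i x)" if \<tau>: "\<tau> \<in> carrier G" and x: "x \<in> mgrade (P (Suc i)) \<tau>" for \<tau> x
      proof -
        have xc: "x \<in> carrier (P (Suc i))" by (rule graded_by_closed[OF gr_premoduleD(3)[OF pm] \<tau> x])
        have \<tau>\<sigma>: "\<tau> \<otimes>\<^bsub>G\<^esub> \<sigma> \<in> carrier G" using \<tau> \<sigma> by simp
        have "component (carrier G) N (mgrade N) (\<tau> \<otimes>\<^bsub>G\<^esub> \<sigma>) (finsum N (\<lambda>\<rho>. h \<rho> (d i x)) ?T) = h \<sigma> (d i x)"
          by (rule component_of_shifted_sum[OF G N T \<tau>])
            (use deg_hom_grade[OF h \<tau> gr_hom_grade[OF p(2) \<tau> x]] T(2) in auto)
        moreover have "finsum N (\<lambda>\<rho>. h \<rho> (d i x)) ?T = f x"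
          using fg[OF xc] gh[OF T(1) subset_insertI cd[OF xc]] by simp
        moreover have "component (carrier G) N (mgrade N) (\<tau> \<otimes>\<^bsub>G\<^esub> \<sigma>) (f x) = f x"
          using component_homogeneous[OF N'(2,3) \<tau>\<sigma> \<tau>\<sigma> deg_hom_grade[OF f \<tau> x]] by simp
        ultimately show ?thesis by simp
      qed
      have "f x = h \<sigma> (d i x)" if x: "x \<in> carrier (P (Suc i))" for x
        by (rule lin_map_eq_from_homogeneous[OF pm N'(2) deg_hom_lin[OF f]
              lin_map_comp[OF gr_hom_lin[OF p(2)] deg_hom_lin[OF h[OF \<sigma>]]] hom x])
      then show "\<exists>g. deg_hom G R \<sigma> (P i) N g \<and> (\<forall>x\<in>carrier (P (Suc i)). f x = g (d i x))" using h[OF \<sigma>] by blast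
    qed
  next
    assume van: "ext_vanishes G R P d i N"
    show "?Z \<subseteq> ?B"
    proof
      fix f assume "f \<in> ?Z"
      then have f: "f \<in> carrier (?C (Suc i))" and fz: "\<And>x. x \<in> carrier (P (Suc (Suc i))) \<Longrightarrow> f (d (Suc i) x) = \<zero>\<^bsub>N\<^esub>"
        unfolding Z_iff by auto
      obtain S h where S: "finite S" "S \<subseteq> carrier G" and h: "\<And>\<sigma>. \<sigma> \<in> carrier G \<Longrightarrow> deg_hom G R \<sigma> (P (Suc i)) N (h \<sigma>)"
        and fh: "\<And>T x. finite T \<Longrightarrow> S \<subseteq> T \<Longrightarrow> x \<in> carrier (P (Suc i)) \<Longrightarrow> f x = finsum N (\<lambda>\<sigma>. h \<sigma> x) T"
        by (rule HOM_E[OF G N f]) (rule that)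
      have "\<exists>g. deg_hom G R \<sigma> (P i) N g \<and> (\<forall>x\<in>carrier (P (Suc i)). h \<sigma> x = g (d i x))" if \<sigma>: "\<sigma> \<in> S" for \<sigma>
      proof -
        have \<sigma>G: "\<sigma> \<in> carrier G" using \<sigma> S(2) by blast
        have hom: "h \<sigma> (d (Suc i) x) = \<zero>\<^bsub>N\<^esub>" if \<tau>: "\<tau> \<in> carrier G" and x: "x \<in> mgrade (P (Suc (Suc i))) \<tau>" for \<tau> x
        proof -
          have xc: "x \<in> carrier (P (Suc (Suc i)))" by (rule graded_by_closed[OF gr_premoduleD(3)[OF pm] \<tau> x])
          have \<tau>\<sigma>: "\<tau> \<otimes>\<^bsub>G\<^esub> \<sigma> \<in> carrier G" using \<tau> \<sigma>G by simp
          have "h \<sigma> (d (Suc i) x) = component (carrier G) N (mgrade N) (\<tau> \<otimes>\<^bsub>G\<^esub> \<sigma>) (finsum N (\<lambda>\<rho>. h \<rho> (d (Suc i) x)) S)"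
            by (rule component_of_shifted_sum[OF G N S \<tau> _ \<sigma>, symmetric])
              (use deg_hom_grade[OF h \<tau> gr_hom_grade[OF p(2) \<tau> x]] S(2) in auto)
          also have "finsum N (\<lambda>\<rho>. h \<rho> (d (Suc i) x)) S = \<zero>\<^bsub>N\<^esub>"
            using fz[OF xc] fh[OF S(1) subset_refl cd[OF xc]] by simp
          also have "component (carrier G) N (mgrade N) (\<tau> \<otimes>\<^bsub>G\<^esub> \<sigma>) \<zero>\<^bsub>N\<^esub> = \<zero>\<^bsub>N\<^esub>"
            using component_homogeneous[OF N'(2,3) \<tau>\<sigma> \<tau>\<sigma> graded_by_zero[OF N'(3) \<tau>\<sigma>]] by simp
          finally show ?thesis .
        qed
        have "h \<sigma> (d (Suc i) x) = \<zero>\<^bsub>N\<^esub>" if x: "x \<in> carrier (P (Suc (Suc i)))" for x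
          by (rule lin_map_eq_from_homogeneous[OF pm N'(2)
                lin_map_comp[OF gr_hom_lin[OF p(2)] deg_hom_lin[OF h[OF \<sigma>G]]] lin_map_zero_map[OF N'(1)] hom x])
        then show ?thesis using van \<sigma>G h[OF \<sigma>G] unfolding ext_vanishes_def by blast
      qed
      then obtain g where g: "\<And>\<sigma>. \<sigma> \<in> S \<Longrightarrow> deg_hom G R \<sigma> (P i) N (g \<sigma>)"
        "\<And>\<sigma> x. \<sigma> \<in> S \<Longrightarrow> x \<in> carrier (P (Suc i)) \<Longrightarrow> h \<sigma> x = g \<sigma> (d i x)" by metis
      have gc: "g \<sigma> x \<in> carrier N" if "\<sigma> \<in> S" "x \<in> carrier (P i)" for \<sigma> x
        by (rule lin_map_closed[OF deg_hom_lin[OF g(1)[OF that(1)]] that(2)])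
      let ?k = "\<lambda>x\<in>carrier (P i). finsum N (\<lambda>\<sigma>. g \<sigma> x) S"
      have k: "?k \<in> carrier (?C i)" by (rule HOM_I[OF pm N'(2) S g(1)]) auto
      have "f = ?D i ?k"
      proof (rule extensionalityI[OF HOM_extensional[OF f] compose_extensional])
        fix x assume x: "x \<in> carrier (P (Suc i))"
        have "finsum N (\<lambda>\<sigma>. h \<sigma> x) S = finsum N (\<lambda>\<sigma>. g \<sigma> (d i x)) S"
          by (rule N.finsum_cong') (use g(2)[OF _ x] gc[OF _ cd[OF x]] in auto)
        then show "f x = ?D i ?k x" using fh[OF S(1) subset_refl x] x cd[OF x] by (simp add: compose_def)
      qed
      then show "f \<in> ?B" using k by blast
    qed
  qed
  finally show ?thesis .
qed

section \<open>Tensor products\<close>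

text \<open>
  The quotient map from the free abelian group; every element of the tensor product is such a class.
\<close>

definition tensor_class ::
    "('g, 'r) gr_ring \<Rightarrow> ('g, 'r, 'm) gr_module \<Rightarrow> ('g, 'r, 'k) gr_module
      \<Rightarrow> (('m \<times> 'k) \<Rightarrow>\<^sub>0 int) \<Rightarrow> (('m \<times> 'k) \<Rightarrow>\<^sub>0 int) set" where
  "tensor_class R M N c = r_coset (free_Abelian_group (carrier M \<times> carrier N)) (tensor_rel R M N) c"

definition tensor_pure ::
    "('g, 'r) gr_ring \<Rightarrow> ('g, 'r, 'm) gr_module \<Rightarrow> ('g, 'r, 'k) gr_module
      \<Rightarrow> 'm \<Rightarrow> 'k \<Rightarrow> (('m \<times> 'k) \<Rightarrow>\<^sub>0 int) set" where
  "tensor_pure R M N x y = tensor_class R M N (frag_of (x, y))"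

lemma tensor_relators_cases [consumes 1, case_names left right balanced]:
  assumes "c \<in> tensor_relators R M N"
  obtains x x' y where "x \<in> carrier M" "x' \<in> carrier M" "y \<in> carrier N"
      "c = frag_of (x \<oplus>\<^bsub>M\<^esub> x', y) - frag_of (x, y) - frag_of (x', y)"
    | x y y' where "x \<in> carrier M" "y \<in> carrier N" "y' \<in> carrier N"
      "c = frag_of (x, y \<oplus>\<^bsub>N\<^esub> y') - frag_of (x, y) - frag_of (x, y')"
    | a x y where "a \<in> carrier R" "x \<in> carrier M" "y \<in> carrier N"
      "c = frag_of (smult M a x, y) - frag_of (x, smult N a y)"
  using assms unfolding tensor_relators_def by blast

lemma free_Abelian_group_diff_closed:
  assumes "a \<in> carrier (free_Abelian_group S)" "b \<in> carrier (free_Abelian_group S)"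
  shows "a - b \<in> carrier (free_Abelian_group S)"
  using assms keys_diff[of a b] unfolding carrier_free_Abelian_group_iff by blast

lemma tensor_relators_closed:
  assumes M: "pre_module R M" and N: "pre_module R N"
  shows "tensor_relators R M N \<subseteq> carrier (free_Abelian_group (carrier M \<times> carrier N))"
proof
  fix c assume "c \<in> tensor_relators R M N"
  then show "c \<in> carrier (free_Abelian_group (carrier M \<times> carrier N))"
  proof (cases rule: tensor_relators_cases)
    case (left x x' y)
    then show ?thesis using pre_module_add_closed[OF M left(1,2)] unfolding left(4)
      by (intro free_Abelian_group_diff_closed) auto
  next
    case (right x y y')
    then show ?thesis using pre_module_add_closed[OF N right(2,3)] unfolding right(4)
      by (intro free_Abelian_group_diff_closed) auto
  next
    case (balanced a x y)
    then show ?thesis using smult_closed[OF M balanced(1,2)] smult_closed[OF N balanced(1,3)] unfolding balanced(4)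
      by (intro free_Abelian_group_diff_closed) auto
  qed
qed

lemma tensor_rel_subgroup:
  assumes M: "pre_module R M" and N: "pre_module R N"
  shows "subgroup (tensor_rel R M N) (free_Abelian_group (carrier M \<times> carrier N))"
    "tensor_rel R M N \<lhd> free_Abelian_group (carrier M \<times> carrier N)"
proof -
  show s: "subgroup (tensor_rel R M N) (free_Abelian_group (carrier M \<times> carrier N))"
    unfolding tensor_rel_def
    by (rule group.generate_is_subgroup[OF group_free_Abelian_group tensor_relators_closed[OF M N]])
  show "tensor_rel R M N \<lhd> free_Abelian_group (carrier M \<times> carrier N)"
    by (rule comm_group.subgroup_imp_normal[OF abelian_free_Abelian_group s])
qed

lemma tensor_carrier:
  "carrier (tensor R M N) = tensor_class R M N ` carrier (free_Abelian_group (carrier M \<times> carrier N))"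
  by (auto simp: tensor_def FactGroup_def RCOSETS_def tensor_class_def)

lemma tensor_class_mult:
  assumes "pre_module R M" "pre_module R N"
    "a \<in> carrier (free_Abelian_group (carrier M \<times> carrier N))" "b \<in> carrier (free_Abelian_group (carrier M \<times> carrier N))"
  shows "tensor_class R M N a \<otimes>\<^bsub>tensor R M N\<^esub> tensor_class R M N b = tensor_class R M N (a + b)"
  using normal.rcos_sum[OF tensor_rel_subgroup(2)[OF assms(1,2)] assms(3,4)]
  by (simp add: tensor_def FactGroup_def tensor_class_def)

lemma tensor_class_one:
  assumes "pre_module R M" "pre_module R N" "c \<in> tensor_rel R M N"
  shows "tensor_class R M N c = \<one>\<^bsub>tensor R M N\<^esub>"
proof -
  have "c \<in> carrier (free_Abelian_group (carrier M \<times> carrier N))"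
    using subgroup.subset[OF tensor_rel_subgroup(1)[OF assms(1,2)]] assms(3) by blast
  then show ?thesis
    using group.coset_join2[OF group_free_Abelian_group _ tensor_rel_subgroup(1)[OF assms(1,2)] assms(3)]
    by (simp add: tensor_def FactGroup_def tensor_class_def)
qed

lemma comm_group_tensor:
  assumes "pre_module R M" "pre_module R N" shows "comm_group (tensor R M N)"
proof -
  have g: "group (tensor R M N)"
    unfolding tensor_def by (rule normal.factorgroup_is_group[OF tensor_rel_subgroup(2)[OF assms]])
  show ?thesis
  proof (rule group.group_comm_groupI[OF g])
    fix z w assume "z \<in> carrier (tensor R M N)" "w \<in> carrier (tensor R M N)"
    then show "z \<otimes>\<^bsub>tensor R M N\<^esub> w = w \<otimes>\<^bsub>tensor R M N\<^esub> z"
      unfolding tensor_carrier using tensor_class_mult[OF assms] by (auto simp: add.commute)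
  qed
qed

lemma tensor_pure_closed: "x \<in> carrier M \<Longrightarrow> y \<in> carrier N \<Longrightarrow> tensor_pure R M N x y \<in> carrier (tensor R M N)"
  unfolding tensor_carrier tensor_pure_def by (rule imageI) simp

lemma tensor_class_eqI:
  assumes M: "pre_module R M" and N: "pre_module R N"
    and a: "a - b \<in> tensor_rel R M N" and b: "b \<in> carrier (free_Abelian_group (carrier M \<times> carrier N))"
  shows "tensor_class R M N a = tensor_class R M N b"
proof -
  interpret T: comm_group "tensor R M N" by (rule comm_group_tensor[OF M N])
  have ab: "a - b \<in> carrier (free_Abelian_group (carrier M \<times> carrier N))"
    using subgroup.subset[OF tensor_rel_subgroup(1)[OF M N]] a by blast
  have "tensor_class R M N a = tensor_class R M N (a - b) \<otimes>\<^bsub>tensor R M N\<^esub> tensor_class R M N b"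
    using tensor_class_mult[OF M N ab b] by simp
  also have "\<dots> = tensor_class R M N b"
    unfolding tensor_class_one[OF M N a] by (rule T.l_one) (use b in \<open>auto simp: tensor_carrier\<close>)
  finally show ?thesis .
qed

lemma tensor_relator_in_rel: "c \<in> tensor_relators R M N \<Longrightarrow> c \<in> tensor_rel R M N"
  unfolding tensor_rel_def by (rule generate.incl)

lemma tensor_pure_add_left:
  assumes M: "pre_module R M" and N: "pre_module R N" and x: "x \<in> carrier M" "x' \<in> carrier M" and y: "y \<in> carrier N"
  shows "tensor_pure R M N (x \<oplus>\<^bsub>M\<^esub> x') y = tensor_pure R M N x y \<otimes>\<^bsub>tensor R M N\<^esub> tensor_pure R M N x' y"
proof -
  have c: "frag_of (x, y) \<in> carrier (free_Abelian_group (carrier M \<times> carrier N))"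
    "frag_of (x', y) \<in> carrier (free_Abelian_group (carrier M \<times> carrier N))" using x y by auto
  have "frag_of (x \<oplus>\<^bsub>M\<^esub> x', y) - frag_of (x, y) - frag_of (x', y) \<in> tensor_relators R M N"
    unfolding tensor_relators_def using x y by blast
  then have "frag_of (x \<oplus>\<^bsub>M\<^esub> x', y) - (frag_of (x, y) + frag_of (x', y)) \<in> tensor_rel R M N"
    using tensor_relator_in_rel by (simp add: diff_diff_eq)
  then show ?thesis unfolding tensor_pure_def tensor_class_mult[OF M N c]
    using keys_add[of "frag_of (x, y)" "frag_of (x', y)"] x y by (intro tensor_class_eqI[OF M N]) auto
qed

lemma tensor_pure_add_right:
  assumes M: "pre_module R M" and N: "pre_module R N" and x: "x \<in> carrier M" and y: "y \<in> carrier N" "y' \<in> carrier N"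
  shows "tensor_pure R M N x (y \<oplus>\<^bsub>N\<^esub> y') = tensor_pure R M N x y \<otimes>\<^bsub>tensor R M N\<^esub> tensor_pure R M N x y'"
proof -
  have c: "frag_of (x, y) \<in> carrier (free_Abelian_group (carrier M \<times> carrier N))"
    "frag_of (x, y') \<in> carrier (free_Abelian_group (carrier M \<times> carrier N))" using x y by auto
  have "frag_of (x, y \<oplus>\<^bsub>N\<^esub> y') - frag_of (x, y) - frag_of (x, y') \<in> tensor_relators R M N"
    unfolding tensor_relators_def using x y by blast
  then have "frag_of (x, y \<oplus>\<^bsub>N\<^esub> y') - (frag_of (x, y) + frag_of (x, y')) \<in> tensor_rel R M N"
    using tensor_relator_in_rel by (simp add: diff_diff_eq)
  then show ?thesis unfolding tensor_pure_def tensor_class_mult[OF M N c]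
    using keys_add[of "frag_of (x, y)" "frag_of (x, y')"] x y by (intro tensor_class_eqI[OF M N]) auto
qed

lemma tensor_pure_smult:
  assumes M: "pre_module R M" and N: "pre_module R N" and x: "x \<in> carrier M" and y: "y \<in> carrier N" and a: "a \<in> carrier R"
  shows "tensor_pure R M N (smult M a x) y = tensor_pure R M N x (smult N a y)"
proof -
  have "frag_of (smult M a x, y) - frag_of (x, smult N a y) \<in> tensor_relators R M N"
    unfolding tensor_relators_def using x y a by blast
  then show ?thesis unfolding tensor_pure_def
    by (intro tensor_class_eqI[OF M N tensor_relator_in_rel]) (use x smult_closed[OF N a y] in auto)
qed

lemma tensor_pure_zero_left:
  assumes M: "pre_module R M" and N: "pre_module R N" and y: "y \<in> carrier N"
  shows "tensor_pure R M N \<zero>\<^bsub>M\<^esub> y = \<one>\<^bsub>tensor R M N\<^esub>"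
proof -
  interpret M: abelian_group M by (rule pre_module_abelian_group[OF M])
  interpret T: comm_group "tensor R M N" by (rule comm_group_tensor[OF M N])
  show ?thesis using tensor_pure_add_left[OF M N M.zero_closed M.zero_closed y]
      tensor_pure_closed[OF M.zero_closed y] by simp
qed

lemma tensor_pure_zero_right:
  assumes M: "pre_module R M" and N: "pre_module R N" and x: "x \<in> carrier M"
  shows "tensor_pure R M N x \<zero>\<^bsub>N\<^esub> = \<one>\<^bsub>tensor R M N\<^esub>"
proof -
  interpret N: abelian_group N by (rule pre_module_abelian_group[OF N])
  interpret T: comm_group "tensor R M N" by (rule comm_group_tensor[OF M N])
  show ?thesis using tensor_pure_add_right[OF M N x N.zero_closed N.zero_closed]
      tensor_pure_closed[OF x N.zero_closed] by simp
qed

lemma tensor_pure_neg_left: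
  assumes M: "pre_module R M" and N: "pre_module R N" and x: "x \<in> carrier M" and y: "y \<in> carrier N"
  shows "inv\<^bsub>tensor R M N\<^esub> tensor_pure R M N x y = tensor_pure R M N (\<ominus>\<^bsub>M\<^esub> x) y"
proof -
  interpret M: abelian_group M by (rule pre_module_abelian_group[OF M])
  interpret T: comm_group "tensor R M N" by (rule comm_group_tensor[OF M N])
  have "tensor_pure R M N (\<ominus>\<^bsub>M\<^esub> x) y \<otimes>\<^bsub>tensor R M N\<^esub> tensor_pure R M N x y = \<one>\<^bsub>tensor R M N\<^esub>"
    using tensor_pure_add_left[OF M N _ x y, of "\<ominus>\<^bsub>M\<^esub> x"] x tensor_pure_zero_left[OF M N y] by (simp add: M.l_neg)
  then show ?thesis using x y by (intro T.inv_equality) (auto intro!: tensor_pure_closed)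
qed

text \<open>
  The tensor product is generated by pure tensors already as a monoid, because the inverse of a pure tensor is
  one.
\<close>

lemma tensor_induct [consumes 3, case_names one pure mult]:
  assumes M: "pre_module R M" and N: "pre_module R N" and z: "z \<in> carrier (tensor R M N)"
    and one: "Q \<one>\<^bsub>tensor R M N\<^esub>" and pure: "\<And>x y. x \<in> carrier M \<Longrightarrow> y \<in> carrier N \<Longrightarrow> Q (tensor_pure R M N x y)"
    and mult: "\<And>z w. z \<in> carrier (tensor R M N) \<Longrightarrow> w \<in> carrier (tensor R M N) \<Longrightarrow> Q z \<Longrightarrow> Q w
      \<Longrightarrow> Q (z \<otimes>\<^bsub>tensor R M N\<^esub> w)"
  shows "Q z"
proof -
  interpret M: abelian_group M by (rule pre_module_abelian_group[OF M])
  interpret T: comm_group "tensor R M N" by (rule comm_group_tensor[OF M N])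
  let ?F = "free_Abelian_group (carrier M \<times> carrier N)" and ?c = "tensor_class R M N"
  have cc: "?c c \<in> carrier (tensor R M N)" if "Poly_Mapping.keys c \<subseteq> carrier M \<times> carrier N" for c
    unfolding tensor_carrier by (rule imageI) (use that in simp)
  have one': "?c 0 = \<one>\<^bsub>tensor R M N\<^esub>"
    using tensor_class_one[OF M N subgroup.one_closed[OF tensor_rel_subgroup(1)[OF M N]]] by simp
  \<comment> \<open>Strengthening the property to inverses makes room for the negative coefficients.\<close>
  have *: "Q (?c c) \<and> Q (inv\<^bsub>tensor R M N\<^esub> ?c c)" if "Poly_Mapping.keys c \<subseteq> carrier M \<times> carrier N" for c
  proof (rule free_Abelian_group_induct[OF that])
    show "Q (?c 0) \<and> Q (inv\<^bsub>tensor R M N\<^esub> ?c 0)" using one one' by simp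
  next
    fix a b assume 2: "Poly_Mapping.keys a \<subseteq> carrier M \<times> carrier N" "Poly_Mapping.keys b \<subseteq> carrier M \<times> carrier N"
      "Q (?c a) \<and> Q (inv\<^bsub>tensor R M N\<^esub> ?c a)" "Q (?c b) \<and> Q (inv\<^bsub>tensor R M N\<^esub> ?c b)"
    have ab: "Poly_Mapping.keys (a - b) \<subseteq> carrier M \<times> carrier N" using keys_diff[of a b] 2 by blast
    have "?c (a - b) \<otimes>\<^bsub>tensor R M N\<^esub> ?c b = ?c a"
      using tensor_class_mult[OF M N, of "a - b" b] ab 2 by simp
    then have "?c (a - b) = ?c a \<otimes>\<^bsub>tensor R M N\<^esub> inv\<^bsub>tensor R M N\<^esub> ?c b"
      using cc[OF ab] cc[OF 2(2)] cc[OF 2(1)] by (metis T.inv_solve_right)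
    moreover from this have "inv\<^bsub>tensor R M N\<^esub> ?c (a - b) = inv\<^bsub>tensor R M N\<^esub> ?c a \<otimes>\<^bsub>tensor R M N\<^esub> ?c b"
      using cc[OF 2(2)] cc[OF 2(1)] by (simp add: T.inv_mult_group T.m_comm)
    ultimately show "Q (?c (a - b)) \<and> Q (inv\<^bsub>tensor R M N\<^esub> ?c (a - b))" using mult cc[OF 2(2)] cc[OF 2(1)] 2(3,4) by simp
  next
    fix p assume 3: "p \<in> carrier M \<times> carrier N"
    obtain x y where p: "p = (x, y)" "x \<in> carrier M" "y \<in> carrier N" using 3 by auto
    have "?c (frag_of p) = tensor_pure R M N x y" using p by (simp add: tensor_pure_def)
    then show "Q (?c (frag_of p)) \<and> Q (inv\<^bsub>tensor R M N\<^esub> ?c (frag_of p))" using pure[OF p(2,3)] pure[of "\<ominus>\<^bsub>M\<^esub> x" y] p tensor_pure_neg_left[OF M N p(2,3)] by simp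
  qed
  obtain c where "c \<in> carrier ?F" "z = ?c c" using z unfolding tensor_carrier by blast
  then show ?thesis using * by simp
qed

lemma tensor_hom_eqI:
  assumes M: "pre_module R M" and N: "pre_module R N" and H: "group H"
    and \<phi>: "\<phi> \<in> hom (tensor R M N) H" and \<psi>: "\<psi> \<in> hom (tensor R M N) H"
    and eq: "\<And>x y. x \<in> carrier M \<Longrightarrow> y \<in> carrier N \<Longrightarrow> \<phi> (tensor_pure R M N x y) = \<psi> (tensor_pure R M N x y)"
    and z: "z \<in> carrier (tensor R M N)"
  shows "\<phi> z = \<psi> z"
  using M N z
proof (induction rule: tensor_induct)
  case one
  have "group (tensor R M N)" using comm_group_tensor[OF M N] comm_group.axioms(2) by blast
  then show ?case using hom_one[OF \<phi> _ H] hom_one[OF \<psi> _ H] by simp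
next
  case (mult z w)
  then show ?case using hom_mult[OF \<phi>] hom_mult[OF \<psi>] by simp
qed (rule eq)

text \<open>
  The homomorphism from the free abelian group given by \<open>\<beta>\<close> kills the relators, hence factors through the
  quotient.
\<close>

lemma tensor_universal:
  assumes M: "pre_module R M" and N: "pre_module R N" and H: "comm_group H"
    and cl: "\<And>x y. x \<in> carrier M \<Longrightarrow> y \<in> carrier N \<Longrightarrow> \<beta> x y \<in> carrier H"
    and add_left: "\<And>x x' y. x \<in> carrier M \<Longrightarrow> x' \<in> carrier M \<Longrightarrow> y \<in> carrier N \<Longrightarrow>
        \<beta> (x \<oplus>\<^bsub>M\<^esub> x') y = \<beta> x y \<otimes>\<^bsub>H\<^esub> \<beta> x' y"
    and add_right: "\<And>x y y'. x \<in> carrier M \<Longrightarrow> y \<in> carrier N \<Longrightarrow> y' \<in> carrier N \<Longrightarrow>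
        \<beta> x (y \<oplus>\<^bsub>N\<^esub> y') = \<beta> x y \<otimes>\<^bsub>H\<^esub> \<beta> x y'"
    and bal: "\<And>a x y. a \<in> carrier R \<Longrightarrow> x \<in> carrier M \<Longrightarrow> y \<in> carrier N \<Longrightarrow> \<beta> (smult M a x) y = \<beta> x (smult N a y)"
  obtains \<phi> where "\<phi> \<in> hom (tensor R M N) H"
    "\<And>x y. x \<in> carrier M \<Longrightarrow> y \<in> carrier N \<Longrightarrow> \<phi> (tensor_pure R M N x y) = \<beta> x y"
proof -
  interpret H: comm_group H by fact
  let ?F = "free_Abelian_group (carrier M \<times> carrier N)"
  interpret F: comm_group ?F by (rule abelian_free_Abelian_group)
  have "(\<lambda>(x, y). \<beta> x y) ` (carrier M \<times> carrier N) \<subseteq> carrier H" using cl by auto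
  then obtain h where h: "h \<in> hom ?F H" "\<And>p. p \<in> carrier M \<times> carrier N \<Longrightarrow> h (frag_of p) = (\<lambda>(x, y). \<beta> x y) p"
    using H.free_Abelian_group_universal by metis
  interpret h: group_hom ?F H h using h(1) by unfold_locales
  have hd: "h (a - b) = h a \<otimes>\<^bsub>H\<^esub> inv\<^bsub>H\<^esub> h b" if "a \<in> carrier ?F" "b \<in> carrier ?F" for a b
    using h.hom_mult[OF that(1), of "inv\<^bsub>?F\<^esub> b"] that h.hom_inv[OF that(2)] by simp
  note dc = free_Abelian_group_diff_closed
  have H1: "a \<otimes>\<^bsub>H\<^esub> b \<otimes>\<^bsub>H\<^esub> inv\<^bsub>H\<^esub> a \<otimes>\<^bsub>H\<^esub> inv\<^bsub>H\<^esub> b = \<one>\<^bsub>H\<^esub>" if "a \<in> carrier H" "b \<in> carrier H" for a b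
    using that H.m_comm[of a b] by (simp add: H.m_assoc)
  have hp: "h (frag_of (x, y)) = \<beta> x y" if "x \<in> carrier M" "y \<in> carrier N" for x y using h(2)[of "(x, y)"] that by simp
  have fc: "frag_of (x, y) \<in> carrier ?F" if "x \<in> carrier M" "y \<in> carrier N" for x y using that by simp
  have "tensor_relators R M N \<subseteq> kernel ?F H h"
  proof
    fix c assume c: "c \<in> tensor_relators R M N"
    then have cF: "c \<in> carrier ?F" using tensor_relators_closed[OF M N] by blast
    from c have "h c = \<one>\<^bsub>H\<^esub>"
    proof (cases rule: tensor_relators_cases)
      case (left x x' y)
      note a = pre_module_add_closed[OF M left(1,2)]
      have "h c = h (frag_of (x \<oplus>\<^bsub>M\<^esub> x', y)) \<otimes>\<^bsub>H\<^esub> inv\<^bsub>H\<^esub> h (frag_of (x, y)) \<otimes>\<^bsub>H\<^esub> inv\<^bsub>H\<^esub> h (frag_of (x', y))"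
        unfolding left(4) by (simp only: hd[OF dc[OF fc[OF a left(3)] fc[OF left(1,3)]] fc[OF left(2,3)]]
            hd[OF fc[OF a left(3)] fc[OF left(1,3)]])
      then show ?thesis using hp[OF a left(3)] hp[OF left(1,3)] hp[OF left(2,3)] add_left[OF left(1-3)]
          H1[OF cl[OF left(1,3)] cl[OF left(2,3)]] by simp
    next
      case (right x y y')
      note a = pre_module_add_closed[OF N right(2,3)]
      have "h c = h (frag_of (x, y \<oplus>\<^bsub>N\<^esub> y')) \<otimes>\<^bsub>H\<^esub> inv\<^bsub>H\<^esub> h (frag_of (x, y)) \<otimes>\<^bsub>H\<^esub> inv\<^bsub>H\<^esub> h (frag_of (x, y'))"
        unfolding right(4) by (simp only: hd[OF dc[OF fc[OF right(1) a] fc[OF right(1,2)]] fc[OF right(1,3)]]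
            hd[OF fc[OF right(1) a] fc[OF right(1,2)]])
      then show ?thesis using hp[OF right(1) a] hp[OF right(1,2)] hp[OF right(1,3)] add_right[OF right(1-3)]
          H1[OF cl[OF right(1,2)] cl[OF right(1,3)]] by simp
    next
      case (balanced a x y)
      note m = smult_closed[OF M balanced(1,2)] smult_closed[OF N balanced(1,3)]
      have "h c = h (frag_of (smult M a x, y)) \<otimes>\<^bsub>H\<^esub> inv\<^bsub>H\<^esub> h (frag_of (x, smult N a y))"
        unfolding balanced(4) by (rule hd[OF fc[OF m(1) balanced(3)] fc[OF balanced(2) m(2)]])
      then show ?thesis using hp[OF m(1) balanced(3)] hp[OF balanced(2) m(2)] bal[OF balanced(1-3)]
          cl[OF balanced(2) m(2)] by simp
    qed
    then show "c \<in> kernel ?F H h" using cF by (simp add: kernel_def)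
  qed
  then have "tensor_rel R M N \<subseteq> kernel ?F H h"
    unfolding tensor_rel_def by (rule F.generate_subgroup_incl[OF _ h.subgroup_kernel])
  then obtain g where g: "g \<in> hom (?F Mod tensor_rel R M N) H"
    "\<And>c. c \<in> carrier ?F \<Longrightarrow> g (tensor_rel R M N #>\<^bsub>?F\<^esub> c) = h c"
    using h.FactGroup_universal_kernel[OF tensor_rel_subgroup(2)[OF M N]] by metis
  show ?thesis
  proof (rule that[of g])
    show "g \<in> hom (tensor R M N) H" using g(1) by (simp add: tensor_def)
    fix x y assume "x \<in> carrier M" "y \<in> carrier N"
    then show "g (tensor_pure R M N x y) = \<beta> x y"
      unfolding tensor_pure_def tensor_class_def using g(2) h(2) by simp
  qed
qed

text \<open>
  Relators are mapped to relators, so the classes of all representatives of one coset agree and the union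
  in \<open>tensor_map\<close> is over a constant family.
\<close>

lemma tensor_map_class:
  assumes M: "pre_module R M" and N: "pre_module R N" and M': "pre_module R M'" and N': "pre_module R N'"
    and f: "lin_map R M M' f" and g: "lin_map R N N' g"
    and c: "c \<in> carrier (free_Abelian_group (carrier M \<times> carrier N))"
  shows "tensor_map R M' N' f g (tensor_class R M N c)
      = tensor_class R M' N' (frag_extend (\<lambda>(x, y). frag_of (f x, g y)) c)"
    and "frag_extend (\<lambda>(x, y). frag_of (f x, g y)) c \<in> carrier (free_Abelian_group (carrier M' \<times> carrier N'))"
proof -
  let ?F = "free_Abelian_group (carrier M \<times> carrier N)" and ?F' = "free_Abelian_group (carrier M' \<times> carrier N')"
  let ?E = "frag_extend (\<lambda>(x, y). frag_of (f x, g y))"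
  note T = tensor_rel_subgroup(1)[OF M N]
  have E: "?E b \<in> carrier ?F'" if "b \<in> carrier ?F" for b
  proof -
    have "Poly_Mapping.keys (?E b) \<subseteq> (\<Union>p\<in>Poly_Mapping.keys b. Poly_Mapping.keys ((\<lambda>(x, y). frag_of (f x, g y)) p))"
      by (rule keys_frag_extend)
    also have "\<dots> \<subseteq> carrier M' \<times> carrier N'"
      using that lin_map_closed[OF f] lin_map_closed[OF g] by (auto split: prod.splits)
    finally show ?thesis by simp
  qed
  show "?E c \<in> carrier ?F'" by (rule E[OF c])
  have rel: "?E t \<in> tensor_rel R M' N'" if "t \<in> tensor_rel R M N" for t
    using that unfolding tensor_rel_def
  proof (induction rule: generate.induct)
    case one
    then show ?case using generate.one[of ?F'] by simp
  next
    have *: "?E r \<in> tensor_relators R M' N'" if "r \<in> tensor_relators R M N" for r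
      using that
    proof (cases rule: tensor_relators_cases)
      case (left x x' y)
      then have "?E r = frag_of (f x \<oplus>\<^bsub>M'\<^esub> f x', g y) - frag_of (f x, g y) - frag_of (f x', g y)"
        by (simp add: frag_extend_diff lin_map_add[OF f])
      then show ?thesis unfolding tensor_relators_def
        using lin_map_closed[OF f left(1)] lin_map_closed[OF f left(2)] lin_map_closed[OF g left(3)] by blast
    next
      case (right x y y')
      then have "?E r = frag_of (f x, g y \<oplus>\<^bsub>N'\<^esub> g y') - frag_of (f x, g y) - frag_of (f x, g y')"
        by (simp add: frag_extend_diff lin_map_add[OF g])
      then show ?thesis unfolding tensor_relators_def
        using lin_map_closed[OF f right(1)] lin_map_closed[OF g right(2)] lin_map_closed[OF g right(3)] by blast
    next
      case (balanced a x y)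
      then have "?E r = frag_of (smult M' a (f x), g y) - frag_of (f x, smult N' a (g y))"
        by (simp add: frag_extend_diff lin_map_smult[OF f] lin_map_smult[OF g])
      then show ?thesis unfolding tensor_relators_def
        using lin_map_closed[OF f balanced(2)] lin_map_closed[OF g balanced(3)] balanced(1) by blast
    qed
    {
      case (incl h)
      then show ?case using * generate.incl[of _ _ ?F'] by blast
    next
      case (inv h)
      then have "h \<in> carrier ?F" "?E h \<in> carrier ?F'" using tensor_relators_closed[OF M N] E by blast+
      then have "?E (inv\<^bsub>?F\<^esub> h) = inv\<^bsub>?F'\<^esub> ?E h" by (simp add: frag_extend_minus)
      then show ?case using generate.inv[OF *[OF inv], of ?F'] by simp
    next
      case (eng h1 h2)
      then show ?case using generate.eng[of "?E h1" ?F' _ "?E h2"] by (simp add: frag_extend_add)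
    }
  qed
  have cT: "c \<in> tensor_class R M N c"
    unfolding tensor_class_def by (rule group.rcos_self[OF group_free_Abelian_group c T])
  have eq: "tensor_class R M' N' (?E z) = tensor_class R M' N' (?E c)" if z: "z \<in> tensor_class R M N c" for z
  proof -
    obtain t where t: "t \<in> tensor_rel R M N" "z = t + c" using z by (auto simp: tensor_class_def r_coset_def)
    show ?thesis
      by (rule tensor_class_eqI[OF M' N']) (use t rel E[OF c] in \<open>auto simp: frag_extend_add\<close>)
  qed
  have "tensor_map R M' N' f g (tensor_class R M N c) = (\<Union>z\<in>tensor_class R M N c. tensor_class R M' N' (?E z))"
    by (simp add: tensor_map_def tensor_class_def)
  also have "\<dots> = (\<Union>z\<in>tensor_class R M N c. tensor_class R M' N' (?E c))"
    by (rule SUP_cong[OF refl eq])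
  also have "\<dots> = tensor_class R M' N' (?E c)" using cT by auto
  finally show "tensor_map R M' N' f g (tensor_class R M N c) = tensor_class R M' N' (?E c)" .
qed

lemma tensor_map_hom:
  assumes M: "pre_module R M" and N: "pre_module R N" and M': "pre_module R M'" and N': "pre_module R N'"
    and f: "lin_map R M M' f" and g: "lin_map R N N' g"
  shows "tensor_map R M' N' f g \<in> hom (tensor R M N) (tensor R M' N')"
proof (rule homI)
  note cl = tensor_map_class[OF M N M' N' f g]
  fix z assume "z \<in> carrier (tensor R M N)"
  then obtain a where a: "a \<in> carrier (free_Abelian_group (carrier M \<times> carrier N))" "z = tensor_class R M N a"
    unfolding tensor_carrier by blast
  show "tensor_map R M' N' f g z \<in> carrier (tensor R M' N')"
    unfolding a(2) cl(1)[OF a(1)] tensor_carrier by (rule imageI[OF cl(2)[OF a(1)]])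
  fix w assume "w \<in> carrier (tensor R M N)"
  then obtain b where b: "b \<in> carrier (free_Abelian_group (carrier M \<times> carrier N))" "w = tensor_class R M N b"
    unfolding tensor_carrier by blast
  have ab: "a + b \<in> carrier (free_Abelian_group (carrier M \<times> carrier N))"
    using a(1) b(1) keys_add[of a b] by auto
  show "tensor_map R M' N' f g (z \<otimes>\<^bsub>tensor R M N\<^esub> w)
      = tensor_map R M' N' f g z \<otimes>\<^bsub>tensor R M' N'\<^esub> tensor_map R M' N' f g w"
    unfolding a(2) b(2) tensor_class_mult[OF M N a(1) b(1)] cl(1)[OF a(1)] cl(1)[OF b(1)] cl(1)[OF ab] frag_extend_add
    by (rule tensor_class_mult[OF M' N' cl(2)[OF a(1)] cl(2)[OF b(1)], symmetric])
qed

lemma tensor_map_pure: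
  assumes "pre_module R M" "pre_module R N" "pre_module R M'" "pre_module R N'"
    "lin_map R M M' f" "lin_map R N N' g" "x \<in> carrier M" "y \<in> carrier N"
  shows "tensor_map R M' N' f g (tensor_pure R M N x y) = tensor_pure R M' N' (f x) (g y)"
  unfolding tensor_pure_def by (subst tensor_map_class(1)[OF assms(1-6)]) (use assms(7,8) in auto)

lemma tensor_map_comp:
  assumes M: "pre_module R M" and N: "pre_module R N" and M': "pre_module R M'" and N': "pre_module R N'"
    and M'': "pre_module R M''" and N'': "pre_module R N''"
    and f: "lin_map R M M' f" and g: "lin_map R N N' g" and f': "lin_map R M' M'' f'" and g': "lin_map R N' N'' g'"
    and z: "z \<in> carrier (tensor R M N)"
  shows "tensor_map R M'' N'' f' g' (tensor_map R M' N' f g z)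
      = tensor_map R M'' N'' (\<lambda>x. f' (f x)) (\<lambda>y. g' (g y)) z"
proof -
  note h1 = tensor_map_hom[OF M N M' N' f g] and h2 = tensor_map_hom[OF M' N' M'' N'' f' g']
  have "(tensor_map R M'' N'' f' g' \<circ> tensor_map R M' N' f g) z
      = tensor_map R M'' N'' (\<lambda>x. f' (f x)) (\<lambda>y. g' (g y)) z"
  proof (rule tensor_hom_eqI[OF M N _ hom_compose[OF h1 h2]
        tensor_map_hom[OF M N M'' N'' lin_map_comp[OF f f'] lin_map_comp[OF g g']] _ z])
    show "group (tensor R M'' N'')" using comm_group_tensor[OF M'' N''] comm_group.axioms(2) by blast
    fix x y assume "x \<in> carrier M" "y \<in> carrier N"
    then show "(tensor_map R M'' N'' f' g' \<circ> tensor_map R M' N' f g) (tensor_pure R M N x y)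
      = tensor_map R M'' N'' (\<lambda>x. f' (f x)) (\<lambda>y. g' (g y)) (tensor_pure R M N x y)"
      using tensor_map_pure[OF M N M' N' f g] tensor_map_pure[OF M' N' M'' N'' f' g']
        tensor_map_pure[OF M N M'' N'' lin_map_comp[OF f f'] lin_map_comp[OF g g']]
        lin_map_closed[OF f] lin_map_closed[OF g] by simp
  qed
  then show ?thesis by simp
qed

lemma tensor_map_cong:
  assumes M: "pre_module R M" and N: "pre_module R N" and M': "pre_module R M'" and N': "pre_module R N'"
    and f: "lin_map R M M' f" and g: "lin_map R N N' g" and f': "lin_map R M M' f'" and g': "lin_map R N N' g'"
    and eq: "\<And>x. x \<in> carrier M \<Longrightarrow> f x = f' x" "\<And>y. y \<in> carrier N \<Longrightarrow> g y = g' y"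
    and z: "z \<in> carrier (tensor R M N)"
  shows "tensor_map R M' N' f g z = tensor_map R M' N' f' g' z"
proof (rule tensor_hom_eqI[OF M N _ tensor_map_hom[OF M N M' N' f g] tensor_map_hom[OF M N M' N' f' g'] _ z])
  show "group (tensor R M' N')" using comm_group_tensor[OF M' N'] comm_group.axioms(2) by blast
  show "tensor_map R M' N' f g (tensor_pure R M N x y) = tensor_map R M' N' f' g' (tensor_pure R M N x y)"
    if "x \<in> carrier M" "y \<in> carrier N" for x y
    using tensor_map_pure[OF M N M' N' f g that] tensor_map_pure[OF M N M' N' f' g' that] eq that by simp
qed

lemma tensor_map_id:
  assumes M: "pre_module R M" and N: "pre_module R N" and z: "z \<in> carrier (tensor R M N)"
  shows "tensor_map R M N (\<lambda>x. x) (\<lambda>y. y) z = z"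
proof -
  have l: "lin_map R M M (\<lambda>x. x)" "lin_map R N N (\<lambda>x. x)" by (auto simp: lin_map_def)
  interpret T: comm_group "tensor R M N" by (rule comm_group_tensor[OF M N])
  have id: "(\<lambda>z. z) \<in> hom (tensor R M N) (tensor R M N)" by (auto simp: hom_def)
  show ?thesis
    by (rule tensor_hom_eqI[OF M N T.is_group tensor_map_hom[OF M N M N l] id _ z])
      (rule tensor_map_pure[OF M N M N l])
qed

lemma tensor_map_add:
  assumes M: "pre_module R M" and N: "pre_module R N" and M': "pre_module R M'" and N': "pre_module R N'"
    and f: "lin_map R M M' f" and g: "lin_map R N N' g" and h: "lin_map R N N' h"
    and z: "z \<in> carrier (tensor R M N)"
  shows "tensor_map R M' N' f (\<lambda>y. g y \<oplus>\<^bsub>N'\<^esub> h y) z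
      = tensor_map R M' N' f g z \<otimes>\<^bsub>tensor R M' N'\<^esub> tensor_map R M' N' f h z"
proof -
  interpret T': comm_group "tensor R M' N'" by (rule comm_group_tensor[OF M' N'])
  note gh = lin_map_add_maps[OF N' g h]
  note hg = tensor_map_hom[OF M N M' N' f g] and hh = tensor_map_hom[OF M N M' N' f h]
  have "(\<lambda>z. tensor_map R M' N' f g z \<otimes>\<^bsub>tensor R M' N'\<^esub> tensor_map R M' N' f h z)
      \<in> hom (tensor R M N) (tensor R M' N')"
  proof (rule homI)
    fix z w assume "z \<in> carrier (tensor R M N)" "w \<in> carrier (tensor R M N)"
    then show "tensor_map R M' N' f g (z \<otimes>\<^bsub>tensor R M N\<^esub> w) \<otimes>\<^bsub>tensor R M' N'\<^esub> tensor_map R M' N' f h (z \<otimes>\<^bsub>tensor R M N\<^esub> w)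
      = tensor_map R M' N' f g z \<otimes>\<^bsub>tensor R M' N'\<^esub> tensor_map R M' N' f h z
        \<otimes>\<^bsub>tensor R M' N'\<^esub> (tensor_map R M' N' f g w \<otimes>\<^bsub>tensor R M' N'\<^esub> tensor_map R M' N' f h w)"
      using hom_mult[OF hg] hom_mult[OF hh] hom_in_carrier[OF hg] hom_in_carrier[OF hh] by (simp add: T'.m_ac)
  qed (use hom_in_carrier[OF hg] hom_in_carrier[OF hh] in simp)
  then show ?thesis
  proof (rule tensor_hom_eqI[OF M N T'.is_group tensor_map_hom[OF M N M' N' f gh] _ _ z])
    fix x y assume xy: "x \<in> carrier M" "y \<in> carrier N"
    show "tensor_map R M' N' f (\<lambda>y. g y \<oplus>\<^bsub>N'\<^esub> h y) (tensor_pure R M N x y)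
      = tensor_map R M' N' f g (tensor_pure R M N x y) \<otimes>\<^bsub>tensor R M' N'\<^esub> tensor_map R M' N' f h (tensor_pure R M N x y)"
      using tensor_map_pure[OF M N M' N' f gh xy] tensor_map_pure[OF M N M' N' f g xy] tensor_map_pure[OF M N M' N' f h xy]
        tensor_pure_add_right[OF M' N' lin_map_closed[OF f xy(1)] lin_map_closed[OF g xy(2)] lin_map_closed[OF h xy(2)]]
      by simp
  qed
qed

lemma tensor_map_zero:
  assumes M: "pre_module R M" and N: "pre_module R N" and M': "pre_module R M'" and N': "pre_module R N'"
    and f: "lin_map R M M' f" and z: "z \<in> carrier (tensor R M N)"
  shows "tensor_map R M' N' f (\<lambda>y. \<zero>\<^bsub>N'\<^esub>) z = \<one>\<^bsub>tensor R M' N'\<^esub>"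
proof -
  interpret T': comm_group "tensor R M' N'" by (rule comm_group_tensor[OF M' N'])
  have "(\<lambda>z. \<one>\<^bsub>tensor R M' N'\<^esub>) \<in> hom (tensor R M N) (tensor R M' N')" by (auto simp: hom_def)
  then show ?thesis
    by (rule tensor_hom_eqI[OF M N T'.is_group tensor_map_hom[OF M N M' N' f lin_map_zero_map[OF N']] _ _ z])
      (simp add: tensor_map_pure[OF M N M' N' f lin_map_zero_map[OF N']] tensor_pure_zero_right[OF M' N'] lin_map_closed[OF f])
qed

text \<open>
  It suffices to find preimages of pure tensors.
\<close>

lemma tensor_map_surj:
  assumes M: "pre_module R M" and N: "pre_module R N" and M': "pre_module R M'"
    and f: "lin_map R M M' f" "f ` carrier M = carrier M'" and z: "z \<in> carrier (tensor R M' N)"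
  shows "\<exists>w\<in>carrier (tensor R M N). tensor_map R M' N f (\<lambda>y. y) w = z"
  using M' N z
proof (induction rule: tensor_induct)
  note h = tensor_map_hom[OF M N M' N f(1), of "\<lambda>y. y"]
  have l: "lin_map R N N (\<lambda>y. y)" by (auto simp: lin_map_def)
  interpret T: comm_group "tensor R M N" by (rule comm_group_tensor[OF M N])
  interpret T': comm_group "tensor R M' N" by (rule comm_group_tensor[OF M' N])
  {
    case one
    then show ?case using hom_one[OF h[OF l] T.is_group T'.is_group] T.one_closed by blast
  next
    case (pure x y)
    then obtain x' where "x' \<in> carrier M" "x = f x'" using f(2) by blast
    then show ?case using tensor_map_pure[OF M N M' N f(1) l, of x' y] pure tensor_pure_closed[of x' M y N R] by metis
  next
    case (mult z w)
    then obtain z' w' where *: "z' \<in> carrier (tensor R M N)" "tensor_map R M' N f (\<lambda>y. y) z' = z"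
      "w' \<in> carrier (tensor R M N)" "tensor_map R M' N f (\<lambda>y. y) w' = w" by blast
    then show ?case using hom_mult[OF h[OF l] *(1,3)] T.m_closed[OF *(1,3)] by blast
  }
qed

section \<open>Tensoring with a free module\<close>

text \<open>
  The part of being a graded right module that matters for tensor products.
\<close>

definition right_action :: "('g, 'r) gr_ring \<Rightarrow> ('g, 'r, 'm) gr_module \<Rightarrow> bool" where
  "right_action R M \<longleftrightarrow> pre_module R M \<and> (\<forall>a\<in>carrier R. \<forall>b\<in>carrier R. \<forall>x\<in>carrier M.
        smult M (a \<otimes>\<^bsub>R\<^esub> b) x = smult M b (smult M a x))"

lemma abelian_group_comm_group: "abelian_group M \<Longrightarrow> comm_group (add_monoid M)"
  by (rule abelian_group.a_comm_group)

text \<open>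
  The coordinate functional at \<open>b\<close> of the free module, tensored with \<open>M\<close>.  Balancedness of
  \<open>x \<otimes> f \<mapsto> x \<cdot> f b\<close> is where \<open>M\<close> has to be a right module.
\<close>

lemma tensor_coordinate:
  assumes R: "ring R" and M: "right_action R M"
  obtains \<phi> where "\<phi> \<in> hom (tensor R M (gr_free G R B \<delta>)) (add_monoid M)"
    "\<And>x f. x \<in> carrier M \<Longrightarrow> f \<in> carrier (gr_free G R B \<delta>) \<Longrightarrow>
      \<phi> (tensor_pure R M (gr_free G R B \<delta>) x f) = smult M (f b) x"
proof -
  let ?P = "gr_free G R B \<delta>"
  have pM: "pre_module R M" and act: "\<And>a b x. a \<in> carrier R \<Longrightarrow> b \<in> carrier R \<Longrightarrow> x \<in> carrier M \<Longrightarrow>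
      smult M (a \<otimes>\<^bsub>R\<^esub> b) x = smult M b (smult M a x)" using M by (auto simp: right_action_def)
  have v: "f b \<in> carrier R" if "f \<in> carrier ?P" for f by (rule gr_free_value[OF R that])
  show ?thesis
  proof (rule tensor_universal[OF pM gr_free_pre_module[OF R]
        abelian_group_comm_group[OF pre_module_abelian_group[OF pM]], of G B \<delta> "\<lambda>x f. smult M (f b) x"])
    fix x f assume "x \<in> carrier M" "f \<in> carrier ?P"
    then show "smult M (f b) x \<in> carrier (add_monoid M)" using smult_closed[OF pM v] by simp
  next
    fix x x' f assume "x \<in> carrier M" "x' \<in> carrier M" "f \<in> carrier ?P"
    then show "smult M (f b) (x \<oplus>\<^bsub>M\<^esub> x') = smult M (f b) x \<otimes>\<^bsub>add_monoid M\<^esub> smult M (f b) x'"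
      using smult_add[OF pM v] by simp
  next
    fix x f f' assume "x \<in> carrier M" "f \<in> carrier ?P" "f' \<in> carrier ?P"
    then show "smult M ((f \<oplus>\<^bsub>?P\<^esub> f') b) x = smult M (f b) x \<otimes>\<^bsub>add_monoid M\<^esub> smult M (f' b) x"
      using smult_add_left[OF pM v v] by (simp add: gr_free_simps(4))
  next
    fix a x f assume "a \<in> carrier R" "x \<in> carrier M" "f \<in> carrier ?P"
    then show "smult M (f b) (smult M a x) = smult M (smult ?P a f b) x"
      using act v by (simp add: gr_free_simps(5))
  qed (rule that)
qed

lemma hom_finprod_comm_group:
  assumes G: "comm_group G" and H: "comm_group H" and h: "h \<in> hom G H" and f: "\<And>s. s \<in> S \<Longrightarrow> f s \<in> carrier G"
  shows "h (finprod G f S) = finprod H (\<lambda>s. h (f s)) S"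
proof -
  interpret G: comm_group G by fact
  interpret H: comm_group H by fact
  show ?thesis using f
  proof (induction S rule: infinite_finite_induct)
    case (insert s S)
    moreover have "f \<in> S \<rightarrow> carrier G" "(\<lambda>s. h (f s)) \<in> S \<rightarrow> carrier H" using insert.prems hom_in_carrier[OF h] by auto
    ultimately show ?case using hom_mult[OF h] hom_in_carrier[OF h] by simp
  qed (use hom_one[OF h G.is_group H.is_group] in auto)
qed

text \<open>
  Every element is a sum of terms \<open>w b \<otimes> e b\<close>: move the coefficients of \<open>f = \<Sum> f b \<cdot> e b\<close> to the left in
  \<open>x \<otimes> f\<close>.  The coefficients are required to vanish outside \<open>S\<close>, so that two expansions can be
  added over the union of their index sets.
\<close>

lemma tensor_free_expansion:
  assumes R: "ring R" and M: "pre_module R M" and z: "z \<in> carrier (tensor R M (gr_free G R B \<delta>))"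
  shows "\<exists>S w. finite S \<and> S \<subseteq> B \<and> (\<forall>b. w b \<in> carrier M) \<and> (\<forall>b. b \<notin> S \<longrightarrow> w b = \<zero>\<^bsub>M\<^esub>) \<and>
    z = finprod (tensor R M (gr_free G R B \<delta>)) (\<lambda>b. tensor_pure R M (gr_free G R B \<delta>) (w b) (gr_basis R b)) S"
  using M gr_free_pre_module[OF R] z
proof (induction rule: tensor_induct)
  let ?P = "gr_free G R B \<delta>"
  note P = gr_free_pre_module[OF R, of G B \<delta>]
  interpret M: abelian_group M by (rule pre_module_abelian_group[OF M])
  interpret T: comm_group "tensor R M ?P" by (rule comm_group_tensor[OF M P])
  have tc: "tensor_pure R M ?P x (gr_basis R b) \<in> carrier (tensor R M ?P)" if "x \<in> carrier M" "b \<in> B" for x b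
    by (rule tensor_pure_closed[OF that(1) gr_basis_closed[OF R that(2)]])
  {
    case one
    show ?case by (intro exI[of _ "{}"] exI[of _ "\<lambda>_. \<zero>\<^bsub>M\<^esub>"]) auto
  next
    case (pure x f)
    let ?S = "{b. f b \<noteq> \<zero>\<^bsub>R\<^esub>}"
    have S: "finite ?S" "?S \<subseteq> B" using pure(2) by (auto simp: gr_free_simps)
    have v: "f b \<in> carrier R" for b by (rule gr_free_value[OF R pure(2)])
    have e: "gr_basis R b \<in> carrier ?P" if "b \<in> ?S" for b by (rule gr_basis_closed[OF R subsetD[OF S(2) that]])
    have lin: "(\<lambda>y. tensor_pure R M ?P x y) \<in> hom (add_monoid ?P) (tensor R M ?P)"
      by (rule homI) (use tensor_pure_closed[OF pure(1)] tensor_pure_add_right[OF M P pure(1)] in auto)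
    have "tensor_pure R M ?P x f = tensor_pure R M ?P x (finsum ?P (\<lambda>b. smult ?P (f b) (gr_basis R b)) ?S)"
      by (simp only: gr_free_expansion[OF R pure(2)])
    also have "\<dots> = finprod (tensor R M ?P) (\<lambda>b. tensor_pure R M ?P x (smult ?P (f b) (gr_basis R b))) ?S"
      unfolding finsum_def
      by (rule hom_finprod_comm_group[OF abelian_group_comm_group[OF pre_module_abelian_group[OF P]] T.comm_group_axioms lin])
        (use smult_closed[OF P v e] in simp)
    also have "\<dots> = finprod (tensor R M ?P) (\<lambda>b. tensor_pure R M ?P (smult M (f b) x) (gr_basis R b)) ?S"
    proof (rule T.finprod_cong')
      show "(\<lambda>b. tensor_pure R M ?P (smult M (f b) x) (gr_basis R b)) \<in> ?S \<rightarrow> carrier (tensor R M ?P)"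
        using tc[OF smult_closed[OF M v pure(1)]] S(2) by auto
      show "tensor_pure R M ?P x (smult ?P (f b) (gr_basis R b)) = tensor_pure R M ?P (smult M (f b) x) (gr_basis R b)"
        if "b \<in> ?S" for b by (rule tensor_pure_smult[OF M P pure(1) e[OF that] v, symmetric])
    qed simp
    finally show ?case
      using S smult_closed[OF M v pure(1)] smult_zero_left[OF R M pure(1)]
      by (intro exI[of _ ?S] exI[of _ "\<lambda>b. smult M (f b) x"]) auto
  next
    case (mult z z')
    obtain S w where S: "finite S" "S \<subseteq> B" and w: "\<And>b. w b \<in> carrier M" "\<And>b. b \<notin> S \<Longrightarrow> w b = \<zero>\<^bsub>M\<^esub>"
      and z: "z = finprod (tensor R M ?P) (\<lambda>b. tensor_pure R M ?P (w b) (gr_basis R b)) S" using mult(3) by blast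
    obtain S' w' where S': "finite S'" "S' \<subseteq> B" and w': "\<And>b. w' b \<in> carrier M" "\<And>b. b \<notin> S' \<Longrightarrow> w' b = \<zero>\<^bsub>M\<^esub>"
      and z': "z' = finprod (tensor R M ?P) (\<lambda>b. tensor_pure R M ?P (w' b) (gr_basis R b)) S'" using mult(4) by blast
    let ?U = "S \<union> S'"
    have U: "finite ?U" "?U \<subseteq> B" using S S' by auto
    have ext: "finprod (tensor R M ?P) (\<lambda>b. tensor_pure R M ?P (u b) (gr_basis R b)) V
      = finprod (tensor R M ?P) (\<lambda>b. tensor_pure R M ?P (u b) (gr_basis R b)) ?U"
      if V: "V \<subseteq> ?U" and u: "\<And>b. u b \<in> carrier M" "\<And>b. b \<notin> V \<Longrightarrow> u b = \<zero>\<^bsub>M\<^esub>" for u V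
    proof (rule T.finprod_mono_neutral_cong_left[OF U(1) V])
      show "(\<lambda>b. tensor_pure R M ?P (u b) (gr_basis R b)) \<in> ?U \<rightarrow> carrier (tensor R M ?P)" using tc[OF u(1)] U(2) by auto
      show "tensor_pure R M ?P (u b) (gr_basis R b) = \<one>\<^bsub>tensor R M ?P\<^esub>" if "b \<in> ?U - V" for b
        using u(2)[of b] that tensor_pure_zero_left[OF M P gr_basis_closed[OF R, of b B G \<delta>]] U(2) by auto
    qed simp
    have zU: "z = finprod (tensor R M ?P) (\<lambda>b. tensor_pure R M ?P (w b) (gr_basis R b)) ?U"
      unfolding z by (rule ext[OF Un_upper1 w])
    have zU': "z' = finprod (tensor R M ?P) (\<lambda>b. tensor_pure R M ?P (w' b) (gr_basis R b)) ?U"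
      unfolding z' by (rule ext[OF Un_upper2 w'])
    have "z \<otimes>\<^bsub>tensor R M ?P\<^esub> z' = finprod (tensor R M ?P) (\<lambda>b. tensor_pure R M ?P (w b) (gr_basis R b)
        \<otimes>\<^bsub>tensor R M ?P\<^esub> tensor_pure R M ?P (w' b) (gr_basis R b)) ?U"
      unfolding zU zU'
      by (rule T.finprod_multf[symmetric]) (use tc[OF w(1)] tc[OF w'(1)] U(2) in auto)
    also have "\<dots> = finprod (tensor R M ?P) (\<lambda>b. tensor_pure R M ?P (w b \<oplus>\<^bsub>M\<^esub> w' b) (gr_basis R b)) ?U"
    proof (rule T.finprod_cong')
      show "(\<lambda>b. tensor_pure R M ?P (w b \<oplus>\<^bsub>M\<^esub> w' b) (gr_basis R b)) \<in> ?U \<rightarrow> carrier (tensor R M ?P)"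
        using tc[OF M.a_closed[OF w(1) w'(1)]] U(2) by auto
      show "tensor_pure R M ?P (w b) (gr_basis R b) \<otimes>\<^bsub>tensor R M ?P\<^esub> tensor_pure R M ?P (w' b) (gr_basis R b)
          = tensor_pure R M ?P (w b \<oplus>\<^bsub>M\<^esub> w' b) (gr_basis R b)" if "b \<in> ?U" for b
        using tensor_pure_add_left[OF M P w(1) w'(1) gr_basis_closed[OF R subsetD[OF U(2) that]]] by simp
    qed simp
    finally show ?case using U w w' by (intro exI[of _ ?U] exI[of _ "\<lambda>b. w b \<oplus>\<^bsub>M\<^esub> w' b"]) auto
  }
qed

lemma tensor_free_coordinate:
  assumes R: "ring R" and M: "right_action R M" and S: "finite S" "S \<subseteq> B" and w: "\<And>b. b \<in> S \<Longrightarrow> w b \<in> carrier M"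
    and \<phi>: "\<phi> \<in> hom (tensor R M (gr_free G R B \<delta>)) (add_monoid M)"
    "\<And>x f. x \<in> carrier M \<Longrightarrow> f \<in> carrier (gr_free G R B \<delta>) \<Longrightarrow>
      \<phi> (tensor_pure R M (gr_free G R B \<delta>) x f) = smult M (f c) x" and c: "c \<in> S"
  shows "\<phi> (finprod (tensor R M (gr_free G R B \<delta>)) (\<lambda>b. tensor_pure R M (gr_free G R B \<delta>) (w b) (gr_basis R b)) S) = w c"
proof -
  let ?P = "gr_free G R B \<delta>"
  interpret R: ring R by fact
  note P = gr_free_pre_module[OF R, of G B \<delta>]
  have pM: "pre_module R M" using M by (simp add: right_action_def)
  interpret M: abelian_group M by (rule pre_module_abelian_group[OF pM])
  have e: "gr_basis R b \<in> carrier ?P" if "b \<in> S" for b by (rule gr_basis_closed[OF R subsetD[OF S(2) that]])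
  have "\<phi> (finprod (tensor R M ?P) (\<lambda>b. tensor_pure R M ?P (w b) (gr_basis R b)) S)
      = finsum M (\<lambda>b. \<phi> (tensor_pure R M ?P (w b) (gr_basis R b))) S"
    unfolding finsum_def
    by (rule hom_finprod_comm_group[OF comm_group_tensor[OF pM P] M.a_comm_group \<phi>(1) tensor_pure_closed[OF w e]])
  also have "\<dots> = finsum M (\<lambda>b. if c = b then w b else \<zero>\<^bsub>M\<^esub>) S"
  proof (rule M.finsum_cong')
    show "\<phi> (tensor_pure R M ?P (w b) (gr_basis R b)) = (if c = b then w b else \<zero>\<^bsub>M\<^esub>)" if "b \<in> S" for b
      using \<phi>(2)[OF w[OF that] e[OF that]] smult_one[OF pM w[OF that]] smult_zero_left[OF R pM w[OF that]]
      by (simp add: gr_basis_def)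
  qed (use w in auto)
  also have "\<dots> = w c" using M.finsum_singleton[OF c S(1), of w] w by auto
  finally show ?thesis .
qed

lemma tensor_coordinate_natural:
  assumes R: "ring R" and M: "right_action R M" and N: "right_action R N" and f: "lin_map R M N f"
    and \<phi>: "\<phi> \<in> hom (tensor R M (gr_free G R B \<delta>)) (add_monoid M)"
    "\<And>x g. x \<in> carrier M \<Longrightarrow> g \<in> carrier (gr_free G R B \<delta>) \<Longrightarrow>
      \<phi> (tensor_pure R M (gr_free G R B \<delta>) x g) = smult M (g c) x"
    and \<psi>: "\<psi> \<in> hom (tensor R N (gr_free G R B \<delta>)) (add_monoid N)"
    "\<And>x g. x \<in> carrier N \<Longrightarrow> g \<in> carrier (gr_free G R B \<delta>) \<Longrightarrow>
      \<psi> (tensor_pure R N (gr_free G R B \<delta>) x g) = smult N (g c) x"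
    and z: "z \<in> carrier (tensor R M (gr_free G R B \<delta>))"
  shows "\<psi> (tensor_map R N (gr_free G R B \<delta>) f (\<lambda>y. y) z) = f (\<phi> z)"
proof -
  let ?P = "gr_free G R B \<delta>"
  note P = gr_free_pre_module[OF R, of G B \<delta>]
  have pM: "pre_module R M" and pN: "pre_module R N" using M N by (auto simp: right_action_def)
  interpret N: abelian_group N by (rule pre_module_abelian_group[OF pN])
  have l: "lin_map R ?P ?P (\<lambda>y. y)" by (auto simp: lin_map_def)
  have fh: "f \<in> hom (add_monoid M) (add_monoid N)" using f by (auto simp: hom_def lin_map_def)
  note th = tensor_map_hom[OF pM P pN P f l]
  have "(\<psi> \<circ> tensor_map R N ?P f (\<lambda>y. y)) z = (f \<circ> \<phi>) z"
  proof (rule tensor_hom_eqI[OF pM P N.a_group hom_compose[OF th \<psi>(1)] hom_compose[OF \<phi>(1) fh] _ z])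
    fix x g assume xg: "x \<in> carrier M" "g \<in> carrier ?P"
    show "(\<psi> \<circ> tensor_map R N ?P f (\<lambda>y. y)) (tensor_pure R M ?P x g) = (f \<circ> \<phi>) (tensor_pure R M ?P x g)"
      using \<phi>(2)[OF xg] \<psi>(2)[OF lin_map_closed[OF f xg(1)] xg(2)] tensor_map_pure[OF pM P pN P f l xg]
        lin_map_smult[OF f gr_free_value[OF R xg(2)] xg(1)] by simp
  qed
  then show ?thesis by simp
qed

text \<open>
  The coordinate functionals are natural and recover the coefficients of an expansion.  So if \<open>f\<close> kills an element,
  it kills each of its coefficients.
\<close>

lemma tensor_free_coefficients:
  assumes R: "ring R" and M: "right_action R M" and N: "right_action R N" and f: "lin_map R M N f"
    and S: "finite S" "S \<subseteq> B" and w: "\<And>b. w b \<in> carrier M"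
    and z: "z = finprod (tensor R M (gr_free G R B \<delta>)) (\<lambda>b. tensor_pure R M (gr_free G R B \<delta>) (w b) (gr_basis R b)) S"
    and fz: "tensor_map R N (gr_free G R B \<delta>) f (\<lambda>y. y) z = \<one>\<^bsub>tensor R N (gr_free G R B \<delta>)\<^esub>" and c: "c \<in> S"
  shows "f (w c) = \<zero>\<^bsub>N\<^esub>"
proof -
  let ?P = "gr_free G R B \<delta>"
  note P = gr_free_pre_module[OF R, of G B \<delta>]
  have pM: "pre_module R M" and pN: "pre_module R N" using M N by (auto simp: right_action_def)
  interpret N: abelian_group N by (rule pre_module_abelian_group[OF pN])
  interpret T: comm_group "tensor R M ?P" by (rule comm_group_tensor[OF pM P])
  interpret T': comm_group "tensor R N ?P" by (rule comm_group_tensor[OF pN P])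
  have zc: "z \<in> carrier (tensor R M ?P)"
    unfolding z by (rule T.finprod_closed, rule Pi_I, rule tensor_pure_closed[OF w gr_basis_closed[OF R]])
      (use S(2) in blast)
  obtain \<phi> where \<phi>: "\<phi> \<in> hom (tensor R M ?P) (add_monoid M)"
    "\<And>x f. x \<in> carrier M \<Longrightarrow> f \<in> carrier ?P \<Longrightarrow> \<phi> (tensor_pure R M ?P x f) = smult M (f c) x"
    by (rule tensor_coordinate[OF R M, where b = c and G = G and B = B and \<delta> = \<delta>]) (rule that)
  obtain \<psi> where \<psi>: "\<psi> \<in> hom (tensor R N ?P) (add_monoid N)"
    "\<And>x f. x \<in> carrier N \<Longrightarrow> f \<in> carrier ?P \<Longrightarrow> \<psi> (tensor_pure R N ?P x f) = smult N (f c) x"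
    by (rule tensor_coordinate[OF R N, where b = c and G = G and B = B and \<delta> = \<delta>]) (rule that)
  have "\<phi> z = w c" unfolding z by (rule tensor_free_coordinate[OF R M S w \<phi> c])
  then have "f (w c) = f (\<phi> z)" by simp
  also have "\<dots> = \<psi> \<one>\<^bsub>tensor R N ?P\<^esub>" using tensor_coordinate_natural[OF R M N f \<phi> \<psi> zc] fz by simp
  also have "\<dots> = \<zero>\<^bsub>N\<^esub>" using hom_one[OF \<psi>(1) T'.is_group N.a_group] by simp
  finally show ?thesis .
qed

text \<open>
  Free modules are flat: all coefficients of \<open>z\<close> vanish because \<open>f\<close> kills them.
\<close>

lemma tensor_free_inj:
  assumes R: "ring R" and M: "right_action R M" and N: "right_action R N"
    and f: "lin_map R M N f" "inj_on f (carrier M)"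
    and z: "z \<in> carrier (tensor R M (gr_free G R B \<delta>))"
    and fz: "tensor_map R N (gr_free G R B \<delta>) f (\<lambda>y. y) z = \<one>\<^bsub>tensor R N (gr_free G R B \<delta>)\<^esub>"
  shows "z = \<one>\<^bsub>tensor R M (gr_free G R B \<delta>)\<^esub>"
proof -
  let ?P = "gr_free G R B \<delta>"
  note P = gr_free_pre_module[OF R, of G B \<delta>]
  have pM: "pre_module R M" and pN: "pre_module R N" using M N by (auto simp: right_action_def)
  note aM = pre_module_abelian_group[OF pM] and aN = pre_module_abelian_group[OF pN]
  interpret T: comm_group "tensor R M ?P" by (rule comm_group_tensor[OF pM P])
  obtain S w where S: "finite S" "S \<subseteq> B" and w: "\<And>b. w b \<in> carrier M"
    and z: "z = finprod (tensor R M ?P) (\<lambda>b. tensor_pure R M ?P (w b) (gr_basis R b)) S"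
    using tensor_free_expansion[OF R pM z] by blast
  have "tensor_pure R M ?P (w b) (gr_basis R b) = \<one>\<^bsub>tensor R M ?P\<^esub>" if "b \<in> S" for b
  proof -
    have "f (w b) = f \<zero>\<^bsub>M\<^esub>"
      using tensor_free_coefficients[OF R M N f(1) S w z fz that] lin_map_zero[OF aM aN f(1)] by simp
    then have "w b = \<zero>\<^bsub>M\<^esub>" using inj_onD[OF f(2) _ w abelian_groupE(2)[OF aM]] by blast
    then show ?thesis using tensor_pure_zero_left[OF pM P gr_basis_closed[OF R subsetD[OF S(2) that]]] by simp
  qed
  then show ?thesis unfolding z by (rule T.finprod_one_eqI)
qed

text \<open>
  The coefficients of \<open>z\<close> lie in the kernel of \<open>\<pi>\<close>, so they can be lifted one by one.
\<close>

lemma tensor_free_exact: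
  assumes R: "ring R" and L: "right_action R L" and M: "right_action R M" and N: "right_action R N"
    and \<iota>: "lin_map R L M \<iota>" and \<pi>: "lin_map R M N \<pi>" and ex: "a_kernel M N \<pi> \<subseteq> \<iota> ` carrier L"
    and z: "z \<in> carrier (tensor R M (gr_free G R B \<delta>))"
    and \<pi>z: "tensor_map R N (gr_free G R B \<delta>) \<pi> (\<lambda>y. y) z = \<one>\<^bsub>tensor R N (gr_free G R B \<delta>)\<^esub>"
  shows "\<exists>u\<in>carrier (tensor R L (gr_free G R B \<delta>)). tensor_map R M (gr_free G R B \<delta>) \<iota> (\<lambda>y. y) u = z"
proof -
  let ?P = "gr_free G R B \<delta>"
  note P = gr_free_pre_module[OF R, of G B \<delta>]
  have pL: "pre_module R L" and pM: "pre_module R M" using L M by (auto simp: right_action_def)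
  interpret TL: comm_group "tensor R L ?P" by (rule comm_group_tensor[OF pL P])
  interpret TM: comm_group "tensor R M ?P" by (rule comm_group_tensor[OF pM P])
  have l: "lin_map R ?P ?P (\<lambda>y. y)" by (auto simp: lin_map_def)
  obtain S w where S: "finite S" "S \<subseteq> B" and w: "\<And>b. w b \<in> carrier M"
    and z: "z = finprod (tensor R M ?P) (\<lambda>b. tensor_pure R M ?P (w b) (gr_basis R b)) S"
    using tensor_free_expansion[OF R pM z] by blast
  have e: "gr_basis R b \<in> carrier ?P" if "b \<in> S" for b by (rule gr_basis_closed[OF R subsetD[OF S(2) that]])
  have "\<forall>b\<in>S. \<exists>u\<in>carrier L. \<iota> u = w b"
  proof
    fix b assume b: "b \<in> S"
    have "w b \<in> a_kernel M N \<pi>" using tensor_free_coefficients[OF R M N \<pi> S w z \<pi>z b] w by (simp add: a_kernel_iff)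
    then show "\<exists>u\<in>carrier L. \<iota> u = w b" using ex by (metis imageE subsetD)
  qed
  then obtain u where u: "\<And>b. b \<in> S \<Longrightarrow> u b \<in> carrier L" "\<And>b. b \<in> S \<Longrightarrow> \<iota> (u b) = w b" by metis
  let ?u = "finprod (tensor R L ?P) (\<lambda>b. tensor_pure R L ?P (u b) (gr_basis R b)) S"
  have uc: "tensor_pure R L ?P (u b) (gr_basis R b) \<in> carrier (tensor R L ?P)" if "b \<in> S" for b
    by (rule tensor_pure_closed[OF u(1)[OF that] e[OF that]])
  have "tensor_map R M ?P \<iota> (\<lambda>y. y) ?u
      = finprod (tensor R M ?P) (\<lambda>b. tensor_map R M ?P \<iota> (\<lambda>y. y) (tensor_pure R L ?P (u b) (gr_basis R b))) S"
    by (rule hom_finprod_comm_group[OF TL.comm_group_axioms TM.comm_group_axioms tensor_map_hom[OF pL P pM P \<iota> l] uc])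
  also have "\<dots> = z" unfolding z
  proof (rule TM.finprod_cong')
    show "(\<lambda>b. tensor_pure R M ?P (w b) (gr_basis R b)) \<in> S \<rightarrow> carrier (tensor R M ?P)"
      using tensor_pure_closed[OF w e] by auto
    show "tensor_map R M ?P \<iota> (\<lambda>y. y) (tensor_pure R L ?P (u b) (gr_basis R b)) = tensor_pure R M ?P (w b) (gr_basis R b)"
      if "b \<in> S" for b
      using tensor_map_pure[OF pL P pM P \<iota> l u(1)[OF that] e[OF that]] u(2)[OF that] by simp
  qed simp
  finally show ?thesis using TL.finprod_closed[of "\<lambda>b. tensor_pure R L ?P (u b) (gr_basis R b)" S] uc by blast
qed

section \<open>The derived functors of the tensor product\<close>

lemma tensor_map_zero_left:
  assumes M: "pre_module R M" and N: "pre_module R N" and M': "pre_module R M'" and N': "pre_module R N'"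
    and g: "lin_map R N N' g" and z: "z \<in> carrier (tensor R M N)"
  shows "tensor_map R M' N' (\<lambda>x. \<zero>\<^bsub>M'\<^esub>) g z = \<one>\<^bsub>tensor R M' N'\<^esub>"
proof -
  interpret T': comm_group "tensor R M' N'" by (rule comm_group_tensor[OF M' N'])
  have "(\<lambda>z. \<one>\<^bsub>tensor R M' N'\<^esub>) \<in> hom (tensor R M N) (tensor R M' N')" by (auto simp: hom_def)
  then show ?thesis
    by (rule tensor_hom_eqI[OF M N T'.is_group tensor_map_hom[OF M N M' N' lin_map_zero_map[OF M'] g] _ _ z])
      (simp add: tensor_map_pure[OF M N M' N' lin_map_zero_map[OF M'] g] tensor_pure_zero_left[OF M' N'] lin_map_closed[OF g])
qed

text \<open>
  Vanishing of the homology of \<open>N \<otimes> P\<close> at \<open>P (Suc i)\<close>, indexed like \<open>ext_vanishes\<close>.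
\<close>

definition tor_vanishes ::
    "('g, 'r) gr_ring \<Rightarrow> (nat \<Rightarrow> ('g, 'r, 'm) gr_module) \<Rightarrow> (nat \<Rightarrow> 'm \<Rightarrow> 'm)
      \<Rightarrow> nat \<Rightarrow> ('g, 'r, 'k) gr_module \<Rightarrow> bool" where
  "tor_vanishes R P d i N \<longleftrightarrow>
     (\<forall>z\<in>carrier (tensor R N (P (Suc i))). tensor_map R N (P i) (\<lambda>x. x) (d i) z = \<one>\<^bsub>tensor R N (P i)\<^esub> \<longrightarrow>
        (\<exists>w\<in>carrier (tensor R N (P (Suc (Suc i)))). z = tensor_map R N (P (Suc i)) (\<lambda>x. x) (d (Suc i)) w))"

lemma tor_vanishesE:
  assumes "tor_vanishes R P d i N" "z \<in> carrier (tensor R N (P (Suc i)))"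
    "tensor_map R N (P i) (\<lambda>x. x) (d i) z = \<one>\<^bsub>tensor R N (P i)\<^esub>"
  obtains w where "w \<in> carrier (tensor R N (P (Suc (Suc i))))" "z = tensor_map R N (P (Suc i)) (\<lambda>x. x) (d (Suc i)) w"
  using assms unfolding tor_vanishes_def by blast

lemma lin_map_ident: "lin_map R M M (\<lambda>x. x)"
  by (auto simp: lin_map_def)

text \<open>
  The homotopy equivalence of the resolutions survives tensoring, because tensoring is additive and
  functorial.  If \<open>z\<close> is a cycle, then \<open>f z = d' w\<close> for some \<open>w\<close>, and \<open>z = d (s z + g w)\<close>.
\<close>

lemma tor_vanishes_independent:
  assumes gr: "graded_ring G R" and M: "left_gr_module G R M"
    and P: "gr_free_resolution G R M P d \<epsilon>" and Q: "gr_free_resolution G R M Q d' \<epsilon>'"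
    and N: "pre_module R N" and van: "tor_vanishes R Q d' i N"
  shows "tor_vanishes R P d i N"
proof (rule comparison_of_resolutions[OF gr M P Q])
  have P': "gr_resolution G R M P d \<epsilon>" and Q': "gr_resolution G R M Q d' \<epsilon>'"
    using P Q by (auto simp: gr_free_resolution_def)
  note p = gr_resolutionD[OF P'] and q = gr_resolutionD[OF Q']
  have pP: "pre_module R (P i)" and pQ: "pre_module R (Q i)" for i
    using gr_premoduleD(1)[OF left_gr_module_premodule[OF p(1)]] gr_premoduleD(1)[OF left_gr_module_premodule[OF q(1)]] by auto
  fix f g s assume f: "\<And>i. gr_hom G R (P i) (Q i) (f i)" and g: "\<And>i. gr_hom G R (Q i) (P i) (g i)"
    and s: "\<And>i. gr_hom G R (P i) (P (Suc i)) (s i)"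
    and fd: "\<And>i x. x \<in> carrier (P (Suc i)) \<Longrightarrow> d' i (f (Suc i) x) = f i (d i x)"
    and gd: "\<And>i x. x \<in> carrier (Q (Suc i)) \<Longrightarrow> d i (g (Suc i) x) = g i (d' i x)"
    and h: "\<And>i x. x \<in> carrier (P (Suc i)) \<Longrightarrow>
       x = (d (Suc i) (s (Suc i) x) \<oplus>\<^bsub>P (Suc i)\<^esub> s i (d i x)) \<oplus>\<^bsub>P (Suc i)\<^esub> g (Suc i) (f (Suc i) x)"
  note fl = gr_hom_lin[OF f] and gl = gr_hom_lin[OF g] and sl = gr_hom_lin[OF s]
    and dl = gr_hom_lin[OF p(2)] and d'l = gr_hom_lin[OF q(2)]
  let ?id = "\<lambda>x. x"
  show ?thesis unfolding tor_vanishes_def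
  proof (intro ballI impI)
    fix z assume z: "z \<in> carrier (tensor R N (P (Suc i)))"
      and dz: "tensor_map R N (P i) ?id (d i) z = \<one>\<^bsub>tensor R N (P i)\<^esub>"
    interpret T: comm_group "tensor R N (P (Suc i))" by (rule comm_group_tensor[OF N pP])
    have grp: "group (tensor R N (P i))" "group (tensor R N (Q i))" for i
      using comm_group_tensor[OF N pP] comm_group_tensor[OF N pQ] comm_group.axioms(2) by blast+
    note hP = tensor_map_hom[OF N pP N pP lin_map_ident] and hPQ = tensor_map_hom[OF N pP N pQ lin_map_ident]
      and hQP = tensor_map_hom[OF N pQ N pP lin_map_ident]
    let ?fz = "tensor_map R N (Q (Suc i)) ?id (f (Suc i)) z"
    have fz: "?fz \<in> carrier (tensor R N (Q (Suc i)))" by (rule hom_in_carrier[OF hPQ[OF fl] z])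
    have "tensor_map R N (Q i) ?id (d' i) ?fz = tensor_map R N (Q i) ?id (\<lambda>x. d' i (f (Suc i) x)) z"
      by (rule tensor_map_comp[OF N pP N pQ N pQ lin_map_ident fl lin_map_ident d'l z])
    also have "\<dots> = tensor_map R N (Q i) ?id (\<lambda>x. f i (d i x)) z"
      by (rule tensor_map_cong[OF N pP N pQ lin_map_ident lin_map_comp[OF fl d'l] lin_map_ident lin_map_comp[OF dl fl] refl fd z])
    also have "\<dots> = tensor_map R N (Q i) ?id (f i) (tensor_map R N (P i) ?id (d i) z)"
      by (rule tensor_map_comp[OF N pP N pP N pQ lin_map_ident dl lin_map_ident fl z, symmetric])
    also have "\<dots> = \<one>\<^bsub>tensor R N (Q i)\<^esub>" unfolding dz by (rule hom_one[OF hPQ[OF fl] grp])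
    finally obtain w where w: "w \<in> carrier (tensor R N (Q (Suc (Suc i))))"
      "?fz = tensor_map R N (Q (Suc i)) ?id (d' (Suc i)) w"
      by (rule tor_vanishesE[OF van fz]) (rule that)
    let ?gw = "tensor_map R N (P (Suc (Suc i))) ?id (g (Suc (Suc i))) w"
    let ?sz = "tensor_map R N (P (Suc (Suc i))) ?id (s (Suc i)) z"
    have gw: "?gw \<in> carrier (tensor R N (P (Suc (Suc i))))" by (rule hom_in_carrier[OF hQP[OF gl] w(1)])
    have sz: "?sz \<in> carrier (tensor R N (P (Suc (Suc i))))" by (rule hom_in_carrier[OF hP[OF sl] z])
    have gfz: "tensor_map R N (P (Suc i)) ?id (\<lambda>x. g (Suc i) (f (Suc i) x)) z = tensor_map R N (P (Suc i)) ?id (d (Suc i)) ?gw"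
    proof -
      have "tensor_map R N (P (Suc i)) ?id (\<lambda>x. g (Suc i) (f (Suc i) x)) z = tensor_map R N (P (Suc i)) ?id (g (Suc i)) ?fz"
        by (rule tensor_map_comp[OF N pP N pQ N pP lin_map_ident fl lin_map_ident gl z, symmetric])
      also have "\<dots> = tensor_map R N (P (Suc i)) ?id (\<lambda>x. g (Suc i) (d' (Suc i) x)) w"
        unfolding w(2) by (rule tensor_map_comp[OF N pQ N pQ N pP lin_map_ident d'l lin_map_ident gl w(1)])
      also have "\<dots> = tensor_map R N (P (Suc i)) ?id (\<lambda>x. d (Suc i) (g (Suc (Suc i)) x)) w"
        by (rule tensor_map_cong[OF N pQ N pP lin_map_ident lin_map_comp[OF d'l gl] lin_map_ident lin_map_comp[OF gl dl] refl gd[symmetric] w(1)])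
      also have "\<dots> = tensor_map R N (P (Suc i)) ?id (d (Suc i)) ?gw"
        by (rule tensor_map_comp[OF N pQ N pP N pP lin_map_ident gl lin_map_ident dl w(1), symmetric])
      finally show ?thesis .
    qed
    have dsz: "tensor_map R N (P (Suc i)) ?id (\<lambda>x. d (Suc i) (s (Suc i) x)) z = tensor_map R N (P (Suc i)) ?id (d (Suc i)) ?sz"
      by (rule tensor_map_comp[OF N pP N pP N pP lin_map_ident sl lin_map_ident dl z, symmetric])
    have sdz: "tensor_map R N (P (Suc i)) ?id (\<lambda>x. s i (d i x)) z = \<one>\<^bsub>tensor R N (P (Suc i))\<^esub>"
    proof -
      have "tensor_map R N (P (Suc i)) ?id (\<lambda>x. s i (d i x)) z = tensor_map R N (P (Suc i)) ?id (s i) (tensor_map R N (P i) ?id (d i) z)"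
        by (rule tensor_map_comp[OF N pP N pP N pP lin_map_ident dl lin_map_ident sl z, symmetric])
      also have "\<dots> = \<one>\<^bsub>tensor R N (P (Suc i))\<^esub>" unfolding dz by (rule hom_one[OF hP[OF sl] grp(1) grp(1)])
      finally show ?thesis .
    qed
    note l1 = lin_map_comp[OF sl[of "Suc i"] dl] and l2 = lin_map_comp[OF dl sl] and l3 = lin_map_comp[OF fl gl]
    have "z = tensor_map R N (P (Suc i)) ?id ?id z" by (rule tensor_map_id[OF N pP z, symmetric])
    also have "\<dots> = tensor_map R N (P (Suc i)) ?id
        (\<lambda>x. (d (Suc i) (s (Suc i) x) \<oplus>\<^bsub>P (Suc i)\<^esub> s i (d i x)) \<oplus>\<^bsub>P (Suc i)\<^esub> g (Suc i) (f (Suc i) x)) z"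
      by (rule tensor_map_cong[OF N pP N pP lin_map_ident lin_map_ident lin_map_ident
            lin_map_add_maps[OF pP lin_map_add_maps[OF pP l1 l2] l3] refl h z])
    also have "\<dots> = tensor_map R N (P (Suc i)) ?id (\<lambda>x. d (Suc i) (s (Suc i) x) \<oplus>\<^bsub>P (Suc i)\<^esub> s i (d i x)) z
        \<otimes>\<^bsub>tensor R N (P (Suc i))\<^esub> tensor_map R N (P (Suc i)) ?id (\<lambda>x. g (Suc i) (f (Suc i) x)) z"
      by (rule tensor_map_add[OF N pP N pP lin_map_ident lin_map_add_maps[OF pP l1 l2] l3 z])
    also have "tensor_map R N (P (Suc i)) ?id (\<lambda>x. d (Suc i) (s (Suc i) x) \<oplus>\<^bsub>P (Suc i)\<^esub> s i (d i x)) z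
        = tensor_map R N (P (Suc i)) ?id (d (Suc i)) ?sz"
      using tensor_map_add[OF N pP N pP lin_map_ident l1 l2 z] sdz dsz hom_in_carrier[OF hP[OF dl] sz] by simp
    also have "\<dots> \<otimes>\<^bsub>tensor R N (P (Suc i))\<^esub> tensor_map R N (P (Suc i)) ?id (\<lambda>x. g (Suc i) (f (Suc i) x)) z
        = tensor_map R N (P (Suc i)) ?id (d (Suc i)) (?sz \<otimes>\<^bsub>tensor R N (P (Suc (Suc i)))\<^esub> ?gw)"
      unfolding gfz by (rule hom_mult[OF hP[OF dl] sz gw, symmetric])
    finally show "\<exists>w\<in>carrier (tensor R N (P (Suc (Suc i)))). z = tensor_map R N (P (Suc i)) ?id (d (Suc i)) w"
      using monoid.m_closed[OF group.is_monoid[OF grp(1)] sz gw] by blast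
  qed
qed

text \<open>
  Dimension shifting for \<open>0 \<rightarrow> N \<rightarrow> F \<rightarrow> C \<rightarrow> 0\<close>: the vanishing for \<open>N\<close> follows from the vanishing for \<open>F\<close> and, one
  degree higher, for \<open>C\<close>.  The diagram chase uses that \<open>0 \<rightarrow> N \<otimes> P \<rightarrow> F \<otimes> P \<rightarrow> C \<otimes> P \<rightarrow> 0\<close> is exact for free \<open>P\<close>.
\<close>

lemma tor_vanishes_submodule:
  assumes R: "ring R" and free: "\<And>i. \<exists>B \<delta>. \<delta> \<in> B \<rightarrow> carrier G \<and> P i = gr_free G R B \<delta>"
    and d: "\<And>i. lin_map R (P (Suc i)) (P i) (d i)"
    and dd: "\<And>i x. x \<in> carrier (P (Suc (Suc i))) \<Longrightarrow> d i (d (Suc i) x) = \<zero>\<^bsub>P i\<^esub>"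
    and N: "right_action R N" and F: "right_action R F" and C: "right_action R C"
    and \<iota>: "lin_map R N F \<iota>" "inj_on \<iota> (carrier N)" and \<pi>: "lin_map R F C \<pi>" "\<pi> ` carrier F = carrier C"
    and ex: "\<iota> ` carrier N = a_kernel F C \<pi>"
    and vC: "tor_vanishes R P d (Suc i) C" and vF: "tor_vanishes R P d i F"
  shows "tor_vanishes R P d i N"
  unfolding tor_vanishes_def
proof (intro ballI impI)
  have pN: "pre_module R N" and pF: "pre_module R F" and pC: "pre_module R C" using N F C by (auto simp: right_action_def)
  have pP: "pre_module R (P i)" for i using free[of i] gr_free_pre_module[OF R] by metis
  note id = lin_map_ident
  let ?id = "\<lambda>x. x"
  have grp: "comm_group (tensor R N (P i))" "comm_group (tensor R F (P i))" "comm_group (tensor R C (P i))" for i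
    using comm_group_tensor[OF pN pP] comm_group_tensor[OF pF pP] comm_group_tensor[OF pC pP] by blast+
  interpret TN: comm_group "tensor R N (P j)" for j by (rule grp)
  interpret TF: comm_group "tensor R F (P j)" for j by (rule grp)
  interpret TC: comm_group "tensor R C (P j)" for j by (rule grp)
  note h\<iota> = tensor_map_hom[OF pN pP pF pP \<iota>(1) id] and h\<pi> = tensor_map_hom[OF pF pP pC pP \<pi>(1) id]
    and hN = tensor_map_hom[OF pN pP pN pP id d] and hF = tensor_map_hom[OF pF pP pF pP id d]
  have com\<iota>: "tensor_map R F (P j) ?id (d j) (tensor_map R F (P (Suc j)) \<iota> ?id z) = tensor_map R F (P j) \<iota> ?id (tensor_map R N (P j) ?id (d j) z)"
    if "z \<in> carrier (tensor R N (P (Suc j)))" for j z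
    using tensor_map_comp[OF pN pP pF pP pF pP \<iota>(1) id id d that] tensor_map_comp[OF pN pP pN pP pF pP id d \<iota>(1) id that] by simp
  have com\<pi>: "tensor_map R C (P j) ?id (d j) (tensor_map R C (P (Suc j)) \<pi> ?id z) = tensor_map R C (P j) \<pi> ?id (tensor_map R F (P j) ?id (d j) z)"
    if "z \<in> carrier (tensor R F (P (Suc j)))" for j z
    using tensor_map_comp[OF pF pP pC pP pC pP \<pi>(1) id id d that] tensor_map_comp[OF pF pP pF pP pC pP id d \<pi>(1) id that] by simp
  have \<pi>\<iota>: "tensor_map R C (P j) \<pi> ?id (tensor_map R F (P j) \<iota> ?id z) = \<one>\<^bsub>tensor R C (P j)\<^esub>"
    if z: "z \<in> carrier (tensor R N (P j))" for j z
  proof -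
    have "tensor_map R C (P j) \<pi> ?id (tensor_map R F (P j) \<iota> ?id z) = tensor_map R C (P j) (\<lambda>x. \<pi> (\<iota> x)) ?id z"
      by (rule tensor_map_comp[OF pN pP pF pP pC pP \<iota>(1) id \<pi>(1) id z])
    also have "\<dots> = tensor_map R C (P j) (\<lambda>x. \<zero>\<^bsub>C\<^esub>) ?id z"
      by (rule tensor_map_cong[OF pN pP pC pP lin_map_comp[OF \<iota>(1) \<pi>(1)] id lin_map_zero_map[OF pC] id _ refl z])
        (use ex in \<open>auto simp: a_kernel_iff\<close>)
    also have "\<dots> = \<one>\<^bsub>tensor R C (P j)\<^esub>" by (rule tensor_map_zero_left[OF pN pP pC pP id z])
    finally show ?thesis .
  qed
  have ddF: "tensor_map R F (P j) ?id (d j) (tensor_map R F (P (Suc j)) ?id (d (Suc j)) v) = \<one>\<^bsub>tensor R F (P j)\<^esub>"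
    if v: "v \<in> carrier (tensor R F (P (Suc (Suc j))))" for j v
  proof -
    have "tensor_map R F (P j) ?id (d j) (tensor_map R F (P (Suc j)) ?id (d (Suc j)) v) = tensor_map R F (P j) ?id (\<lambda>x. d j (d (Suc j) x)) v"
      by (rule tensor_map_comp[OF pF pP pF pP pF pP id d id d v])
    also have "\<dots> = tensor_map R F (P j) ?id (\<lambda>x. \<zero>\<^bsub>P j\<^esub>) v"
      by (rule tensor_map_cong[OF pF pP pF pP id lin_map_comp[OF d d] id lin_map_zero_map[OF pP] refl dd v])
    also have "\<dots> = \<one>\<^bsub>tensor R F (P j)\<^esub>" by (rule tensor_map_zero[OF pF pP pF pP id v])
    finally show ?thesis .
  qed
  obtain B \<delta> where P'': "P (Suc i) = gr_free G R B \<delta>" using free by metis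
  obtain B' \<delta>' where P': "P (Suc (Suc i)) = gr_free G R B' \<delta>'" using free by metis
  fix z assume z: "z \<in> carrier (tensor R N (P (Suc i)))" and dz: "tensor_map R N (P i) ?id (d i) z = \<one>\<^bsub>tensor R N (P i)\<^esub>"
  let ?\<iota>z = "tensor_map R F (P (Suc i)) \<iota> ?id z"
  have \<iota>z: "?\<iota>z \<in> carrier (tensor R F (P (Suc i)))" by (rule hom_in_carrier[OF h\<iota> z])
  have "tensor_map R F (P i) ?id (d i) ?\<iota>z = \<one>\<^bsub>tensor R F (P i)\<^esub>"
    unfolding com\<iota>[OF z] dz by (rule hom_one[OF h\<iota> TN.is_group TF.is_group])
  then obtain w where w: "w \<in> carrier (tensor R F (P (Suc (Suc i))))" "?\<iota>z = tensor_map R F (P (Suc i)) ?id (d (Suc i)) w"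
    by (rule tor_vanishesE[OF vF \<iota>z]) (rule that)
  let ?\<pi>w = "tensor_map R C (P (Suc (Suc i))) \<pi> ?id w"
  have \<pi>w: "?\<pi>w \<in> carrier (tensor R C (P (Suc (Suc i))))" by (rule hom_in_carrier[OF h\<pi> w(1)])
  have "tensor_map R C (P (Suc i)) ?id (d (Suc i)) ?\<pi>w = \<one>\<^bsub>tensor R C (P (Suc i))\<^esub>"
    unfolding com\<pi>[OF w(1)] w(2)[symmetric] by (rule \<pi>\<iota>[OF z])
  then obtain v' where v': "v' \<in> carrier (tensor R C (P (Suc (Suc (Suc i)))))"
    "?\<pi>w = tensor_map R C (P (Suc (Suc i))) ?id (d (Suc (Suc i))) v'"
    by (rule tor_vanishesE[OF vC \<pi>w]) (rule that)
  obtain v where v: "v \<in> carrier (tensor R F (P (Suc (Suc (Suc i)))))" "tensor_map R C (P (Suc (Suc (Suc i)))) \<pi> ?id v = v'"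
    using tensor_map_surj[OF pF pP pC \<pi> v'(1)] by blast
  let ?dv = "tensor_map R F (P (Suc (Suc i))) ?id (d (Suc (Suc i))) v"
  let ?t = "w \<otimes>\<^bsub>tensor R F (P (Suc (Suc i)))\<^esub> inv\<^bsub>tensor R F (P (Suc (Suc i)))\<^esub> ?dv"
  have dv: "?dv \<in> carrier (tensor R F (P (Suc (Suc i))))" by (rule hom_in_carrier[OF hF v(1)])
  have t: "?t \<in> carrier (tensor R F (P (Suc (Suc i))))" using w(1) dv by simp
  have hinv: "\<phi> (a \<otimes>\<^bsub>A\<^esub> inv\<^bsub>A\<^esub> b) = \<phi> a \<otimes>\<^bsub>B\<^esub> inv\<^bsub>B\<^esub> \<phi> b"
    if "\<phi> \<in> hom A B" "group A" "group B" "a \<in> carrier A" "b \<in> carrier A"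
    for \<phi> and A :: "('x, 'y) monoid_scheme" and B :: "('u, 'v) monoid_scheme" and a b
  proof -
    interpret group_hom A B \<phi> using that by (simp add: group_hom_def group_hom_axioms_def)
    show ?thesis using that by simp
  qed
  have "tensor_map R C (P (Suc (Suc i))) \<pi> ?id ?t = \<one>\<^bsub>tensor R C (P (Suc (Suc i)))\<^esub>"
    unfolding hinv[OF h\<pi> TF.is_group TC.is_group w(1) dv] com\<pi>[OF v(1), symmetric] v(2) v'(2)[symmetric]
    using \<pi>w by simp
  then have "\<exists>u\<in>carrier (tensor R N (P (Suc (Suc i)))). tensor_map R F (P (Suc (Suc i))) \<iota> ?id u = ?t"
    using t unfolding P' by (intro tensor_free_exact[OF R N F C \<iota>(1) \<pi>(1) equalityD2[OF ex]])
  then obtain u where u: "u \<in> carrier (tensor R N (P (Suc (Suc i))))" "tensor_map R F (P (Suc (Suc i))) \<iota> ?id u = ?t"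
    by (rule bexE) (rule that)
  let ?du = "tensor_map R N (P (Suc i)) ?id (d (Suc i)) u"
  have du: "?du \<in> carrier (tensor R N (P (Suc i)))" by (rule hom_in_carrier[OF hN u(1)])
  have "tensor_map R F (P (Suc i)) \<iota> ?id ?du = tensor_map R F (P (Suc i)) ?id (d (Suc i)) ?t"
    using com\<iota>[OF u(1)] u(2) by simp
  also have "\<dots> = ?\<iota>z"
    unfolding hinv[OF hF TF.is_group TF.is_group w(1) dv] ddF[OF v(1)] w(2)[symmetric] using \<iota>z by simp
  finally have "tensor_map R F (P (Suc i)) \<iota> ?id (z \<otimes>\<^bsub>tensor R N (P (Suc i))\<^esub> inv\<^bsub>tensor R N (P (Suc i))\<^esub> ?du) = \<one>\<^bsub>tensor R F (P (Suc i))\<^esub>"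
    unfolding hinv[OF h\<iota> TN.is_group TF.is_group z du] using \<iota>z by simp
  then have "z \<otimes>\<^bsub>tensor R N (P (Suc i))\<^esub> inv\<^bsub>tensor R N (P (Suc i))\<^esub> ?du = \<one>\<^bsub>tensor R N (P (Suc i))\<^esub>"
    using TN.m_closed[OF z TN.inv_closed[OF du]] unfolding P'' by (intro tensor_free_inj[OF R N F \<iota>])
  then have "z = ?du" using TN.inv_solve_right'[OF TN.one_closed z du] du by simp
  then show "\<exists>w\<in>carrier (tensor R N (P (Suc (Suc i)))). z = tensor_map R N (P (Suc i)) ?id (d (Suc i)) w" using u(1) by blast
qed

lemma Tor_trivial_iff:
  assumes N: "pre_module R N" and ch: "chosen_resolution G R M = (P, d)"
    and P: "gr_resolution G R M P d \<epsilon>"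
  shows "trivial_group (Tor G R (Suc i) N M) \<longleftrightarrow> tor_vanishes R P d i N"
proof -
  note p = gr_resolutionD[OF P]
  have pP: "pre_module R (P i)" for i by (rule gr_premoduleD(1)[OF left_gr_module_premodule[OF p(1)]])
  note dl = gr_hom_lin[OF p(2)]
  let ?C = "\<lambda>j. tensor R N (P j)" and ?D = "\<lambda>j. tensor_map R N (P j) (\<lambda>x. x) (d j)"
  let ?Z = "kernel (?C (Suc i)) (?C i) (?D i)" and ?B = "?D (Suc i) ` carrier (?C (Suc (Suc i)))"
  have cg: "comm_group (?C j)" for j by (rule comm_group_tensor[OF N pP])
  have gh: "group_hom (?C (Suc j)) (?C j) (?D j)" for j
    unfolding group_hom_def group_hom_axioms_def
    using cg tensor_map_hom[OF N pP N pP lin_map_ident dl] comm_group.axioms(2) by blast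
  have Z: "subgroup ?Z (?C (Suc i))" by (rule group_hom.subgroup_kernel[OF gh])
  have B: "subgroup ?B (?C (Suc i))" by (rule group_hom.img_is_subgroup[OF gh])
  have "?B \<subseteq> ?Z"
  proof
    fix z assume "z \<in> ?B"
    then obtain w where w: "w \<in> carrier (?C (Suc (Suc i)))" "z = ?D (Suc i) w" by blast
    have "?D i z = tensor_map R N (P i) (\<lambda>x. x) (\<lambda>x. d i (d (Suc i) x)) w"
      unfolding w(2) by (rule tensor_map_comp[OF N pP N pP N pP lin_map_ident dl lin_map_ident dl w(1)])
    also have "\<dots> = tensor_map R N (P i) (\<lambda>x. x) (\<lambda>x. \<zero>\<^bsub>P i\<^esub>) w"
      by (rule tensor_map_cong[OF N pP N pP lin_map_ident lin_map_comp[OF dl dl] lin_map_ident lin_map_zero_map[OF pP] refl _ w(1)])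
        (rule gr_resolution_dd[OF P])
    also have "\<dots> = \<one>\<^bsub>?C i\<^esub>" by (rule tensor_map_zero[OF N pP N pP lin_map_ident w(1)])
    finally show "z \<in> ?Z" using \<open>z \<in> ?B\<close> subgroup.subset[OF B] by (auto simp: kernel_def)
  qed
  moreover have "Tor G R (Suc i) N M = (?C (Suc i))\<lparr>carrier := ?Z\<rparr> Mod ?B"
    unfolding Tor_def ch by simp
  ultimately have "trivial_group (Tor G R (Suc i) N M) \<longleftrightarrow> ?Z \<subseteq> ?B"
    using trivial_quotient_iff[OF cg Z B] by simp
  also have "\<dots> \<longleftrightarrow> tor_vanishes R P d i N"
    unfolding tor_vanishes_def kernel_def by blast
  finally show ?thesis .
qed

section \<open>Free resolutions over a coherent ring\<close>

lemma gr_hom_inverse: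
  assumes M: "gr_premodule G R M" and N: "gr_premodule G R N" and f: "gr_hom G R M N f"
    and bij: "bij_betw f (carrier M) (carrier N)"
  obtains g where "gr_hom G R N M g" "\<And>x. x \<in> carrier M \<Longrightarrow> g (f x) = x" "\<And>y. y \<in> carrier N \<Longrightarrow> f (g y) = y"
proof -
  let ?g = "inv_into (carrier M) f"
  note fl = gr_hom_lin[OF f]
  have gf: "?g (f x) = x" if "x \<in> carrier M" for x using bij_betw_inv_into_left[OF bij that] .
  have fg: "f (?g y) = y" and gc: "?g y \<in> carrier M" if "y \<in> carrier N" for y
    using bij_betw_inv_into_right[OF bij that] bij_betwE[OF bij_betw_inv_into[OF bij]] that by auto
  have eq: "?g y = x" if "x \<in> carrier M" "y = f x" for x y using gf that by simp
  have "lin_map R N M ?g"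
  proof (rule lin_mapI)
    fix y z assume yz: "y \<in> carrier N" "z \<in> carrier N"
    show "?g (y \<oplus>\<^bsub>N\<^esub> z) = ?g y \<oplus>\<^bsub>M\<^esub> ?g z"
      by (rule eq[OF pre_module_add_closed[OF gr_premoduleD(1)[OF M] gc[OF yz(1)] gc[OF yz(2)]]])
        (simp add: lin_map_add[OF fl] gc fg yz)
  next
    fix a y assume ay: "a \<in> carrier R" "y \<in> carrier N"
    show "?g (smult N a y) = smult M a (?g y)"
      by (rule eq[OF smult_closed[OF gr_premoduleD(1)[OF M] ay(1) gc[OF ay(2)]]])
        (simp add: lin_map_smult[OF fl] gc fg ay)
  qed (rule gc)
  moreover have "?g y \<in> mgrade M \<sigma>" if \<sigma>: "\<sigma> \<in> carrier G" and y: "y \<in> mgrade N \<sigma>" for \<sigma> y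
  proof -
    have yc: "y \<in> carrier N" by (rule graded_by_closed[OF gr_premoduleD(3)[OF N] \<sigma> y])
    then have "y \<in> f ` carrier M" using bij by (simp add: bij_betw_def)
    then obtain x where x: "x \<in> mgrade M \<sigma>" "f x = y" using homogeneous_preimage[OF M N f \<sigma> _ y] by blast
    then show ?thesis using gf[OF graded_by_closed[OF gr_premoduleD(3)[OF M] \<sigma> x(1)]] by simp
  qed
  ultimately have "gr_hom G R N M ?g" by (auto simp: gr_hom_def)
  then show ?thesis using that gf fg by blast
qed

text \<open>
  An infinite supply of distinct labels, needed to place finitely generated free modules, whose basis
  is indexed by an initial segment of the natural numbers, in the type of \<open>chosen_resolution\<close>.
\<close>

primrec syz_label :: "nat \<Rightarrow> ('m, 'r) syz" where
  "syz_label 0 = Comb []"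
| "syz_label (Suc k) = Comb [(syz_label k, undefined)]"

lemma syz_label_eq_iff: "syz_label j = syz_label k \<longleftrightarrow> j = k"
proof (induction j arbitrary: k)
  case 0
  then show ?case by (cases k) auto
next
  case (Suc j)
  then show ?case by (cases k) auto
qed

lemma gr_free_relabel:
  assumes gr: "graded_ring G R" and t: "inj_on t A" and \<delta>: "\<delta> \<in> A \<rightarrow> carrier G"
  obtains \<delta>' f g where "\<delta>' \<in> t ` A \<rightarrow> carrier G"
    "gr_hom G R (gr_free G R A \<delta>) (gr_free G R (t ` A) \<delta>') f" "gr_hom G R (gr_free G R (t ` A) \<delta>') (gr_free G R A \<delta>) g"
    "\<And>x. x \<in> carrier (gr_free G R A \<delta>) \<Longrightarrow> g (f x) = x"
    "\<And>y. y \<in> carrier (gr_free G R (t ` A) \<delta>') \<Longrightarrow> f (g y) = y"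
proof -
  interpret R: ring R using gr by (simp add: graded_ring_def)
  let ?u = "inv_into A t"
  let ?F = "gr_free G R A \<delta>" and ?F' = "gr_free G R (t ` A) (\<lambda>s. \<delta> (?u s))"
  let ?f = "\<lambda>x s. if s \<in> t ` A then x (?u s) else \<zero>\<^bsub>R\<^esub>" and ?g = "\<lambda>y a. if a \<in> A then y (t a) else \<zero>\<^bsub>R\<^esub>"
  have ut: "?u (t a) = a" if "a \<in> A" for a using t that by simp
  have fc: "?f x \<in> carrier ?F'" if x: "x \<in> carrier ?F" for x
    by (rule gr_free_carrierI[of _ _ _ "t ` {a. x a \<noteq> \<zero>\<^bsub>R\<^esub>}"]) (use x ut in \<open>auto simp: gr_free_simps(1)\<close>)
  have gc: "?g y \<in> carrier ?F" if y: "y \<in> carrier ?F'" for y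
  proof (rule gr_free_carrierI[of _ _ _ "{a\<in>A. y (t a) \<noteq> \<zero>\<^bsub>R\<^esub>}"])
    have "finite (t ` {a\<in>A. y (t a) \<noteq> \<zero>\<^bsub>R\<^esub>})"
      by (rule finite_subset[of _ "{s. y s \<noteq> \<zero>\<^bsub>R\<^esub>}"]) (use y in \<open>auto simp: gr_free_simps(1)\<close>)
    then show "finite {a\<in>A. y (t a) \<noteq> \<zero>\<^bsub>R\<^esub>}"
      by (rule finite_imageD) (rule inj_on_subset[OF t], blast)
  qed (use y in \<open>auto simp: gr_free_simps(1)\<close>)
  have "(\<lambda>s. \<delta> (?u s)) \<in> t ` A \<rightarrow> carrier G" using \<delta> ut by auto
  moreover have "gr_hom G R ?F ?F' ?f"
    unfolding gr_hom_def
  proof (intro conjI ballI lin_mapI)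
    show "?f ` mgrade ?F \<sigma> \<subseteq> mgrade ?F' \<sigma>" for \<sigma>
      using fc ut by (auto simp: gr_free_simps(2))
  qed (use fc in \<open>auto simp: gr_free_simps(4,5) fun_eq_iff\<close>)
  moreover have "gr_hom G R ?F' ?F ?g"
    unfolding gr_hom_def
  proof (intro conjI ballI lin_mapI)
    show "?g ` mgrade ?F' \<sigma> \<subseteq> mgrade ?F \<sigma>" for \<sigma>
    proof
      fix x assume "x \<in> ?g ` mgrade ?F' \<sigma>"
      then obtain y where y: "y \<in> mgrade ?F' \<sigma>" "x = ?g y" by blast
      have "?g y a \<in> rgrade R (\<sigma> \<otimes>\<^bsub>G\<^esub> \<delta> a)" if "a \<in> A" for a
        using y(1) ut[OF that] that unfolding gr_free_simps(2) by auto
      then show "x \<in> mgrade ?F \<sigma>" using gc y unfolding gr_free_simps(2) by auto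
    qed
  qed (use gc in \<open>auto simp: gr_free_simps(4,5) fun_eq_iff\<close>)
  moreover have "?g (?f x) = x" if "x \<in> carrier ?F" for x
    using that ut by (auto simp: fun_eq_iff gr_free_simps(1))
  moreover have "?f (?g y) = y" if "y \<in> carrier ?F'" for y
    using that ut by (auto simp: fun_eq_iff gr_free_simps(1))
  ultimately show ?thesis by (rule that)
qed

text \<open>
  Together with \<open>coherent_resolution\<close> this provides a free resolution in the type required by
  \<open>chosen_resolution\<close>, with finitely many labels in each degree.
\<close>

lemma fg_gr_free_copy:
  fixes F :: "('g, 'r, 'm) gr_module"
  assumes gr: "graded_ring G R" and F: "fg_gr_free G R F"
  obtains P :: "('g, 'r, ('k, 'r) univ) gr_module" and f g where "\<exists>B \<delta>. \<delta> \<in> B \<rightarrow> carrier G \<and> P = gr_free G R B \<delta>"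
    "gr_hom G R F P f" "gr_hom G R P F g" "\<And>x. x \<in> carrier F \<Longrightarrow> g (f x) = x" "\<And>y. y \<in> carrier P \<Longrightarrow> f (g y) = y"
proof -
  obtain k and \<delta> :: "nat \<Rightarrow> 'g" and h where \<delta>: "\<delta> \<in> {..<k} \<rightarrow> carrier G" and lF: "left_gr_module G R F"
    and h: "gr_hom G R F (gr_free G R {..<k} \<delta>) h" "bij_betw h (carrier F) (carrier (gr_free G R {..<k} \<delta>))"
    using F by (auto simp: fg_gr_free_def gr_isomorphic_def)
  let ?E = "gr_free G R {..<k} \<delta>"
  have lE: "left_gr_module G R ?E" by (rule gr_free_left_gr_module[OF gr \<delta>])
  obtain h' where h': "gr_hom G R ?E F h'" "\<And>x. x \<in> carrier F \<Longrightarrow> h' (h x) = x" "\<And>y. y \<in> carrier ?E \<Longrightarrow> h (h' y) = y"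
    by (rule gr_hom_inverse[OF left_gr_module_premodule[OF lF] left_gr_module_premodule[OF lE] h]) (rule that)
  have "inj_on (syz_label :: nat \<Rightarrow> ('k, 'r) syz) {..<k}" by (auto intro: inj_onI simp: syz_label_eq_iff)
  then obtain \<delta>' and f g where \<delta>': "\<delta>' \<in> (syz_label :: nat \<Rightarrow> ('k, 'r) syz) ` {..<k} \<rightarrow> carrier G"
    and f: "gr_hom G R ?E (gr_free G R (syz_label ` {..<k}) \<delta>') f" and g: "gr_hom G R (gr_free G R (syz_label ` {..<k}) \<delta>') ?E g"
    and gf: "\<And>x. x \<in> carrier ?E \<Longrightarrow> g (f x) = x" and fg: "\<And>y. y \<in> carrier (gr_free G R (syz_label ` {..<k}) \<delta>') \<Longrightarrow> f (g y) = y"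
    by (rule gr_free_relabel[OF gr _ \<delta>]) (rule that)
  show ?thesis
  proof (rule that[OF _ gr_hom_comp[OF h(1) f] gr_hom_comp[OF g h'(1)]])
    show "\<exists>B \<delta>. \<delta> \<in> B \<rightarrow> carrier G \<and> gr_free G R (syz_label ` {..<k}) \<delta>' = gr_free G R B \<delta>" using \<delta>' by blast
    show "h' (g (f (h x))) = x" if "x \<in> carrier F" for x
      using gf[OF lin_map_closed[OF gr_hom_lin[OF h(1)] that]] h'(2)[OF that] by simp
    show "f (h (h' (g y))) = y" if "y \<in> carrier (gr_free G R (syz_label ` {..<k}) \<delta>')" for y
      using h'(3)[OF lin_map_closed[OF gr_hom_lin[OF g] that]] fg[OF that] by simp
  qed
qed

lemma gr_hom_to_kernel:
  assumes "gr_hom G R M N f" "f ` carrier M \<subseteq> a_kernel N L g" "gr_premodule G R M"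
  shows "gr_hom G R M (gr_kernel N L g) f"
  using assms graded_by_closed[OF gr_premoduleD(3)[OF assms(3)]] unfolding gr_hom_def lin_map_def by auto

lemma gr_hom_from_kernel:
  assumes "gr_hom G R M (gr_kernel N L g) f"
  shows "gr_hom G R M N f"
  using assms unfolding gr_hom_def lin_map_def by (auto simp: a_kernel_iff Pi_iff)

text \<open>
  Coherence makes the class of \<open>n\<close>-presented modules closed under syzygies: the additional term
  of the longer presentation of \<open>U\<close> is the last term of the presentation of its syzygy.
\<close>

lemma coherent_syzygy:
  assumes gr: "graded_ring G R" and coh: "left_gr_coherent G R n" and U: "gr_presented G R n U"
  shows "\<exists>F e. fg_gr_free G R F \<and> gr_hom G R F U e \<and> e ` carrier F = carrier U \<and> gr_presented G R n (gr_kernel F U e)"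
proof -
  obtain X d where X: "gr_presentation G R (Suc n) X d" "X 0 = U"
    using coh U unfolding left_gr_coherent_def gr_presented_def by blast
  have lU: "left_gr_module G R U" and free: "\<And>i. i \<le> Suc n \<Longrightarrow> fg_gr_free G R (X (Suc i))"
    and hom: "\<And>i. i \<le> Suc n \<Longrightarrow> gr_hom G R (X (Suc i)) (X i) (d i)"
    and sur: "d 0 ` carrier (X (Suc 0)) = carrier U"
    and ex: "\<And>i. i < Suc n \<Longrightarrow> d (Suc i) ` carrier (X (Suc (Suc i))) = a_kernel (X (Suc i)) (X i) (d i)"
    using X by (auto simp: gr_presentation_def)
  have l: "left_gr_module G R (X (Suc i))" if "i \<le> Suc n" for i using free[OF that] by (simp add: fg_gr_free_def)
  let ?K = "gr_kernel (X (Suc 0)) U (d 0)"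
  let ?X = "\<lambda>j. if j = 0 then ?K else X (Suc j)"
  have e0: "gr_hom G R (X (Suc 0)) U (d 0)" using hom[of 0] X(2) by simp
  have ex0: "d (Suc 0) ` carrier (X (Suc (Suc 0))) = a_kernel (X (Suc 0)) U (d 0)" using ex[of 0] X(2) by simp
  have "gr_presentation G R n ?X (\<lambda>i. d (Suc i))"
    unfolding gr_presentation_def
  proof (intro conjI allI impI)
    show "left_gr_module G R (?X 0)" using gr_kernel_left[OF gr l[of 0] lU e0] by simp
    show "fg_gr_free G R (?X (Suc i))" if "i \<le> n" for i using free[of "Suc i"] that by simp
    show "gr_hom G R (?X (Suc i)) (?X i) (d (Suc i))" if "i \<le> n" for i
    proof (cases i)
      case 0
      then show ?thesis
        using gr_hom_to_kernel[OF hom[of "Suc 0"] equalityD1[OF ex0] left_gr_module_premodule[OF l]] that by simp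
    next
      case (Suc j)
      then show ?thesis using hom[of "Suc i"] that by simp
    qed
    show "d (Suc 0) ` carrier (?X 1) = carrier (?X 0)" using ex0 by simp
    show "d (Suc (Suc i)) ` carrier (?X (Suc (Suc i))) = a_kernel (?X (Suc i)) (?X i) (d (Suc i))" if "i < n" for i
      using ex[of "Suc i"] that by (cases i) (auto simp: a_kernel_def')
  qed
  then have "gr_presented G R n ?K" unfolding gr_presented_def by (intro exI[of _ ?X] exI) auto
  then show ?thesis using free[of 0] e0 sur by blast
qed

text \<open>
  The syzygies \<open>V j\<close> of \<open>U\<close> are obtained by iterating \<open>coherent_syzygy\<close>, and the free modules covering them form one
  resolution \<open>P\<close> of \<open>U\<close> whose tails resolve the \<open>V j\<close>.  Each \<open>V j\<close> starts a presentation of length \<open>Suc m\<close>, and the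
  module \<open>K\<^sub>m\<close> of that presentation is \<open>V (j + m)\<close>.  Presentations starting at \<open>V (Suc j)\<close> are used, because for \<open>m = 0\<close> the
  special module is an image inside the presented module itself: \<open>V (Suc j)\<close> is a kernel and
  so equal to that image, whereas the grading of \<open>V 0 = U\<close> is arbitrary at degrees outside \<open>G\<close>.
\<close>

lemma coherent_resolution:
  fixes U :: "('g, 'r, 'r fin_univ) gr_module"
  assumes gr: "graded_ring G R" and coh: "left_gr_coherent G R (Suc m)" and U: "gr_presented G R (Suc m) U"
  obtains V and P :: "nat \<Rightarrow> ('g, 'r, ('r fin_univ, 'r) univ) gr_module" and d \<epsilon> where "V 0 = U"
    "\<And>j. gr_presented G R (Suc m) (V j)"
    "\<And>j. gr_free_resolution G R (V j) (\<lambda>i. P (j + i)) (\<lambda>i. d (j + i)) (\<epsilon> j)"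
    "\<And>j. special_gr_presented G R (Suc m) (V (Suc j + m))"
proof -
  let ?n = "Suc m"
  let ?step = "\<lambda>W F e W'. fg_gr_free G R F \<and> gr_hom G R F W e \<and> e ` carrier F = carrier W \<and> W' = gr_kernel F W e"
  have "\<exists>V. \<forall>j. (gr_presented G R ?n (V j) \<and> (j = 0 \<longrightarrow> V j = U)) \<and> (\<exists>F e. ?step (V j) F e (V (Suc j)))"
  proof (rule dependent_nat_choice)
    show "\<exists>W. gr_presented G R ?n W \<and> (0 = 0 \<longrightarrow> W = U)" using U by blast
    fix W :: "('g, 'r, 'r fin_univ) gr_module" and j :: nat assume "gr_presented G R ?n W \<and> (j = 0 \<longrightarrow> W = U)"
    then obtain F e where "fg_gr_free G R F" "gr_hom G R F W e" "e ` carrier F = carrier W" "gr_presented G R ?n (gr_kernel F W e)"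
      using coherent_syzygy[OF gr coh] by blast
    then show "\<exists>W'. (gr_presented G R ?n W' \<and> (Suc j = 0 \<longrightarrow> W' = U)) \<and> (\<exists>F e. ?step W F e W')" by blast
  qed
  then obtain V where V': "\<forall>j. (gr_presented G R ?n (V j) \<and> (j = 0 \<longrightarrow> V j = U)) \<and> (\<exists>F e. ?step (V j) F e (V (Suc j)))"
    by (rule exE)
  have V: "gr_presented G R ?n (V j)" "V 0 = U" for j using spec[OF V', of j] spec[OF V', of 0] by auto
  have "\<forall>j. \<exists>F e. ?step (V j) F e (V (Suc j))" using V' by (intro allI) (elim allE conjE)
  then have "\<exists>F. \<forall>j. \<exists>e. ?step (V j) (F j) e (V (Suc j))" by (rule choice)
  then obtain F where "\<forall>j. \<exists>e. ?step (V j) (F j) e (V (Suc j))" by (rule exE)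
  then have "\<exists>e. \<forall>j. ?step (V j) (F j) (e j) (V (Suc j))" by (rule choice)
  then obtain e where Fe: "\<forall>j. ?step (V j) (F j) (e j) (V (Suc j))" by (rule exE)
  have F: "fg_gr_free G R (F j)" and e: "gr_hom G R (F j) (V j) (e j)"
    "e j ` carrier (F j) = carrier (V j)" and VS: "V (Suc j) = gr_kernel (F j) (V j) (e j)" for j
    using spec[OF Fe, of j] by auto
  have lF: "left_gr_module G R (F j)" for j using F[of j] by (simp add: fg_gr_free_def)
  have lV: "left_gr_module G R (V j)" for j
    using V(1)[of j] by (auto simp: gr_presented_def gr_presentation_def)
  have pF: "gr_premodule G R (F j)" for j by (rule left_gr_module_premodule[OF lF])
  have e': "gr_hom G R (F (Suc j)) (F j) (e (Suc j))" for j
    using gr_hom_from_kernel[of G R "F (Suc j)" "F j"] e(1)[of "Suc j"] unfolding VS .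
  have im: "e (Suc j) ` carrier (F (Suc j)) = a_kernel (F j) (V j) (e j)" for j
    using e(2)[of "Suc j"] by (simp add: VS)
  let ?copy = "\<lambda>F (P :: ('g, 'r, ('r fin_univ, 'r) univ) gr_module) f g. (\<exists>B \<delta>. \<delta> \<in> B \<rightarrow> carrier G \<and> P = gr_free G R B \<delta>) \<and>
    gr_hom G R F P f \<and> gr_hom G R P F g \<and> (\<forall>x\<in>carrier F. g (f x) = x) \<and> (\<forall>y\<in>carrier P. f (g y) = y)"
  have "\<forall>j. \<exists>P f g. ?copy (F j) P f g"
  proof
    fix j
    show "\<exists>P f g. ?copy (F j) P f g"
    proof (rule fg_gr_free_copy[OF gr F[of j]])
      fix P f g assume "\<exists>B \<delta>. \<delta> \<in> B \<rightarrow> carrier G \<and> (P :: ('g, 'r, ('r fin_univ, 'r) univ) gr_module) = gr_free G R B \<delta>"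
        "gr_hom G R (F j) P f" "gr_hom G R P (F j) g" "\<And>x. x \<in> carrier (F j) \<Longrightarrow> g (f x) = x"
        "\<And>y. y \<in> carrier P \<Longrightarrow> f (g y) = y"
      then have "?copy (F j) P f g" by (intro conjI ballI)
      then show ?thesis by (intro exI)
    qed
  qed
  then have "\<exists>P. \<forall>j. \<exists>f g. ?copy (F j) (P j) f g" by (rule choice)
  then obtain P where "\<forall>j. \<exists>f g. ?copy (F j) (P j) f g" by (rule exE)
  then have "\<exists>f. \<forall>j. \<exists>g. ?copy (F j) (P j) (f j) g" by (rule choice)
  then obtain \<theta> where "\<forall>j. \<exists>g. ?copy (F j) (P j) (\<theta> j) g" by (rule exE)
  then have "\<exists>g. \<forall>j. ?copy (F j) (P j) (\<theta> j) (g j)" by (rule choice)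
  then obtain \<eta> where copy: "\<forall>j. ?copy (F j) (P j) (\<theta> j) (\<eta> j)" by (rule exE)
  have P: "\<exists>B \<delta>. \<delta> \<in> B \<rightarrow> carrier G \<and> P j = gr_free G R B \<delta>" for j
    by (rule conjunct1[OF spec[OF copy, of j]])
  have \<theta>: "gr_hom G R (F j) (P j) (\<theta> j)" for j
    by (rule conjunct1[OF conjunct2[OF spec[OF copy, of j]]])
  have \<eta>: "gr_hom G R (P j) (F j) (\<eta> j)" for j
    by (rule conjunct1[OF conjunct2[OF conjunct2[OF spec[OF copy, of j]]]])
  have \<eta>\<theta>: "\<eta> j (\<theta> j x) = x" if "x \<in> carrier (F j)" for j x using spec[OF copy, of j] that by blast
  have \<theta>\<eta>: "\<theta> j (\<eta> j y) = y" if "y \<in> carrier (P j)" for j y using spec[OF copy, of j] that by blast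
  have lP: "left_gr_module G R (P j)" for j 
  proof -
    obtain B \<delta> where "\<delta> \<in> B \<rightarrow> carrier G" "P j = gr_free G R B \<delta>" using P[of j] by blast
    then show ?thesis using gr_free_left_gr_module[OF gr] by simp
  qed
  have \<theta>c: "\<theta> j x \<in> carrier (P j)" if "x \<in> carrier (F j)" for j x by (rule lin_map_closed[OF gr_hom_lin[OF \<theta>] that])
  have \<eta>c: "\<eta> j y \<in> carrier (F j)" if "y \<in> carrier (P j)" for j y by (rule lin_map_closed[OF gr_hom_lin[OF \<eta>] that])
  have \<eta>im: "\<eta> j ` carrier (P j) = carrier (F j)" for j 
  proof
    show "carrier (F j) \<subseteq> \<eta> j ` carrier (P j)" using \<theta>c \<eta>\<theta> by (metis imageI subsetI)
  qed (use \<eta>c in blast)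
  define \<epsilon> where "\<epsilon> = (\<lambda>j y. e j (\<eta> j y))"
  define d where "d = (\<lambda>j y. \<theta> j (\<epsilon> (Suc j) y))"
  have \<epsilon>: "gr_hom G R (P j) (V j) (\<epsilon> j)" for j unfolding \<epsilon>_def by (rule gr_hom_comp[OF \<eta> e(1)])
  have \<epsilon>F: "gr_hom G R (P (Suc j)) (F j) (\<epsilon> (Suc j))" for j unfolding \<epsilon>_def by (rule gr_hom_comp[OF \<eta> e'])
  have dh: "gr_hom G R (P (Suc j)) (P j) (d j)" for j unfolding d_def by (rule gr_hom_comp[OF \<epsilon>F \<theta>])
  have \<epsilon>im: "\<epsilon> j ` carrier (P j) = carrier (V j)" for j
  proof -
    have "\<epsilon> j ` carrier (P j) = e j ` (\<eta> j ` carrier (P j))" by (simp add: \<epsilon>_def image_image)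
    then show ?thesis by (simp add: \<eta>im e(2))
  qed
  have dim: "d j ` carrier (P (Suc j)) = a_kernel (P j) (V j) (\<epsilon> j)" for j
  proof -
    have "d j ` carrier (P (Suc j)) = \<theta> j ` (\<epsilon> (Suc j) ` carrier (P (Suc j)))" by (simp add: d_def image_image)
    also have "\<dots> = \<theta> j ` a_kernel (F j) (V j) (e j)" by (simp only: \<epsilon>im VS gr_kernel_simps)
    also have "\<dots> = a_kernel (P j) (V j) (\<epsilon> j)"
    proof
      show "\<theta> j ` a_kernel (F j) (V j) (e j) \<subseteq> a_kernel (P j) (V j) (\<epsilon> j)"
        using \<theta>c \<eta>\<theta> by (auto simp: a_kernel_iff \<epsilon>_def)
      show "a_kernel (P j) (V j) (\<epsilon> j) \<subseteq> \<theta> j ` a_kernel (F j) (V j) (e j)"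
      proof
        fix y assume "y \<in> a_kernel (P j) (V j) (\<epsilon> j)"
        then have "y \<in> carrier (P j)" "\<eta> j y \<in> a_kernel (F j) (V j) (e j)" using \<eta>c by (auto simp: a_kernel_iff \<epsilon>_def)
        then show "y \<in> \<theta> j ` a_kernel (F j) (V j) (e j)" using \<theta>\<eta> by (metis imageI)
      qed
    qed
    finally show ?thesis .
  qed
  have dker: "a_kernel (P (Suc j)) (P j) (d j) = a_kernel (P (Suc j)) (V (Suc j)) (\<epsilon> (Suc j))" for j
  proof -
    have ag: "abelian_group (P j)" "abelian_group (F j)"
      using gr_premoduleD(2)[OF left_gr_module_premodule[OF lP]] gr_premoduleD(2)[OF pF] by auto
    have "d j y = \<zero>\<^bsub>P j\<^esub> \<longleftrightarrow> \<epsilon> (Suc j) y = \<zero>\<^bsub>F j\<^esub>" if "y \<in> carrier (P (Suc j))" for y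
      using \<eta>\<theta>[OF lin_map_closed[OF gr_hom_lin[OF \<epsilon>F] that]] lin_map_zero[OF ag(2,1) gr_hom_lin[OF \<theta>]]
        lin_map_zero[OF ag gr_hom_lin[OF \<eta>]] by (auto simp: d_def)
    then show ?thesis by (auto simp: a_kernel_iff VS)
  qed
  show ?thesis
  proof (rule that[of V P d \<epsilon>])
    show "V 0 = U" by (rule V(2))
    show "gr_presented G R ?n (V j)" for j by (rule V(1))
    show "gr_free_resolution G R (V j) (\<lambda>i. P (j + i)) (\<lambda>i. d (j + i)) (\<epsilon> j)" for j
      unfolding gr_free_resolution_def gr_resolution_def
      using lP dh \<epsilon> \<epsilon>im dim dker P by simp
    show "special_gr_presented G R ?n (V (Suc j + m))" for j
    proof -
      let ?X = "\<lambda>i. if i = 0 then V (Suc j) else F (j + i)"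
      let ?d = "\<lambda>i. e (Suc j + i)"
      have "gr_presentation G R ?n ?X ?d"
        unfolding gr_presentation_def
      proof (intro conjI allI impI)
        show "gr_hom G R (?X (Suc i)) (?X i) (?d i)" for i using e(1)[of "Suc j"] e'[of "j + i"] by (cases i) auto
        show "?d 0 ` carrier (?X 1) = carrier (?X 0)" using e(2)[of "Suc j"] by simp
        show "?d (Suc i) ` carrier (?X (Suc (Suc i))) = a_kernel (?X (Suc i)) (?X i) (?d i)" for i
          using im[of "Suc (j + i)"] by (cases i) (auto simp: a_kernel_def' VS)
      qed (use F lV in auto)
      moreover have "V (Suc j + m) = gr_image (?X ?n) (?X (?n - 1)) (?d (?n - 1))"
      proof (cases m)
        case 0
        then show ?thesis using e(2)[of "Suc j"] by (simp add: gr_image_def VS gr_kernel_def Int_assoc)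
      next
        case (Suc k)
        then show ?thesis using im[of "j + m"] by (simp add: gr_image_def VS gr_kernel_def)
      qed
      ultimately show ?thesis unfolding special_gr_presented_def by blast
    qed
  qed
qed

section \<open>Dimension shifting along an exact complex\<close>

text \<open>
  The choice in \<open>chosen_resolution\<close> is meaningful as soon as some free resolution exists in its type.
\<close>

lemma chosen_resolution_ex:
  fixes M :: "('g, 'r, 'm) gr_module" and P :: "nat \<Rightarrow> ('g, 'r, ('m, 'r) univ) gr_module"
  assumes "gr_free_resolution G R M P d \<epsilon>"
  obtains P' d' \<epsilon>' where "chosen_resolution G R M = (P', d')" "gr_free_resolution G R M P' d' \<epsilon>'"
proof -
  let ?res = "\<lambda>(P :: nat \<Rightarrow> ('g, 'r, ('m, 'r) univ) gr_module, d). \<exists>\<epsilon>. gr_free_resolution G R M P d \<epsilon>"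
  have "\<exists>p. ?res p" using assms by (intro exI[of _ "(P, d)"]) auto
  then have "?res (chosen_resolution G R M)" unfolding chosen_resolution_def by (rule someI_ex)
  then show ?thesis using that by (cases "chosen_resolution G R M") auto
qed

lemma EXT_trivial_iff_resolution:
  fixes M :: "('g, 'r, 'm) gr_module" and P :: "nat \<Rightarrow> ('g, 'r, ('m, 'r) univ) gr_module"
  assumes gr: "graded_ring G R" and M: "left_gr_module G R M" and N: "gr_premodule G R N"
    and P: "gr_free_resolution G R M P d \<epsilon>"
  shows "trivial_group (EXT G R (Suc i) M N) \<longleftrightarrow> ext_vanishes G R P d i N"
proof -
  obtain P' d' \<epsilon>' where ch: "chosen_resolution G R M = (P', d')" and P': "gr_free_resolution G R M P' d' \<epsilon>'"
    by (rule chosen_resolution_ex[OF P]) (rule that)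
  have "gr_resolution G R M P' d' \<epsilon>'" using P' by (simp add: gr_free_resolution_def)
  from EXT_trivial_iff[OF gr N ch this] show ?thesis
    using ext_vanishes_independent[OF gr M P P' N] ext_vanishes_independent[OF gr M P' P N] by blast
qed

lemma Tor_trivial_iff_resolution:
  fixes M :: "('g, 'r, 'm) gr_module" and P :: "nat \<Rightarrow> ('g, 'r, ('m, 'r) univ) gr_module"
  assumes gr: "graded_ring G R" and M: "left_gr_module G R M" and N: "pre_module R N"
    and P: "gr_free_resolution G R M P d \<epsilon>"
  shows "trivial_group (Tor G R (Suc i) N M) \<longleftrightarrow> tor_vanishes R P d i N"
proof -
  obtain P' d' \<epsilon>' where ch: "chosen_resolution G R M = (P', d')" and P': "gr_free_resolution G R M P' d' \<epsilon>'"
    by (rule chosen_resolution_ex[OF P]) (rule that)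
  have "gr_resolution G R M P' d' \<epsilon>'" using P' by (simp add: gr_free_resolution_def)
  from Tor_trivial_iff[OF N ch this] show ?thesis
    using tor_vanishes_independent[OF gr M P P' N] tor_vanishes_independent[OF gr M P' P N] by blast
qed

text \<open>
  A Gorenstein module is given only up to isomorphism as the cycles of its complex.
\<close>

lemma ext_vanishes_iso:
  assumes gr: "graded_ring G R" and M: "gr_premodule G R M" and Z: "gr_premodule G R Z"
    and f: "gr_hom G R M Z f" "inj_on f (carrier M)" "f ` carrier M = carrier Z"
    and van: "ext_vanishes G R P d i Z"
  shows "ext_vanishes G R P d i M"
  unfolding ext_vanishes_def
proof (intro ballI allI impI, elim conjE)
  interpret G: group G using gr by (simp add: graded_ring_def)
  obtain g where g: "gr_hom G R Z M g" "\<And>x. x \<in> carrier M \<Longrightarrow> g (f x) = x"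
    using gr_hom_inverse[OF M Z f(1)] f(2,3) unfolding bij_betw_def by metis
  fix \<sigma> c assume \<sigma>: "\<sigma> \<in> carrier G" and c: "deg_hom G R \<sigma> (P (Suc i)) M c"
    and cz: "\<forall>x\<in>carrier (P (Suc (Suc i))). c (d (Suc i) x) = \<zero>\<^bsub>M\<^esub>"
  have "f (c (d (Suc i) x)) = \<zero>\<^bsub>Z\<^esub>" if "x \<in> carrier (P (Suc (Suc i)))" for x
    using cz that lin_map_zero[OF gr_premoduleD(2)[OF M] gr_premoduleD(2)[OF Z] gr_hom_lin[OF f(1)]] by simp
  then obtain h where h: "deg_hom G R \<sigma> (P i) Z h" "\<And>x. x \<in> carrier (P (Suc i)) \<Longrightarrow> f (c x) = h (d i x)"
    by (rule ext_vanishesD[OF van \<sigma> deg_hom_comp_gr_hom[OF c f(1) G.is_group \<sigma>]]) (assumption, rule that)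
  have "c x = g (h (d i x))" if "x \<in> carrier (P (Suc i))" for x
    using h(2)[OF that] g(2)[OF lin_map_closed[OF deg_hom_lin[OF c] that]] by metis
  then show "\<exists>h. deg_hom G R \<sigma> (P i) M h \<and> (\<forall>x\<in>carrier (P (Suc i)). c x = h (d i x))"
    using deg_hom_comp_gr_hom[OF h(1) g(1) G.is_group \<sigma>] by blast
qed

definition cycles :: "(int \<Rightarrow> ('g, 'r, 'm) gr_module) \<Rightarrow> (int \<Rightarrow> 'm \<Rightarrow> 'm) \<Rightarrow> int \<Rightarrow> ('g, 'r, 'm) gr_module" where
  "cycles A d s = gr_kernel (A s) (A (s + 1)) (d s)"

lemma gr_exact_complexD:
  assumes "gr_exact_complex G R A d"
  shows "gr_hom G R (A s) (A (s + 1)) (d s)" "d s ` carrier (A s) = carrier (cycles A d (s + 1))"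
  using assms by (auto simp: gr_exact_complex_def cycles_def add.assoc)

text \<open>
  An exact complex is spliced together from the short exact sequences
  \<open>0 \<rightarrow> cycles s \<rightarrow> A s \<rightarrow> cycles (s + 1) \<rightarrow> 0\<close>.
\<close>

lemma cycles_short_exact:
  assumes ex: "gr_exact_complex G R A d" and A: "\<And>s. gr_premodule G R (A s)"
  shows "gr_hom G R (cycles A d s) (A s) (\<lambda>x. x)" "inj_on (\<lambda>x. x) (carrier (cycles A d s))"
    "gr_hom G R (A s) (cycles A d (s + 1)) (d s)" "d s ` carrier (A s) = carrier (cycles A d (s + 1))"
    "(\<lambda>x. x) ` carrier (cycles A d s) = a_kernel (A s) (cycles A d (s + 1)) (d s)"
proof -
  show "gr_hom G R (cycles A d s) (A s) (\<lambda>x. x)"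
    by (auto simp: cycles_def gr_hom_def lin_map_def a_kernel_iff)
  show "gr_hom G R (A s) (cycles A d (s + 1)) (d s)"
    unfolding cycles_def
    by (rule gr_hom_to_kernel[OF gr_exact_complexD(1)[OF ex] _ A]) (use gr_exact_complexD(2)[OF ex, of s] in \<open>simp add: cycles_def\<close>)
  show "d s ` carrier (A s) = carrier (cycles A d (s + 1))" by (rule gr_exact_complexD(2)[OF ex])
  show "(\<lambda>x. x) ` carrier (cycles A d s) = a_kernel (A s) (cycles A d (s + 1)) (d s)"
    by (auto simp: cycles_def a_kernel_iff)
qed simp

lemma cycles_left:
  assumes "graded_ring G R" "gr_exact_complex G R A d" "\<And>s. left_gr_module G R (A s)"
  shows "left_gr_module G R (cycles A d s)"
  unfolding cycles_def by (rule gr_kernel_left[OF assms(1,3,3) gr_exact_complexD(1)[OF assms(2)]])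

lemma cycles_right:
  assumes "graded_ring G R" "gr_exact_complex G R A d" "\<And>s. right_gr_module G R (A s)"
  shows "right_gr_module G R (cycles A d s)"
  unfolding cycles_def by (rule gr_kernel_right[OF assms(1,3,3) gr_exact_complexD(1)[OF assms(2)]])

lemma right_gr_module_right_action: "right_gr_module G R M \<Longrightarrow> right_action R M"
  by (simp add: right_gr_module_def right_action_def)

text \<open>
  Extracts from a bound on a homological dimension the place at which the dimension is attained.
\<close>

lemma Inf_enat_le_imp_witness:
  assumes "Inf {enat k | k. Q k} \<le> enat b"
  obtains k where "k \<le> b" "Q k"
proof -
  have ne: "{enat k | k. Q k} \<noteq> {}"
  proof
    assume "{enat k | k. Q k} = {}"
    then have "Inf {enat k | k. Q k} = Inf ({} :: enat set)" by (simp only:)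
    also have "\<dots> = \<infinity>" by (simp add: Inf_enat_def)
    finally show False using assms by simp
  qed
  then have "Inf {enat k | k. Q k} \<in> {enat k | k. Q k}"
    unfolding Inf_enat_def using LeastI_ex[of "\<lambda>x. x \<in> {enat k | k. Q k}"] by auto
  then show ?thesis using assms that by auto
qed

lemma finite_Sup_enat_bound:
  assumes "Sup {f M | M. Q M} < \<infinity>"
  obtains b where "\<And>M. Q M \<Longrightarrow> f M \<le> enat b"
proof -
  obtain b where b: "Sup {f M | M. Q M} = enat b" using assms by (cases "Sup {f M | M. Q M}") auto
  have "f M \<le> enat b" if "Q M" for M unfolding b[symmetric] by (rule Sup_upper) (use that in blast)
  then show ?thesis by (rule that)
qed

text \<open>
  The vanishing in degree \<open>n + b + 1\<close> for all left modules descends to degree \<open>n\<close> for the cycles of the complex, by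
  moving to the left in the complex once for each degree.
\<close>

lemma FP_gr_injective_if_Gorenstein:
  fixes M :: "('g, 'r, 'm) gr_module"
  assumes gr: "graded_ring G R" and coh: "left_gr_coherent G R (Suc m)"
    and dim: "l_FP_gr_dim G R (Suc m) TYPE('m) < \<infinity>" and Gor: "Gorenstein_FP_gr_injective G R (Suc m) M"
  shows "FP_gr_injective G R (Suc m) M"
proof -
  obtain A :: "int \<Rightarrow> ('g, 'r, 'm) gr_module" and D where A: "\<And>s. FP_gr_injective G R (Suc m) (A s)"
    and ex: "gr_exact_complex G R A D" and ker: "is_gr_kernel G R M (A 0) (A 1) (D 0)" and M: "left_gr_module G R M"
    using Gor unfolding Gorenstein_FP_gr_injective_def by blast
  have lA: "left_gr_module G R (A s)" for s using A[of s] by (simp add: FP_gr_injective_def)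
  have pA: "gr_premodule G R (A s)" for s by (rule left_gr_module_premodule[OF lA])
  let ?Z = "cycles A D"
  have lZ: "left_gr_module G R (?Z s)" for s by (rule cycles_left[OF gr ex lA])
  note ses = cycles_short_exact[OF ex pA]
  obtain b where b: "\<And>L :: ('g, 'r, 'm) gr_module. left_gr_module G R L \<Longrightarrow> FP_gr_id G R (Suc m) L \<le> enat b"
    by (rule finite_Sup_enat_bound[OF dim[unfolded l_FP_gr_dim_def]]) (rule that)
  have "trivial_group (EXT G R (Suc m) U M)" if U: "gr_presented G R (Suc m) U" for U
  proof (rule coherent_resolution[OF gr coh U])
    fix V :: "nat \<Rightarrow> ('g, 'r, 'r fin_univ) gr_module" and P :: "nat \<Rightarrow> ('g, 'r, ('r fin_univ, 'r) univ) gr_module" and d \<epsilon>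
    assume V0: "V 0 = U" and V: "\<And>j. gr_presented G R (Suc m) (V j)"
      and P: "\<And>j. gr_free_resolution G R (V j) (\<lambda>i. P (j + i)) (\<lambda>i. d (j + i)) (\<epsilon> j)"
      and sp: "\<And>j. special_gr_presented G R (Suc m) (V (Suc j + m))"
    have lV: "left_gr_module G R (V j)" for j using V[of j] by (auto simp: gr_presented_def gr_presentation_def)
    have iff: "trivial_group (EXT G R (Suc i) (V j) N) \<longleftrightarrow> ext_vanishes G R P d (j + i) N"
      if "left_gr_module G R N" for i j and N :: "('g, 'r, 'm) gr_module"
      using EXT_trivial_iff_resolution[OF gr lV left_gr_module_premodule[OF that] P[of j], of i]
      by (simp add: ext_vanishes_def)
    have vA: "ext_vanishes G R P d (m + j) (A s)" for j s
      using A[of s] V[of j] iff[OF lA[of s], of m j] by (simp add: FP_gr_injective_def add.commute)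
    \<comment> \<open>The dimension \<open>k\<close> of \<open>L\<close> may be smaller than \<open>b\<close>; testing with the syzygy \<open>b - k\<close> steps later
      moves the vanishing to a degree that is the same for all \<open>L\<close>.\<close>
    have top: "ext_vanishes G R P d (m + Suc b) L" if L: "left_gr_module G R L" for L :: "('g, 'r, 'm) gr_module"
    proof -
      obtain k where k: "k \<le> b" "\<And>K. special_gr_presented G R (Suc m) K \<Longrightarrow> trivial_group (EXT G R (k + 1) K L)"
        using Inf_enat_le_imp_witness[OF b[OF L, unfolded FP_gr_id_def]] by metis
      have "ext_vanishes G R P d (Suc (b - k) + m + k) L"
        using iff[OF L, of k "Suc (b - k) + m"] k(2)[OF sp[of "b - k"]] by simp
      moreover have "Suc (b - k) + m + k = m + Suc b" using k(1) by simp
      ultimately show ?thesis by (simp only:)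
    qed
    have P0: "gr_free_resolution G R (V 0) P d (\<epsilon> 0)" using P[of 0] by simp
    then have res: "gr_resolution G R (V 0) P d (\<epsilon> 0)" and free: "\<And>i. \<exists>B \<delta>. \<delta> \<in> B \<rightarrow> carrier G \<and> P i = gr_free G R B \<delta>"
      by (auto simp: gr_free_resolution_def)
    have "ext_vanishes G R P d (m + (Suc b - t)) (?Z s)" if "t \<le> Suc b" for t s
      using that
    proof (induction t arbitrary: s)
      case 0
      then show ?case using top[OF lZ] by simp
    next
      case (Suc t)
      have eq: "Suc b - t = Suc (Suc b - Suc t)" using Suc.prems by simp
      have "ext_vanishes G R P d (m + (Suc b - Suc t)) (?Z (s - 1 + 1))"
      proof (rule ext_vanishes_quotient[where P = P and d = d, OF gr free gr_resolutionD(2)[OF res] gr_resolution_dd[OF res]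
            lZ[of "s - 1"] lA[of "s - 1"] lZ[of "s - 1 + 1"] ses[of "s - 1"]])
        show "ext_vanishes G R P d (Suc (m + (Suc b - Suc t))) (?Z (s - 1))"
          using Suc.IH[of "s - 1"] Suc.prems unfolding eq by simp
        show "ext_vanishes G R P d (m + (Suc b - Suc t)) (A (s - 1))" by (rule vA)
      qed
      then show ?case by simp
    qed
    from this[of "Suc b" 0] have Z0: "ext_vanishes G R P d m (?Z 0)" by simp
    obtain \<iota> where \<iota>: "gr_hom G R M (A 0) \<iota>" "inj_on \<iota> (carrier M)" "\<iota> ` carrier M = a_kernel (A 0) (A 1) (D 0)"
      using ker unfolding is_gr_kernel_def by blast
    have "gr_hom G R M (?Z 0) \<iota>" "\<iota> ` carrier M = carrier (?Z 0)"
      using gr_hom_to_kernel[OF \<iota>(1) equalityD1[OF \<iota>(3)] left_gr_module_premodule[OF M]] \<iota>(3) by (auto simp: cycles_def)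
    then have "ext_vanishes G R P d m M"
      using ext_vanishes_iso[OF gr left_gr_module_premodule[OF M] left_gr_module_premodule[OF lZ] _ \<iota>(2) _ Z0] by blast
    then show "trivial_group (EXT G R (Suc m) U M)" using iff[OF M, of m 0] V0 by simp
  qed
  then show ?thesis using M by (simp add: FP_gr_injective_def)
qed

text \<open>
  Dual to the previous lemma: Tor is covariant in the right module, so the cycles are embedded rather than covered, and one
  moves to the right in the complex.
\<close>

lemma n_gr_flat_if_Gorenstein:
  fixes N :: "('g, 'r, 'm) gr_module"
  assumes gr: "graded_ring G R" and coh: "left_gr_coherent G R (Suc m)"
    and dim: "r_gr_dim G R (Suc m) TYPE('m) < \<infinity>" and Gor: "Gorenstein_gr_flat G R (Suc m) N"
  shows "n_gr_flat G R (Suc m) N"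
proof -
  obtain A :: "int \<Rightarrow> ('g, 'r, 'm) gr_module" and D where A: "\<And>s. n_gr_flat G R (Suc m) (A s)"
    and ex: "gr_exact_complex G R A D" and ker: "is_gr_kernel G R N (A 0) (A 1) (D 0)" and N: "right_gr_module G R N"
    using Gor unfolding Gorenstein_gr_flat_def by blast
  have Rr: "ring R" using gr by (simp add: graded_ring_def)
  have lA: "right_gr_module G R (A s)" for s using A[of s] by (simp add: n_gr_flat_def)
  have pA: "gr_premodule G R (A s)" for s by (rule right_gr_module_premodule[OF lA])
  let ?Z = "cycles A D"
  have lZ: "right_gr_module G R (?Z s)" for s by (rule cycles_right[OF gr ex lA])
  note ses = cycles_short_exact[OF ex pA] and ra = right_gr_module_right_action
  obtain b where b: "\<And>L :: ('g, 'r, 'm) gr_module. right_gr_module G R L \<Longrightarrow> n_gr_fd G R (Suc m) L \<le> enat b"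
    by (rule finite_Sup_enat_bound[OF dim[unfolded r_gr_dim_def]]) (rule that)
  have "trivial_group (Tor G R (Suc m) N U)" if U: "gr_presented G R (Suc m) U" for U
  proof (rule coherent_resolution[OF gr coh U])
    fix V :: "nat \<Rightarrow> ('g, 'r, 'r fin_univ) gr_module" and P :: "nat \<Rightarrow> ('g, 'r, ('r fin_univ, 'r) univ) gr_module" and d \<epsilon>
    assume V0: "V 0 = U" and V: "\<And>j. gr_presented G R (Suc m) (V j)"
      and P: "\<And>j. gr_free_resolution G R (V j) (\<lambda>i. P (j + i)) (\<lambda>i. d (j + i)) (\<epsilon> j)"
      and sp: "\<And>j. special_gr_presented G R (Suc m) (V (Suc j + m))"
    have lV: "left_gr_module G R (V j)" for j using V[of j] by (auto simp: gr_presented_def gr_presentation_def)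
    have iff: "trivial_group (Tor G R (Suc i) L (V j)) \<longleftrightarrow> tor_vanishes R P d (j + i) L"
      if "right_gr_module G R L" for i j and L :: "('g, 'r, 'm) gr_module"
      using Tor_trivial_iff_resolution[OF gr lV gr_premoduleD(1)[OF right_gr_module_premodule[OF that]] P[of j], of i]
      by (simp add: tor_vanishes_def)
    have vA: "tor_vanishes R P d (m + j) (A s)" for j s
      using A[of s] V[of j] iff[OF lA[of s], of m j] by (simp add: n_gr_flat_def add.commute)
    \<comment> \<open>As for EXT, a later syzygy compensates for a dimension \<open>k\<close> smaller than \<open>b\<close>.\<close>
    have top: "tor_vanishes R P d (m + Suc b) L" if L: "right_gr_module G R L" for L :: "('g, 'r, 'm) gr_module"
    proof -
      obtain k where k: "k \<le> b" "\<And>K. special_gr_presented G R (Suc m) K \<Longrightarrow> trivial_group (Tor G R (k + 1) L K)"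
        using Inf_enat_le_imp_witness[OF b[OF L, unfolded n_gr_fd_def]] by metis
      have "tor_vanishes R P d (Suc (b - k) + m + k) L"
        using iff[OF L, of k "Suc (b - k) + m"] k(2)[OF sp[of "b - k"]] by simp
      moreover have "Suc (b - k) + m + k = m + Suc b" using k(1) by simp
      ultimately show ?thesis by (simp only:)
    qed
    have P0: "gr_free_resolution G R (V 0) P d (\<epsilon> 0)" using P[of 0] by simp
    then have res: "gr_resolution G R (V 0) P d (\<epsilon> 0)" and free: "\<And>i. \<exists>B \<delta>. \<delta> \<in> B \<rightarrow> carrier G \<and> P i = gr_free G R B \<delta>"
      by (auto simp: gr_free_resolution_def)
    note sub = tor_vanishes_submodule[where P = P and d = d, OF Rr free gr_hom_lin[OF gr_resolutionD(2)[OF res]] gr_resolution_dd[OF res]]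
    have "tor_vanishes R P d (m + (Suc b - t)) (?Z s)" if "t \<le> Suc b" for t s
      using that
    proof (induction t arbitrary: s)
      case 0
      then show ?case using top[OF lZ] by simp
    next
      case (Suc t)
      have eq: "Suc b - t = Suc (Suc b - Suc t)" using Suc.prems by simp
      show ?case
      proof (rule sub[OF _ ra[OF lZ[of s]] ra[OF lA[of s]] ra[OF lZ[of "s + 1"]] gr_hom_lin[OF ses(1)[of s]] ses(2)[of s]
            gr_hom_lin[OF ses(3)[of s]] ses(4,5)[of s]])
        show "tor_vanishes R P d (Suc (m + (Suc b - Suc t))) (?Z (s + 1))"
          using Suc.IH[of "s + 1"] Suc.prems unfolding eq by simp
        show "tor_vanishes R P d (m + (Suc b - Suc t)) (A s)" by (rule vA)
      qed
    qed
    from this[of b 1] have Z1: "tor_vanishes R P d (Suc m) (?Z (0 + 1))" by simp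
    obtain \<iota> where \<iota>: "gr_hom G R N (A 0) \<iota>" "inj_on \<iota> (carrier N)" "\<iota> ` carrier N = a_kernel (A 0) (A 1) (D 0)"
      using ker unfolding is_gr_kernel_def by blast
    have "\<iota> ` carrier N = a_kernel (A 0) (?Z (0 + 1)) (D 0)"
      using \<iota>(3) ses(5)[of 0] by (simp add: cycles_def)
    then have "tor_vanishes R P d m N"
      by (intro sub[OF _ ra[OF N] ra[OF lA[of 0]] ra[OF lZ[of "0 + 1"]] gr_hom_lin[OF \<iota>(1)] \<iota>(2)
          gr_hom_lin[OF ses(3)[of 0]] ses(4)[of 0] _ Z1]) (use vA[of 0 0] in simp_all)
    then show "trivial_group (Tor G R (Suc m) N U)" using iff[OF N, of m 0] V0 by simp
  qed
  then show ?thesis using N by (simp add: n_gr_flat_def)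
qed

theorem proposition3p18:
  fixes G :: "'g monoid" and R :: "('g, 'r) gr_ring" and n :: nat
  assumes "graded_ring G R" and "n \<ge> 1" and "left_gr_coherent G R n"
  shows "(l_FP_gr_dim G R n TYPE('m) < \<infinity> \<longrightarrow>
            (\<forall>M :: ('g, 'r, 'm) gr_module.
               Gorenstein_FP_gr_injective G R n M \<longrightarrow> FP_gr_injective G R n M)) \<and>
         (r_gr_dim G R n TYPE('k) < \<infinity> \<longrightarrow>
            (\<forall>N :: ('g, 'r, 'k) gr_module.
               Gorenstein_gr_flat G R n N \<longrightarrow> n_gr_flat G R n N))"
proof -
  obtain m where n: "n = Suc m" using assms(2) by (cases n) auto
  show ?thesis
    using FP_gr_injective_if_Gorenstein[OF assms(1) assms(3)[unfolded n]]
      n_gr_flat_if_Gorenstein[OF assms(1) assms(3)[unfolded n]] unfolding n by blast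
qed

end
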